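(* Let $V = \bigoplus_{i=1}^k S_i^{\oplus e_i}$ be a semisimple $n$-dimensional complex representation of $B_3$, where the $S_i$ are pairwise non-isomorphic simple representations and $e_i\geq 1$. Suppose that $V$ is a singular point of $\mathrm{rep}_n B_3$ such that at least one of the following holds: (1) there exist $1 \leq i < j \leq k$ with $\mathrm{Ext}^1_{B_3}(S_i,S_j) \neq 0$; or (2) there exists $1 \leq i \leq k$ with $\dim S_i \geq 3$ and $e_i \geq 2$. Then $V$ lies on the intersection of two distinct irreducible components of $\mathrm{rep}_n B_3$.
   Context: $B_3 = \langle X,Y \mid X^2 = Y^3\rangle$ is the braid group on 3 strands. All representations are finite-dimensional over $\mathbb{C}$; $\mathrm{Ext}^1_{B_3}$ means $\mathrm{Ext}^1$ over the group algebra $\mathbb{C}B_3$. The representation variety is $\mathrm{rep}_n B_3 = \{(A,B) \in \mathrm{GL}_n(\mathbb{C}) \times \mathrm{GL}_n(\mathbb{C}) \mid A^2 = B^3\}$, on which $\mathrm{PGL}_n(\mathbb{C})$ acts by simultaneous conjugation. Its tangent spaces are those defined by the equations $A^2=B^3$, so that $T_V \mathrm{rep}_n B_3 / T_V \mathcal{O}(V) \cong \mathrm{Ext}^1_{B_3}(V,V)$, where $\mathcal{O}(V)$ is the $\mathrm{PGL}_n(\mathbb{C})$-orbit of $V$; a singular point is a point that is not smooth. *)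

theory Defs
  imports
    "HOL-Analysis.Abstract_Topology"
    "HOL-Library.Extended_Nat"
    "Jordan_Normal_Form.VS_Connect"
begin

section \<open>Representations of the braid group on three strands\<close>

text \<open>
  Since \<open>B\<^sub>3 = \<langle>X, Y | X\<^sup>2 = Y\<^sup>3\<rangle>\<close>, a representation of \<open>B\<^sub>3\<close> on \<open>\<complex>\<^sup>n\<close>, i.e. an \<open>n\<close>-dimensional
  module over the group algebra with a chosen basis, is the pair of images of \<open>X\<close> and \<open>Y\<close>.
\<close>

type_synonym b3_rep = "complex mat \<times> complex mat"

definition rep_variety :: "nat \<Rightarrow> b3_rep set" where
  "rep_variety n = {(A, B). A \<in> carrier_mat n n \<and> B \<in> carrier_mat n n \<and>
     invertible_mat A \<and> invertible_mat B \<and> A ^\<^sub>m 2 = B ^\<^sub>m 3}"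

definition rep_dim :: "b3_rep \<Rightarrow> nat" where
  "rep_dim V = dim_row (fst V)"

definition is_rep :: "b3_rep \<Rightarrow> bool" where
  "is_rep V \<longleftrightarrow> V \<in> rep_variety (rep_dim V)"

definition rep_hom :: "b3_rep \<Rightarrow> b3_rep \<Rightarrow> complex mat set" where
  "rep_hom V W = {P \<in> carrier_mat (rep_dim W) (rep_dim V).
     P * fst V = fst W * P \<and> P * snd V = snd W * P}"

definition rep_iso :: "b3_rep \<Rightarrow> b3_rep \<Rightarrow> bool" where
  "rep_iso V W \<longleftrightarrow> (\<exists>P \<in> rep_hom V W. invertible_mat P)"

text \<open>
  Stability is stated with equality of images, so that it covers the action of the inverses of the
  generators.
\<close>

definition subrep :: "complex vec set \<Rightarrow> b3_rep \<Rightarrow> bool" where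
  "subrep U V \<longleftrightarrow> subspace class_ring U (module_vec TYPE(complex) (rep_dim V)) \<and>
     (\<lambda>u. fst V *\<^sub>v u) ` U = U \<and> (\<lambda>u. snd V *\<^sub>v u) ` U = U"

definition simple_rep :: "b3_rep \<Rightarrow> bool" where
  "simple_rep V \<longleftrightarrow> is_rep V \<and> rep_dim V > 0 \<and>
     (\<forall>U. subrep U V \<longrightarrow> U = {0\<^sub>v (rep_dim V)} \<or> U = carrier_vec (rep_dim V))"

definition direct_sum_reps :: "b3_rep list \<Rightarrow> b3_rep" where
  "direct_sum_reps Vs = (diag_block_mat (map fst Vs), diag_block_mat (map snd Vs))"

text \<open>The direct sum of \<open>e i\<close> copies of \<open>S i\<close>, for \<open>i\<close> from \<open>1\<close> to \<open>k\<close>.\<close>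

definition isotypic_sum :: "nat \<Rightarrow> (nat \<Rightarrow> b3_rep) \<Rightarrow> (nat \<Rightarrow> nat) \<Rightarrow> b3_rep" where
  "isotypic_sum k S e = direct_sum_reps (concat (map (\<lambda>i. replicate (e i) (S i)) [1..<Suc k]))"


section \<open>Extensions\<close>

text \<open>
  Yoneda \<open>Ext\<^sup>1(V, W)\<close> over the group algebra: equivalence classes of short exact sequences
  \<open>0 \<rightarrow> W \<rightarrow> E \<rightarrow> V \<rightarrow> 0\<close>. An extension of finite-dimensional modules is finite-dimensional, so after
  a choice of basis the middle term is again a pair of matrices. The zero of \<open>Ext\<^sup>1(V, W)\<close> is the
  class of the split sequence.
\<close>

type_synonym b3_extension = "b3_rep \<times> complex mat \<times> complex mat"

definition extensions :: "b3_rep \<Rightarrow> b3_rep \<Rightarrow> b3_extension set" where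
  "extensions V W = {(E, i, p). is_rep E \<and> i \<in> rep_hom W E \<and> p \<in> rep_hom E V \<and>
     inj_on (\<lambda>w. i *\<^sub>v w) (carrier_vec (rep_dim W)) \<and>
     (\<lambda>w. i *\<^sub>v w) ` carrier_vec (rep_dim W)
       = {x \<in> carrier_vec (rep_dim E). p *\<^sub>v x = 0\<^sub>v (rep_dim V)} \<and>
     (\<lambda>x. p *\<^sub>v x) ` carrier_vec (rep_dim E) = carrier_vec (rep_dim V)}"

definition extension_equiv :: "b3_rep \<Rightarrow> b3_rep \<Rightarrow> (b3_extension \<times> b3_extension) set" where
  "extension_equiv V W = {((E, i, p), (E', i', p')).
     (E, i, p) \<in> extensions V W \<and> (E', i', p') \<in> extensions V W \<and>
     (\<exists>f \<in> rep_hom E E'. invertible_mat f \<and> f * i = i' \<and> p' * f = p)}"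

definition split_extension :: "b3_rep \<Rightarrow> b3_rep \<Rightarrow> b3_extension" where
  "split_extension V W =
    (let m = rep_dim V; l = rep_dim W in
     (direct_sum_reps [W, V],
      1\<^sub>m l @\<^sub>r 0\<^sub>m m l,
      transpose_mat (0\<^sub>m l m @\<^sub>r 1\<^sub>m m)))"

definition Ext1 :: "b3_rep \<Rightarrow> b3_rep \<Rightarrow> b3_extension set set" where
  "Ext1 V W = extensions V W // extension_equiv V W"

definition Ext1_zero :: "b3_rep \<Rightarrow> b3_rep \<Rightarrow> b3_extension set" where
  "Ext1_zero V W = extension_equiv V W `` {split_extension V W}"


section \<open>The Zariski topology\<close>

inductive_set poly_funs :: "nat \<Rightarrow> (b3_rep \<Rightarrow> complex) set" for n :: nat where
  const: "(\<lambda>_. c) \<in> poly_funs n"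
| fst_entry: "\<lbrakk>i < n; j < n\<rbrakk> \<Longrightarrow> (\<lambda>V. fst V $$ (i, j)) \<in> poly_funs n"
| snd_entry: "\<lbrakk>i < n; j < n\<rbrakk> \<Longrightarrow> (\<lambda>V. snd V $$ (i, j)) \<in> poly_funs n"
| add: "\<lbrakk>p \<in> poly_funs n; q \<in> poly_funs n\<rbrakk> \<Longrightarrow> (\<lambda>V. p V + q V) \<in> poly_funs n"
| mult: "\<lbrakk>p \<in> poly_funs n; q \<in> poly_funs n\<rbrakk> \<Longrightarrow> (\<lambda>V. p V * q V) \<in> poly_funs n"

text \<open>
  The regular functions on \<open>GL\<^sub>n \<times> GL\<^sub>n\<close> are the polynomials in the entries divided by powers of the
  determinants; the numerators alone define the same closed sets.
\<close>

definition rep_zariski :: "nat \<Rightarrow> b3_rep topology" where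
  "rep_zariski n =
    topology (\<lambda>U. \<exists>P \<subseteq> poly_funs n. U = {V \<in> rep_variety n. \<exists>p \<in> P. p V \<noteq> 0})"

lemma istopology_rep_zariski:
  "istopology (\<lambda>U. \<exists>P \<subseteq> poly_funs n. U = {V \<in> rep_variety n. \<exists>p \<in> P. p V \<noteq> 0})"
proof -
  define D :: "(b3_rep \<Rightarrow> complex) set \<Rightarrow> b3_rep set"
    where "D P = {V \<in> rep_variety n. \<exists>p \<in> P. p V \<noteq> 0}" for P
  have D_Int: "D P \<inter> D P' = D ((\<lambda>(p, q) V. p V * q V) ` (P \<times> P'))" for P P'
    by (auto simp: D_def)
  have D_Union: "\<Union> (D ` \<P>) = D (\<Union>\<P>)" for \<P>
    by (auto simp: D_def)
  have mult: "(\<lambda>(p, q) V. p V * q V) ` (P \<times> P') \<subseteq> poly_funs n"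
    if "P \<subseteq> poly_funs n" "P' \<subseteq> poly_funs n" for P P'
    using that by (auto intro: poly_funs.mult)
  have "istopology (\<lambda>U. \<exists>P \<subseteq> poly_funs n. U = D P)"
    unfolding istopology_def
  proof (rule conjI; intro allI impI)
    fix U U' assume "\<exists>P \<subseteq> poly_funs n. U = D P" "\<exists>P \<subseteq> poly_funs n. U' = D P"
    then obtain P P' where P: "P \<subseteq> poly_funs n" "U = D P" "P' \<subseteq> poly_funs n" "U' = D P'"
      by (elim exE conjE)
    show "\<exists>P \<subseteq> poly_funs n. U \<inter> U' = D P"
      using mult[OF P(1,3)] D_Int[of P P'] unfolding P(2,4) by (intro exI conjI)
  next
    fix K assume "\<forall>U \<in> K. \<exists>P \<subseteq> poly_funs n. U = D P"
    then obtain f where f: "\<forall>U \<in> K. f U \<subseteq> poly_funs n \<and> U = D (f U)"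
      by (elim bchoice[THEN exE])
    then have "\<Union>K = \<Union> (D ` (f ` K))" by (simp add: image_image)
    then have "\<Union>K = D (\<Union> (f ` K))" by (simp only: D_Union)
    moreover have "\<Union> (f ` K) \<subseteq> poly_funs n" using f by (intro UN_least) simp
    ultimately show "\<exists>P \<subseteq> poly_funs n. \<Union>K = D P" by (intro exI conjI)
  qed
  then show ?thesis by (simp only: D_def)
qed

lemma openin_rep_zariski:
  "openin (rep_zariski n) U \<longleftrightarrow>
    (\<exists>P \<subseteq> poly_funs n. U = {V \<in> rep_variety n. \<exists>p \<in> P. p V \<noteq> 0})"
  unfolding rep_zariski_def by (simp only: topology_inverse'[OF istopology_rep_zariski])

lemma topspace_rep_zariski: "topspace (rep_zariski n) = rep_variety n"
proof (rule antisym)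
  have "{\<lambda>_. 1} \<subseteq> poly_funs n" by (simp add: poly_funs.const)
  moreover have "rep_variety n = {V \<in> rep_variety n. \<exists>p \<in> {\<lambda>_. 1}. p V \<noteq> (0 :: complex)}" by simp
  ultimately have "openin (rep_zariski n) (rep_variety n)"
    unfolding openin_rep_zariski by (intro exI conjI)
  then show "rep_variety n \<subseteq> topspace (rep_zariski n)" by (rule openin_subset)
  have "openin (rep_zariski n) (topspace (rep_zariski n))" by (rule openin_topspace)
  then show "topspace (rep_zariski n) \<subseteq> rep_variety n"
    unfolding openin_rep_zariski by (elim exE conjE) simp
qed

lemma closedin_rep_zariski:
  "closedin (rep_zariski n) Z \<longleftrightarrow>
    (\<exists>P \<subseteq> poly_funs n. Z = {V \<in> rep_variety n. \<forall>p \<in> P. p V = 0})"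
proof -
  have "Z \<subseteq> rep_variety n \<and> rep_variety n - Z = {V \<in> rep_variety n. \<exists>p \<in> P. p V \<noteq> 0} \<longleftrightarrow>
      Z = {V \<in> rep_variety n. \<forall>p \<in> P. p V = 0}" for P
    by (rule iffI; blast)
  note eq = this[symmetric]
  show ?thesis
    unfolding closedin_def topspace_rep_zariski openin_rep_zariski eq by blast
qed

definition irreducible_space :: "'a topology \<Rightarrow> bool" where
  "irreducible_space X \<longleftrightarrow> topspace X \<noteq> {} \<and>
     (\<forall>C D. closedin X C \<and> closedin X D \<and> topspace X = C \<union> D
        \<longrightarrow> C = topspace X \<or> D = topspace X)"

definition irreducible_in :: "'a topology \<Rightarrow> 'a set \<Rightarrow> bool" where
  "irreducible_in X S \<longleftrightarrow> S \<subseteq> topspace X \<and> irreducible_space (subtopology X S)"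

definition irreducible_component :: "'a topology \<Rightarrow> 'a set \<Rightarrow> bool" where
  "irreducible_component X Z \<longleftrightarrow> irreducible_in X Z \<and>
     (\<forall>W. irreducible_in X W \<and> Z \<subseteq> W \<longrightarrow> W = Z)"

text \<open>
  For a variety and a closed point \<open>x\<close> this is the Krull dimension of the local ring at \<open>x\<close>, whose
  primes correspond to the irreducible closed subsets through \<open>x\<close>.
\<close>

definition local_dim :: "'a topology \<Rightarrow> 'a \<Rightarrow> enat" where
  "local_dim X x = (SUP d \<in> {d. \<exists>Z :: nat \<Rightarrow> 'a set.
     (\<forall>i \<le> d. closedin X (Z i) \<and> irreducible_in X (Z i) \<and> x \<in> Z i) \<and>
     (\<forall>i < d. Z i \<subset> Z (Suc i))}. enat d)"


section \<open>Tangent spaces and singular points\<close>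

text \<open>
  The tangent space at \<open>(A, B)\<close> is cut out by the differential of the equations \<open>A\<^sup>2 = B\<^sup>3\<close>: it
  consists of the \<open>(M, N)\<close> for which \<open>(A + \<epsilon> M)\<^sup>2 = (B + \<epsilon> N)\<^sup>3\<close> modulo \<open>\<epsilon>\<^sup>2\<close>. The invertibility
  conditions are open and impose nothing. The fields \<open>mult\<close> and \<open>one\<close> play no role in a module.
\<close>

definition tangent_space :: "nat \<Rightarrow> b3_rep \<Rightarrow> (complex, complex mat \<times> complex mat) module" where
  "tangent_space n V = (case V of (A, B) \<Rightarrow>
    \<lparr>carrier = {(M, N). M \<in> carrier_mat n n \<and> N \<in> carrier_mat n n \<and>
        A * M + M * A = N * B * B + B * N * B + B * B * N},
     mult = undefined, one = undefined,
     zero = (0\<^sub>m n n, 0\<^sub>m n n),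
     add = (\<lambda>(M, N) (M', N'). (M + M', N + N')),
     smult = (\<lambda>c (M, N). (c \<cdot>\<^sub>m M, c \<cdot>\<^sub>m N))\<rparr>)"

definition smooth_point :: "nat \<Rightarrow> b3_rep \<Rightarrow> bool" where
  "smooth_point n V \<longleftrightarrow> V \<in> rep_variety n \<and>
     local_dim (rep_zariski n) V = enat (vectorspace.dim class_ring (tangent_space n V))"

definition singular_point :: "nat \<Rightarrow> b3_rep \<Rightarrow> bool" where
  "singular_point n V \<longleftrightarrow> V \<in> rep_variety n \<and> \<not> smooth_point n V"

end

theory Submission
  imports Defs "Jordan_Normal_Form.Char_Poly" "HOL-Computational_Algebra.Fundamental_Theorem_Algebra"
begin

text \<open>
  Let \<open>m\<close> be the number of simple summands of \<open>V\<close>, counted with multiplicity, and let \<open>C = A\<^sup>2 = B\<^sup>3\<close>,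
  which is central. Twisting the summands by independent scalars gives a curve through \<open>V\<close> on which \<open>C\<close>
  generically has \<open>m\<close> different eigenvalues, so that \<open>1, C, \<dots>, C\<^bsup>m-1\<^esup>\<close> are linearly independent
  endomorphisms. Under either hypothesis the sum of two of the summands is a limit of representations
  whose only endomorphisms are scalars: of the nonsplit extension in case (1), and of conjugates of one
  of the two generators in case (2), where \<open>dim S \<ge> 3\<close> makes the self-extensions of \<open>S\<close> on which \<open>C\<close> stays
  scalar at least two-dimensional. Twisting again gives a second curve through \<open>V\<close>, whose generic
  endomorphism ring has dimension at most \<open>m - 1\<close>. Both generic conditions are open and they exclude
  each other, so no irreducible set contains both curves.
\<close>

section \<open>The ring of finitely supported matrices\<close>

text \<open>A nonsplit extension of \<open>S\<close> by itself does not serve in case (2): it has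
  the nilpotent endomorphism through its quotient and its sub, so at least two dimensions of
  endomorphisms remain. To first order the deformations of S + S are 2 x 2 matrices over Ext^1(S,
  S), and an endomorphism in M_2 survives only if it commutes with all their coefficient matrices.
  One class offers a single coefficient matrix, whose commutant is at least two-dimensional; two
  independent classes can be put in opposite corners, and only scalars commute with both. This is
  why two-dimensional self-extensions are wanted. Let a_i and b_j be the eigenvalue multiplicities
  on S of the images of X and Y, and d = dim S. With \<open>C\<close> scalar the algebra is, up to
  rescaling, that of the free product Z/2 * Z/3, and Ext^1(S, S) over it has dimension 1 + d^2 - sum
  a_i^2 - sum b_j^2. Simplicity gives a_i + b_j <= d, and d >= 3 makes all three b_j positive; this
  brings the dimension to at least 2. All curves are polynomial in one parameter, which makes their
  irreducibility elementary and removes any need to compute the dimension of a component.\<close>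

text \<open>
  Matrices of all sizes form one ring, so that products need no size conditions. The predicates
  \<open>rw n\<close> and \<open>cl n\<close> bound the number of rows and columns, and \<open>E n\<close> acts as the identity from the left
  and from the right on the matrices that satisfy them.
\<close>

typedef fmat = "{f :: nat \<Rightarrow> nat \<Rightarrow> complex. \<exists>n. \<forall>i j. i \<ge> n \<or> j \<ge> n \<longrightarrow> f i j = 0}"
  morphisms ent Abs_fmat
  by (intro exI[of _ "\<lambda>_ _. 0"]) simp

lemma ent_bounded: "\<exists>n. \<forall>i j. i \<ge> n \<or> j \<ge> n \<longrightarrow> ent x i j = 0"
  using ent[of x] by simp

lemma fmat_eqI: "(\<And>i j. ent x i j = ent y i j) \<Longrightarrow> x = y"
  by (simp add: ent_inject[symmetric] fun_eq_iff)

definition Fm :: "nat \<Rightarrow> nat \<Rightarrow> (nat \<Rightarrow> nat \<Rightarrow> complex) \<Rightarrow> fmat" where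
  "Fm n m f = Abs_fmat (\<lambda>i j. if i < n \<and> j < m then f i j else 0)"

lemma ent_Fm [simp]: "ent (Fm n m f) i j = (if i < n \<and> j < m then f i j else 0)"
proof -
  have "(\<lambda>i j. if i < n \<and> j < m then f i j else 0)
      \<in> {f. \<exists>n. \<forall>i j. i \<ge> n \<or> j \<ge> n \<longrightarrow> f i j = 0}"
    by (auto intro!: exI[of _ "max n m"])
  from Abs_fmat_inverse[OF this] show ?thesis by (simp add: Fm_def)
qed

definition rw :: "nat \<Rightarrow> fmat \<Rightarrow> bool" where
  "rw n x \<longleftrightarrow> (\<forall>i j. i \<ge> n \<longrightarrow> ent x i j = 0)"

definition cl :: "nat \<Rightarrow> fmat \<Rightarrow> bool" where
  "cl m x \<longleftrightarrow> (\<forall>i j. j \<ge> m \<longrightarrow> ent x i j = 0)"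

abbreviation sz :: "nat \<Rightarrow> nat \<Rightarrow> fmat \<Rightarrow> bool" where
  "sz n m x \<equiv> rw n x \<and> cl m x"

lemma sz_ex: "\<exists>n. sz n n x"
  using ent_bounded[of x] unfolding rw_def cl_def by blast

lemma rw_mono: "rw n x \<Longrightarrow> n \<le> n' \<Longrightarrow> rw n' x"
  unfolding rw_def by (meson le_trans)

lemma cl_mono: "cl n x \<Longrightarrow> n \<le> n' \<Longrightarrow> cl n' x"
  unfolding cl_def by (meson le_trans)

lemma sz_Fm [simp, intro]: "sz n m (Fm n m f)"
  by (auto simp: rw_def cl_def)

lemma sz_eqI:
  assumes "sz n m x" "sz n m y" "\<And>i j. i < n \<Longrightarrow> j < m \<Longrightarrow> ent x i j = ent y i j"
  shows "x = y"
  by (rule fmat_eqI) (metis assms rw_def cl_def not_le)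

instantiation fmat :: "{zero, plus, minus, uminus, times}"
begin

definition zero_fmat where "0 = Fm 0 0 (\<lambda>_ _. 0)"
definition plus_fmat where "x + y = Abs_fmat (\<lambda>i j. ent x i j + ent y i j)"
definition minus_fmat where "x - y = Abs_fmat (\<lambda>i j. ent x i j - ent y i j)"
definition uminus_fmat where "- x = Abs_fmat (\<lambda>i j. - ent x i j)"
text \<open>Only the support of row \<open>i\<close> of \<open>x\<close> is summed over, a finite
  sum that mentions no size.\<close>

definition times_fmat where
  "x * y = Abs_fmat (\<lambda>i j. \<Sum>k | ent x i k \<noteq> 0. ent x i k * ent y k j)"

instance ..

end

definition sc :: "complex \<Rightarrow> fmat \<Rightarrow> fmat" where
  "sc c x = Abs_fmat (\<lambda>i j. c * ent x i j)"

definition E :: "nat \<Rightarrow> fmat" where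
  "E n = Fm n n (\<lambda>i j. if i = j then 1 else 0)"

lemma ent_Abs:
  assumes "\<And>i j. i \<ge> n \<or> j \<ge> n \<Longrightarrow> f i j = 0"
  shows "ent (Abs_fmat f) i j = f i j"
proof -
  have "f \<in> {f. \<exists>n. \<forall>i j. i \<ge> n \<or> j \<ge> n \<longrightarrow> f i j = 0}"
    using assms by blast
  from Abs_fmat_inverse[OF this] show ?thesis by simp
qed

lemma ent_0 [simp]: "ent 0 i j = 0"
  by (simp add: zero_fmat_def)

lemma common_bound: "\<exists>n. sz n n x \<and> sz n n y"
proof -
  obtain a b where "sz a a x" "sz b b y" using sz_ex by metis
  then have "sz (max a b) (max a b) x" "sz (max a b) (max a b) y"
    by (auto intro: rw_mono cl_mono)
  then show ?thesis by blast
qed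

lemma ent_add [simp]: "ent (x + y) i j = ent x i j + ent y i j"
proof -
  obtain n where "sz n n x" "sz n n y" using common_bound by blast
  then show ?thesis unfolding plus_fmat_def by (intro ent_Abs[of n]) (auto simp: rw_def cl_def)
qed

lemma ent_diff [simp]: "ent (x - y) i j = ent x i j - ent y i j"
proof -
  obtain n where "sz n n x" "sz n n y" using common_bound by blast
  then show ?thesis unfolding minus_fmat_def by (intro ent_Abs[of n]) (auto simp: rw_def cl_def)
qed

lemma ent_uminus [simp]: "ent (- x) i j = - ent x i j"
proof -
  obtain n where "sz n n x" using sz_ex by blast
  then show ?thesis unfolding uminus_fmat_def by (intro ent_Abs[of n]) (auto simp: rw_def cl_def)
qed

lemma ent_sc [simp]: "ent (sc c x) i j = c * ent x i j"
proof -
  obtain n where "sz n n x" using sz_ex by blast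
  then show ?thesis unfolding sc_def by (intro ent_Abs[of n]) (auto simp: rw_def cl_def)
qed

lemma ent_E [simp]: "ent (E n) i j = (if i < n \<and> i = j then 1 else 0)"
  by (auto simp: E_def)

lemma ent_times_supp: "ent (x * y) i j = (\<Sum>k | ent x i k \<noteq> 0. ent x i k * ent y k j)"
proof -
  obtain n where "sz n n x" "sz n n y" using common_bound by blast
  then show ?thesis unfolding times_fmat_def by (intro ent_Abs[of n]) (auto simp: rw_def cl_def)
qed

lemma ent_times: "sz n m x \<Longrightarrow> ent (x * y) i j = (\<Sum>k<m. ent x i k * ent y k j)"
  unfolding ent_times_supp
  by (rule sum.mono_neutral_left) (auto simp: rw_def cl_def not_less[symmetric])

lemma ent_times':
  assumes "sz n m y" shows "ent (x * y) i j = (\<Sum>k<n. ent x i k * ent y k j)"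
proof -
  obtain N where N: "sz N N x" using sz_ex by blast
  have "ent (x * y) i j = (\<Sum>k<max N n. ent x i k * ent y k j)"
    by (rule ent_times[of N]) (use N in \<open>auto intro: rw_mono cl_mono\<close>)
  also have "\<dots> = (\<Sum>k<n. ent x i k * ent y k j)"
    by (rule sum.mono_neutral_right) (use assms in \<open>auto simp: rw_def cl_def\<close>)
  finally show ?thesis .
qed

instance fmat :: ring
proof
  fix x y z :: fmat
  show "x + y + z = x + (y + z)" "x + y = y + x" "0 + x = x" "- x + x = 0" "x - y = x + - y"
    by (rule fmat_eqI; simp)+
  obtain n where x: "sz n n x" using sz_ex by blast
  obtain m where y: "sz m m y" using sz_ex by blast
  have xy: "sz n m (x * y)"
    using x y by (auto simp: rw_def cl_def ent_times[OF x] ent_times'[OF y])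
  show "x * y * z = x * (y * z)"
  proof (rule fmat_eqI)
    fix i j
    have "ent (x * y * z) i j = (\<Sum>l<m. \<Sum>k<n. ent x i k * (ent y k l * ent z l j))"
      by (simp add: ent_times[OF xy] ent_times[OF x] sum_distrib_right mult.assoc)
    also have "\<dots> = (\<Sum>k<n. \<Sum>l<m. ent x i k * (ent y k l * ent z l j))"
      by (rule sum.swap)
    also have "\<dots> = ent (x * (y * z)) i j"
      by (simp add: ent_times[OF x] ent_times[OF y] sum_distrib_left)
    finally show "ent (x * y * z) i j = ent (x * (y * z)) i j" .
  qed
  show "x * (y + z) = x * y + x * z"
    by (rule fmat_eqI) (simp add: ent_times[OF x] sum.distrib algebra_simps)
  obtain k where z: "sz k k z" using sz_ex by blast
  show "(x + y) * z = x * z + y * z"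
    by (rule fmat_eqI) (simp add: ent_times'[OF z] sum.distrib algebra_simps)
qed

lemma rw_simps [simp]:
  "rw n 0" "rw n (E n)" "rw n x \<Longrightarrow> rw n y \<Longrightarrow> rw n (x + y)" "rw n x \<Longrightarrow> rw n y \<Longrightarrow> rw n (x - y)"
  "rw n (- x) = rw n x" "rw n x \<Longrightarrow> rw n (sc c x)" "rw n x \<Longrightarrow> rw n (x * y)"
  by (auto simp: rw_def ent_times_supp)

lemma cl_simps [simp]:
  "cl n 0" "cl n (E n)" "cl n x \<Longrightarrow> cl n y \<Longrightarrow> cl n (x + y)" "cl n x \<Longrightarrow> cl n y \<Longrightarrow> cl n (x - y)"
  "cl n (- x) = cl n x" "cl n x \<Longrightarrow> cl n (sc c x)" "cl n y \<Longrightarrow> cl n (x * y)"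
  by (auto simp: cl_def ent_times_supp)

lemma ent_sum [simp]: "ent (\<Sum>a\<in>S. f a) i j = (\<Sum>a\<in>S. ent (f a) i j)"
  by (induction S rule: infinite_finite_induct) auto

lemma rw_sum [simp]: "(\<And>a. a \<in> S \<Longrightarrow> rw n (f a)) \<Longrightarrow> rw n (\<Sum>a\<in>S. f a)"
  by (simp add: rw_def)

lemma cl_sum [simp]: "(\<And>a. a \<in> S \<Longrightarrow> cl n (f a)) \<Longrightarrow> cl n (\<Sum>a\<in>S. f a)"
  by (simp add: cl_def)

lemma sz_mult: "sz n k x \<Longrightarrow> sz l m y \<Longrightarrow> sz n m (x * y)"
  by simp

lemma E_left [simp]:
  assumes "rw n x" shows "E n * x = x"
proof (rule fmat_eqI)
  fix i j
  have "sz n n (E n)" by simp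
  then have "ent (E n * x) i j = (\<Sum>k<n. ent (E n) i k * ent x k j)" by (rule ent_times)
  also have "\<dots> = (\<Sum>k<n. if k = i then ent x k j else 0)"
    by (rule sum.cong) auto
  also have "\<dots> = ent x i j"
    using assms by (auto simp: rw_def sum.delta)
  finally show "ent (E n * x) i j = ent x i j" .
qed

lemma E_right [simp]:
  assumes "cl m x" shows "x * E m = x"
proof (rule fmat_eqI)
  fix i j
  have "sz m m (E m)" by simp
  then have "ent (x * E m) i j = (\<Sum>k<m. ent x i k * ent (E m) k j)" by (rule ent_times')
  also have "\<dots> = (\<Sum>k<m. if k = j then ent x i k else 0)"
    by (rule sum.cong) auto
  also have "\<dots> = ent x i j"
    using assms by (auto simp: cl_def sum.delta)
  finally show "ent (x * E m) i j = ent x i j" .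
qed

lemma E_right_assoc [simp]: "cl m x \<Longrightarrow> x * (E m * y) = x * y"
  by (simp add: mult.assoc[symmetric])

lemma sc_mult_left [simp]: "sc c x * y = sc c (x * y)"
proof (rule fmat_eqI)
  obtain n where x: "sz n n x" using sz_ex by blast
  have x': "sz n n (sc c x)" using x by simp
  show "ent (sc c x * y) i j = ent (sc c (x * y)) i j" for i j
    by (simp add: ent_times[OF x] ent_times[OF x'] sum_distrib_left mult.assoc)
qed

lemma sc_mult_right [simp]: "x * sc c y = sc c (x * y)"
proof (rule fmat_eqI)
  obtain n where x: "sz n n x" using sz_ex by blast
  show "ent (x * sc c y) i j = ent (sc c (x * y)) i j" for i j
    by (simp add: ent_times[OF x] sum_distrib_left mult_ac)
qed

lemma sc_sc [simp]: "sc a (sc b x) = sc (a * b) x" by (rule fmat_eqI) simp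
lemma sc_1 [simp]: "sc 1 x = x" by (rule fmat_eqI) simp
lemma sc_0 [simp]: "sc 0 x = 0" by (rule fmat_eqI) simp
lemma sc_zero [simp]: "sc c 0 = 0" by (rule fmat_eqI) simp
lemma sc_add: "sc c (x + y) = sc c x + sc c y" by (rule fmat_eqI) (simp add: algebra_simps)
lemma sc_diff: "sc c (x - y) = sc c x - sc c y" by (rule fmat_eqI) (simp add: algebra_simps)
lemma sc_add_left: "sc (a + b) x = sc a x + sc b x" by (rule fmat_eqI) (simp add: algebra_simps)
lemma sc_diff_left: "sc (a - b) x = sc a x - sc b x" by (rule fmat_eqI) (simp add: algebra_simps)
lemma sc_uminus_left: "sc (- a) x = - sc a x" by (rule fmat_eqI) simp
lemma sc_sum: "sc c (\<Sum>a\<in>S. f a) = (\<Sum>a\<in>S. sc c (f a))" by (rule fmat_eqI) (simp add: sum_distrib_left)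

lemma sc_eq_0_iff [simp]: "sc c x = 0 \<longleftrightarrow> c = 0 \<or> x = 0"
proof
  assume h: "sc c x = 0"
  show "c = 0 \<or> x = 0"
  proof (cases "c = 0")
    case False
    then have "x = sc (1/c) (sc c x)" by simp
    then show ?thesis using h by simp
  qed simp
qed auto

lemma sc_cancel: "c \<noteq> 0 \<Longrightarrow> sc c x = sc c y \<Longrightarrow> x = y"
  by (metis eq_iff_diff_eq_0 sc_diff sc_eq_0_iff)

section \<open>The trace of a finitely supported matrix\<close>

definition tr :: "fmat \<Rightarrow> complex" where
  "tr x = (\<Sum>i | ent x i i \<noteq> 0. ent x i i)"

lemma tr_eq: "sz n m x \<Longrightarrow> tr x = (\<Sum>i<n. ent x i i)"
  unfolding tr_def by (rule sum.mono_neutral_left) (auto simp: rw_def cl_def not_less[symmetric])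

lemma tr_add: "tr (x + y) = tr x + tr y"
proof -
  obtain n where n: "sz n n x" "sz n n y" using common_bound by blast
  then have "sz n n (x + y)" by simp
  from tr_eq[OF this] tr_eq[OF n(1)] tr_eq[OF n(2)] show ?thesis by (simp add: sum.distrib)
qed

lemma tr_sc: "tr (sc c x) = c * tr x"
proof -
  obtain n where n: "sz n n x" using sz_ex by blast
  then have "sz n n (sc c x)" by simp
  from tr_eq[OF this] tr_eq[OF n(1)] show ?thesis by (simp add: sum_distrib_left)
qed

lemma tr_0 [simp]: "tr 0 = 0" by (simp add: tr_def)

lemma tr_uminus: "tr (- x) = - tr x"
  using tr_sc[of "-1" x] by (simp add: sc_uminus_left)

lemma tr_diff: "tr (x - y) = tr x - tr y"
  using tr_add[of x "- y"] by (simp add: tr_uminus)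

text \<open>Together with \<open>tr_mult_commute\<close> this compares sizes:
  \<open>P * Q = E m\<close> and \<open>Q * P = E n\<close> give m = n, because the complex numbers
  have characteristic zero. In the same way the trace of an idempotent counts its rank.\<close>

lemma tr_E [simp]: "tr (E n) = of_nat n"
  by (simp add: tr_eq[of n "E n" n])

lemma tr_mult_commute: "tr (x * y) = tr (y * x)"
proof -
  obtain n where n: "sz n n x" "sz n n y" using common_bound by blast
  then have "sz n n (x * y)" "sz n n (y * x)" by simp_all
  from tr_eq[OF this(1)] tr_eq[OF this(2)] have
    "tr (x * y) = (\<Sum>i<n. \<Sum>k<n. ent x i k * ent y k i)"
    "tr (y * x) = (\<Sum>k<n. \<Sum>i<n. ent y k i * ent x i k)"
    by (simp_all add: ent_times[OF n(1)] ent_times[OF n(2)])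
  then show ?thesis
    using sum.swap[of "\<lambda>i k. ent x i k * ent y k i" "{..<n}" "{..<n}"] by (simp add: mult.commute)
qed

subsection \<open>Comparison with matrices of fixed size\<close>

definition of_mat :: "complex mat \<Rightarrow> fmat" where
  "of_mat A = Fm (dim_row A) (dim_col A) (\<lambda>i j. A $$ (i, j))"

definition to_mat :: "nat \<Rightarrow> nat \<Rightarrow> fmat \<Rightarrow> complex mat" where
  "to_mat n m x = mat n m (\<lambda>(i, j). ent x i j)"

lemma rw_of_mat [simp]: "dim_row A = n \<Longrightarrow> rw n (of_mat A)"
  by (auto simp: of_mat_def)

lemma cl_of_mat [simp]: "dim_col A = n \<Longrightarrow> cl n (of_mat A)"
  by (auto simp: of_mat_def)

lemma sz_of_mat: "A \<in> carrier_mat n m \<Longrightarrow> sz n m (of_mat A)"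
  by auto

lemma ent_of_mat: "A \<in> carrier_mat n m \<Longrightarrow> i < n \<Longrightarrow> j < m \<Longrightarrow> ent (of_mat A) i j = A $$ (i, j)"
  by (auto simp: of_mat_def)

lemma to_mat_carrier [simp]: "to_mat n m x \<in> carrier_mat n m"
  by (simp add: to_mat_def)

lemma of_to_mat [simp]: "sz n m x \<Longrightarrow> of_mat (to_mat n m x) = x"
  by (rule sz_eqI[where n = n and m = m]) (auto simp: of_mat_def to_mat_def)

lemma to_of_mat [simp]: "A \<in> carrier_mat n m \<Longrightarrow> to_mat n m (of_mat A) = A"
  by (rule eq_matI) (auto simp: of_mat_def to_mat_def)

lemma of_mat_inj: "A \<in> carrier_mat n m \<Longrightarrow> B \<in> carrier_mat n m \<Longrightarrow> of_mat A = of_mat B \<Longrightarrow> A = B"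
  by (metis to_of_mat)

lemma of_mat_mult:
  assumes A: "A \<in> carrier_mat n m" and B: "B \<in> carrier_mat m k"
  shows "of_mat (A * B) = of_mat A * of_mat B"
proof (rule sz_eqI[where n = n and m = k])
  show "sz n k (of_mat (A * B))" "sz n k (of_mat A * of_mat B)" using A B by auto
  fix i j assume ij: "i < n" "j < k"
  have "ent (of_mat A * of_mat B) i j = (\<Sum>l<m. ent (of_mat A) i l * ent (of_mat B) l j)"
    by (rule ent_times[OF sz_of_mat[OF A]])
  also have "\<dots> = (\<Sum>l<m. A $$ (i, l) * B $$ (l, j))"
    using ij by (intro sum.cong) (auto simp: ent_of_mat[OF A] ent_of_mat[OF B])
  also have "\<dots> = (A * B) $$ (i, j)"
    using A B ij by (auto simp: scalar_prod_def atLeast0LessThan)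
  finally show "ent (of_mat (A * B)) i j = ent (of_mat A * of_mat B) i j"
    using ent_of_mat[of "A * B" n k] A B ij by auto
qed

lemma of_mat_one [simp]: "of_mat (1\<^sub>m n) = E n"
  by (rule sz_eqI[where n = n and m = n]) (auto simp: of_mat_def)

lemma of_mat_zero [simp]: "of_mat (0\<^sub>m n m) = 0"
  by (rule sz_eqI[where n = n and m = m]) (auto simp: of_mat_def)

definition of_vec :: "complex vec \<Rightarrow> fmat" where
  "of_vec v = Fm (dim_vec v) 1 (\<lambda>i _. v $ i)"

definition to_vec :: "nat \<Rightarrow> fmat \<Rightarrow> complex vec" where
  "to_vec n x = vec n (\<lambda>i. ent x i 0)"

lemma sz_of_vec [simp, intro]: "v \<in> carrier_vec n \<Longrightarrow> sz n 1 (of_vec v)"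
  using carrier_vecD[of v n] by (simp only: of_vec_def sz_Fm)

lemma to_vec_carrier [simp]: "to_vec n x \<in> carrier_vec n"
  by (simp add: to_vec_def)

lemma of_to_vec [simp]: "sz n 1 x \<Longrightarrow> of_vec (to_vec n x) = x"
  by (rule sz_eqI[where n = n and m = 1]) (auto simp: of_vec_def to_vec_def rw_def cl_def)

lemma to_of_vec [simp]: "v \<in> carrier_vec n \<Longrightarrow> to_vec n (of_vec v) = v"
  by (rule eq_vecI) (auto simp: of_vec_def to_vec_def)

lemma of_vec_inj: "v \<in> carrier_vec n \<Longrightarrow> w \<in> carrier_vec n \<Longrightarrow> of_vec v = of_vec w \<Longrightarrow> v = w"
  by (metis to_of_vec)

lemma of_vec_mult:
  assumes A: "A \<in> carrier_mat n m" and v: "v \<in> carrier_vec m"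
  shows "of_vec (A *\<^sub>v v) = of_mat A * of_vec v"
proof (rule sz_eqI[where n = n and m = 1])
  show "sz n 1 (of_vec (A *\<^sub>v v))" using A v by (metis mult_mat_vec_carrier sz_of_vec)
  show "sz n 1 (of_mat A * of_vec v)" using A v by (metis sz_mult sz_of_mat sz_of_vec)
  fix i j :: nat assume ij: "i < n" "j < 1"
  have "ent (of_mat A * of_vec v) i j = (\<Sum>l<m. ent (of_mat A) i l * ent (of_vec v) l j)"
    by (rule ent_times[OF sz_of_mat[OF A]])
  also have "\<dots> = (\<Sum>l<m. A $$ (i, l) * v $ l)"
    using ij v by (intro sum.cong) (auto simp: ent_of_mat[OF A] of_vec_def)
  also have "\<dots> = (A *\<^sub>v v) $ i"
    using A v ij by (auto simp: scalar_prod_def atLeast0LessThan)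
  finally show "ent (of_vec (A *\<^sub>v v)) i j = ent (of_mat A * of_vec v) i j"
    using A ij by (auto simp: of_vec_def)
qed

lemma of_vec_add: "v \<in> carrier_vec n \<Longrightarrow> w \<in> carrier_vec n \<Longrightarrow> of_vec (v + w) = of_vec v + of_vec w"
  by (rule sz_eqI[where n = n and m = 1]) (auto simp: of_vec_def)

lemma of_vec_smult: "v \<in> carrier_vec n \<Longrightarrow> of_vec (c \<cdot>\<^sub>v v) = sc c (of_vec v)"
  by (rule sz_eqI[where n = n and m = 1]) (auto simp: of_vec_def)

lemma of_vec_zero [simp]: "of_vec (0\<^sub>v n) = 0"
  by (rule fmat_eqI) (simp add: of_vec_def)

subsection \<open>Elementary matrices and linear functionals\<close>

definition El :: "nat \<Rightarrow> nat \<Rightarrow> fmat" where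
  "El i j = Fm (Suc i) (Suc j) (\<lambda>a b. if a = i \<and> b = j then 1 else 0)"

lemma ent_El [simp]: "ent (El i j) a b = (if a = i \<and> b = j then 1 else 0)"
  by (auto simp: El_def)

lemma rw_El [simp]: "rw n (El i j) \<longleftrightarrow> i < n"
  by (auto simp: rw_def not_less[symmetric])

lemma cl_El [simp]: "cl n (El i j) \<longleftrightarrow> j < n"
  by (auto simp: cl_def not_less[symmetric])

lemma ent_times_El: "ent (x * El i j) a b = (if b = j then ent x a i else 0)"
proof -
  have "sz (Suc i) (Suc j) (El i j)" by simp
  from ent_times'[OF this] show ?thesis by simp
qed

lemma ent_El_times: "ent (El i j * x) a b = (if a = i then ent x j b else 0)"
proof -
  have "sz (Suc i) (Suc j) (El i j)" by simp
  from ent_times[OF this] show ?thesis by simp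
qed

lemma tr_El_times: "tr (El i j * x) = ent x j i"
proof -
  obtain n where n: "sz n n x" using sz_ex by blast
  have "sz (max n (Suc i)) (max n (Suc i)) (El i j * x)"
    using n by (auto simp: rw_def cl_def ent_El_times)
  from tr_eq[OF this] show ?thesis by (simp add: ent_El_times if_distrib)
qed

definition linf :: "(fmat \<Rightarrow> complex) \<Rightarrow> bool" where
  "linf f \<longleftrightarrow> (\<forall>x y. f (x + y) = f x + f y) \<and> (\<forall>c x. f (sc c x) = c * f x)"

lemma linf_0: "linf f \<Longrightarrow> f 0 = 0"
  unfolding linf_def by (metis mult_zero_left sc_0)

lemma linf_sum: "linf f \<Longrightarrow> f (\<Sum>a\<in>S. sc (c a) (x a)) = (\<Sum>a\<in>S. c a * f (x a))"
proof (induction S rule: infinite_finite_induct)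
  case (insert a F)
  then show ?case by (simp add: linf_def)
qed (auto simp: linf_0)

text \<open>Row-major numbering of the elementary matrices with \<open>c\<close> columns. It turns
  an unknown matrix into a coordinate vector, to which determinants apply.\<close>

definition basis :: "nat \<Rightarrow> nat \<Rightarrow> fmat" where
  "basis c k = El (k div c) (k mod c)"

lemma div_mod_index:
  fixes k r c :: nat assumes "k < r * c" shows "k div c < r" "k mod c < c"
proof -
  have c: "c > 0" using assms by (cases c) auto
  then show "k mod c < c" by simp
  show "k div c < r" using assms by (simp add: less_mult_imp_div_less)
qed

lemma ent_basis_comb:
  assumes "i < r" "j < c"
  shows "ent (\<Sum>k<r*c. sc (x k) (basis c k)) i j = x (i * c + j)"
proof -
  have lt: "i * c + j < r * c"
  proof -
    have "i * c + j < Suc i * c" using assms by simp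
    also have "\<dots> \<le> r * c" using assms by (intro mult_le_mono1) simp
    finally show ?thesis .
  qed
  have *: "i = k div c \<and> j = k mod c \<longleftrightarrow> k = i * c + j" for k
    using assms by auto
  have "ent (\<Sum>k<r*c. sc (x k) (basis c k)) i j = (\<Sum>k<r*c. if k = i * c + j then x k else 0)"
    unfolding ent_sum basis_def ent_sc ent_El * by (rule sum.cong) auto
  then show ?thesis using lt by simp
qed

lemma sz_basis: "k < r * c \<Longrightarrow> sz r c (basis c k)"
  unfolding basis_def using div_mod_index by simp

lemma sz_basis_comb: "sz r c (\<Sum>k<r*c. sc (x k) (basis c k))"
  using sz_basis[of _ r c] by (auto intro!: rw_sum cl_sum)

lemma basis_expand:
  assumes "sz r c X"
  shows "X = (\<Sum>k<r*c. sc (ent X (k div c) (k mod c)) (basis c k))"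
proof (rule sz_eqI[OF assms sz_basis_comb])
  fix i j assume ij: "i < r" "j < c"
  have "(i * c + j) div c = i" "(i * c + j) mod c = j" using ij by auto
  then show "ent X i j = ent (\<Sum>k<r*c. sc (ent X (k div c) (k mod c)) (basis c k)) i j"
    unfolding ent_basis_comb[OF ij] by simp
qed

lemma basis_comb_eq_0:
  assumes "(\<Sum>k<r*c. sc (x k) (basis c k)) = 0" "k < r * c"
  shows "x k = 0"
proof -
  have "ent (\<Sum>k<r*c. sc (x k) (basis c k)) (k div c) (k mod c) = x (k div c * c + k mod c)"
    by (rule ent_basis_comb) (use div_mod_index[OF assms(2)] in auto)
  then show ?thesis unfolding assms(1) by simp
qed

text \<open>The coefficient matrix is padded with zero rows to a square one. Its last row is zero,
  so the transpose kills the last unit vector, the determinant vanishes, and a kernel vector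
  supplies the coordinates of \<open>X\<close>.\<close>

lemma underdetermined:
  assumes lin: "\<And>f. f \<in> set fs \<Longrightarrow> linf f" and len: "length fs < r * c"
  shows "\<exists>X. sz r c X \<and> X \<noteq> 0 \<and> (\<forall>f \<in> set fs. f X = 0)"
proof -
  define q where "q = r * c"
  have q: "length fs < q" using len by (simp add: q_def)
  define M where "M = mat q q (\<lambda>(a, k). if a < length fs then (fs ! a) (basis c k) else 0)"
  have M: "M \<in> carrier_mat q q" by (simp add: M_def)
  have "transpose_mat M *\<^sub>v unit_vec q (q - 1) = 0\<^sub>v q"
  proof (rule eq_vecI)
    fix i assume i: "i < dim_vec (0\<^sub>v q)"
    have "(transpose_mat M *\<^sub>v unit_vec q (q - 1)) $ i = row (transpose_mat M) i \<bullet> unit_vec q (q - 1)"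
      using i M by simp
    also have "\<dots> = row (transpose_mat M) i $ (q - 1)"
      by (rule scalar_prod_right_unit) (use i q M in auto)
    also have "\<dots> = 0" using i q by (auto simp: M_def)
    finally show "(transpose_mat M *\<^sub>v unit_vec q (q - 1)) $ i = 0\<^sub>v q $ i" using i by simp
  qed (use M in auto)
  moreover have "unit_vec q (q - 1) \<noteq> (0\<^sub>v q :: complex vec)"
  proof
    assume h: "unit_vec q (q - 1) = (0\<^sub>v q :: complex vec)"
    have "(unit_vec q (q - 1) :: complex vec) $ (q - 1) = 0" unfolding h using q by simp
    then show False using q by simp
  qed
  ultimately have "det (transpose_mat M) = 0"
    using M by (intro iffD2[OF det_0_iff_vec_prod_zero_field[of _ q]] exI[of _ "unit_vec q (q - 1)"])
      (simp_all only: transpose_carrier_mat unit_vec_carrier not_False_eq_True simp_thms)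
  then have "det M = 0" using det_transpose[OF M] by simp
  then obtain v where v: "v \<in> carrier_vec q" "v \<noteq> 0\<^sub>v q" "M *\<^sub>v v = 0\<^sub>v q"
    using det_0_iff_vec_prod_zero_field[OF M] by auto
  define X where "X = (\<Sum>k<q. sc (v $ k) (basis c k))"
  have "X \<noteq> 0"
  proof
    assume "X = 0"
    then have "v $ k = 0" if "k < q" for k
      using basis_comb_eq_0[of "\<lambda>k. v $ k" c r k] that by (simp add: X_def q_def)
    then have "v = 0\<^sub>v q" using v(1) by (intro eq_vecI) auto
    then show False using v(2) by simp
  qed
  moreover have "f X = 0" if "f \<in> set fs" for f
  proof -
    obtain a where a: "a < length fs" "f = fs ! a" using \<open>f \<in> set fs\<close> by (metis in_set_conv_nth)
    have "f X = (\<Sum>k<q. v $ k * f (basis c k))"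
      unfolding X_def by (rule linf_sum[OF lin[OF that]])
    also have "\<dots> = (M *\<^sub>v v) $ a"
      using a q v(1) M by (auto simp: M_def scalar_prod_def atLeast0LessThan mult.commute intro!: sum.cong)
    also have "\<dots> = 0" using v(3) a q by simp
    finally show ?thesis .
  qed
  moreover have "sz r c X" unfolding X_def q_def by (rule sz_basis_comb)
  ultimately show ?thesis by blast
qed

subsection \<open>Injectivity is an open condition\<close>

text \<open>The common ground of polynomial functions on the variety and polynomials in one
  parameter: the openness of full rank is proved once and used in both settings.\<close>

definition fun_alg :: "('p \<Rightarrow> complex) set \<Rightarrow> bool" where
  "fun_alg F \<longleftrightarrow> (\<forall>c. (\<lambda>_. c) \<in> F) \<and> (\<forall>f\<in>F. \<forall>g\<in>F. (\<lambda>p. f p + g p) \<in> F) \<and>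
     (\<forall>f\<in>F. \<forall>g\<in>F. (\<lambda>p. f p * g p) \<in> F)"

lemma fun_algD:
  assumes "fun_alg F"
  shows "(\<lambda>_. c) \<in> F" "f \<in> F \<Longrightarrow> g \<in> F \<Longrightarrow> (\<lambda>p. f p + g p) \<in> F"
    "f \<in> F \<Longrightarrow> g \<in> F \<Longrightarrow> (\<lambda>p. f p * g p) \<in> F"
  using assms unfolding fun_alg_def by blast+

lemma fun_alg_sum:
  "fun_alg F \<Longrightarrow> (\<And>a. a \<in> S \<Longrightarrow> f a \<in> F) \<Longrightarrow> (\<lambda>p. \<Sum>a\<in>S. f a p) \<in> F"
  by (induction S rule: infinite_finite_induct) (auto intro: fun_algD)

lemma fun_alg_prod:
  "fun_alg F \<Longrightarrow> (\<And>a. a \<in> S \<Longrightarrow> f a \<in> F) \<Longrightarrow> (\<lambda>p. \<Prod>a\<in>S. f a p) \<in> F"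
  by (induction S rule: infinite_finite_induct) (auto intro: fun_algD)

lemma fun_alg_det:
  assumes F: "fun_alg F" and f: "\<And>i j. i < q \<Longrightarrow> j < q \<Longrightarrow> f i j \<in> F"
  shows "(\<lambda>p. det (mat q q (\<lambda>(i, j). f i j p))) \<in> F"
proof -
  have eq: "det (mat q q (\<lambda>(i, j). f i j p)) =
      (\<Sum>\<pi> | \<pi> permutes {0..<q}. signof \<pi> * (\<Prod>i\<in>{0..<q}. f i (\<pi> i) p))" for p
  proof -
    have "(mat q q (\<lambda>(i, j). f i j p)) $$ (i, \<pi> i) = f i (\<pi> i) p"
      if "\<pi> permutes {0..<q}" "i \<in> {0..<q}" for \<pi> i
      using that permutes_in_image[OF that(1), of i] by simp
    then show ?thesis
      unfolding det_def by (auto intro!: sum.cong prod.cong)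
  qed
  show ?thesis
    unfolding eq
  proof (intro fun_alg_sum[OF F] fun_algD(3)[OF F] fun_alg_prod[OF F] fun_algD(1)[OF F] f)
    fix \<pi> i assume "\<pi> \<in> {\<pi>. \<pi> permutes {0..<q}}" "i \<in> {0..<q}"
    then show "i < q" "\<pi> i < q" using permutes_in_image[of \<pi> "{0..<q}" i] by auto
  qed
qed

text \<open>Full column rank of a linear system, given as a list of functionals so that conditions
  of different origin (commutation relations, single entries, traces) can be concatenated.\<close>

definition injective_at :: "nat \<Rightarrow> nat \<Rightarrow> (fmat \<Rightarrow> complex) list \<Rightarrow> bool" where
  "injective_at r c fs \<longleftrightarrow> (\<forall>X. sz r c X \<longrightarrow> (\<forall>f\<in>set fs. f X = 0) \<longrightarrow> X = 0)"

text \<open>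
  The matrix \<open>M\<^sub>p\<close> of the system at \<open>p\<close> is injective wherever the product of the conjugate transpose
  of \<open>M\<^bsub>p0\<^esub>\<close> with \<open>M\<^sub>p\<close> has nonzero determinant.
\<close>

lemma injective_open:
  fixes p0 :: 'p and fs :: "('p \<Rightarrow> fmat \<Rightarrow> complex) list"
  assumes F: "fun_alg F"
    and lin: "\<And>f p. f \<in> set fs \<Longrightarrow> linf (f p)"
    and alg: "\<And>f X. f \<in> set fs \<Longrightarrow> (\<lambda>p. f p X) \<in> F"
    and inj: "injective_at r c (map (\<lambda>f. f p0) fs)"
  shows "\<exists>g\<in>F. g p0 \<noteq> 0 \<and> (\<forall>p. g p \<noteq> 0 \<longrightarrow> injective_at r c (map (\<lambda>f. f p) fs))"
proof -
  define q where "q = r * c"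
  define b where "b = basis c"
  define N where "N = length fs"
  \<comment> \<open>Only values at the fixed point \<open>p0\<close> are conjugated. As functions of
    \<open>p\<close> the entries of \<open>G\<close> stay in \<open>F\<close>, which need not be
    closed under conjugation.\<close>
  define G where "G k l p = (\<Sum>a<N. cnj ((fs ! a) p0 (b k)) * (fs ! a) p (b l))" for k l p
  define GM where "GM p = mat q q (\<lambda>(k, l). G k l p)" for p
  have mem: "fs ! a \<in> set fs" if "a < N" for a using that by (simp add: N_def)
  have GM: "GM p \<in> carrier_mat q q" for p by (simp add: GM_def)
  have "(\<lambda>p. G k l p) \<in> F" for k l
    unfolding G_def by (intro fun_alg_sum[OF F] fun_algD(3)[OF F] fun_algD(1)[OF F] alg mem) simp
  then have gF: "(\<lambda>p. det (GM p)) \<in> F"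
    unfolding GM_def using fun_alg_det[OF F, of q G] by simp
  have G_vec: "(\<Sum>l<q. G k l p * v l) = (\<Sum>a<N. cnj ((fs ! a) p0 (b k)) * (fs ! a) p (\<Sum>l<q. sc (v l) (b l)))"
    for k p v
  proof -
    have "(\<Sum>l<q. G k l p * v l) = (\<Sum>l<q. \<Sum>a<N. cnj ((fs ! a) p0 (b k)) * (fs ! a) p (b l) * v l)"
      by (simp add: G_def sum_distrib_right)
    also have "\<dots> = (\<Sum>a<N. \<Sum>l<q. cnj ((fs ! a) p0 (b k)) * (fs ! a) p (b l) * v l)"
      by (rule sum.swap)
    also have "\<dots> = (\<Sum>a<N. cnj ((fs ! a) p0 (b k)) * (fs ! a) p (\<Sum>l<q. sc (v l) (b l)))"
    proof (rule sum.cong[OF refl])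
      fix a assume "a \<in> {..<N}"
      then have "(fs ! a) p (\<Sum>l<q. sc (v l) (b l)) = (\<Sum>l<q. v l * (fs ! a) p (b l))"
        using linf_sum[OF lin[OF mem]] by blast
      then show "(\<Sum>l<q. cnj ((fs ! a) p0 (b k)) * (fs ! a) p (b l) * v l)
          = cnj ((fs ! a) p0 (b k)) * (fs ! a) p (\<Sum>l<q. sc (v l) (b l))"
        by (simp add: sum_distrib_left mult_ac)
    qed
    finally show ?thesis .
  qed
  have GM_vec: "(GM p *\<^sub>v v) $ k = (\<Sum>l<q. G k l p * v $ l)"
    if "v \<in> carrier_vec q" "k < q" for p v k
    using that by (auto simp: GM_def scalar_prod_def atLeast0LessThan intro!: sum.cong)
  have ne: "det (GM p0) \<noteq> 0"
  proof
    assume "det (GM p0) = 0"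
    then obtain v where v: "v \<in> carrier_vec q" "v \<noteq> 0\<^sub>v q" "GM p0 *\<^sub>v v = 0\<^sub>v q"
      using det_0_iff_vec_prod_zero_field[OF GM] by auto
    define X where "X = (\<Sum>l<q. sc (v $ l) (b l))"
    have zero: "(\<Sum>a<N. cnj ((fs ! a) p0 (b k)) * (fs ! a) p0 X) = 0" if "k < q" for k
      using GM_vec[OF v(1) that, of p0] G_vec[of k p0 "\<lambda>l. v $ l"] v(3) that by (simp add: X_def)
    have X_eq: "(fs ! a) p0 X = (\<Sum>k<q. v $ k * (fs ! a) p0 (b k))" if "a < N" for a
      unfolding X_def by (rule linf_sum[OF lin[OF mem[OF that]]])
    \<comment> \<open>At \<open>p0\<close> the matrix is a Gram matrix: for a kernel vector
      \<open>v\<close> its Hermitian form at \<open>v\<close>, which is zero, is the squared norm of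
      the vector of values of the system at \<open>X\<close>.\<close>
    have "(\<Sum>a<N. cnj ((fs ! a) p0 X) * (fs ! a) p0 X)
        = (\<Sum>a<N. \<Sum>k<q. cnj (v $ k) * (cnj ((fs ! a) p0 (b k)) * (fs ! a) p0 X))"
    proof (rule sum.cong[OF refl])
      fix a assume "a \<in> {..<N}"
      then have "cnj ((fs ! a) p0 X) = (\<Sum>k<q. cnj (v $ k) * cnj ((fs ! a) p0 (b k)))"
        by (simp add: X_eq)
      then show "cnj ((fs ! a) p0 X) * (fs ! a) p0 X
          = (\<Sum>k<q. cnj (v $ k) * (cnj ((fs ! a) p0 (b k)) * (fs ! a) p0 X))"
        by (simp only: sum_distrib_right mult.assoc)
    qed
    also have "\<dots> = (\<Sum>k<q. cnj (v $ k) * (\<Sum>a<N. cnj ((fs ! a) p0 (b k)) * (fs ! a) p0 X))"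
      by (subst sum.swap) (simp add: sum_distrib_left)
    also have "\<dots> = 0" by (simp add: zero)
    finally have "(\<Sum>a<N. cnj ((fs ! a) p0 X) * (fs ! a) p0 X) = 0" .
    moreover have "(\<Sum>a<N. cnj ((fs ! a) p0 X) * (fs ! a) p0 X)
        = complex_of_real (\<Sum>a<N. (cmod ((fs ! a) p0 X))\<^sup>2)"
      unfolding of_real_sum
      by (rule sum.cong[OF refl]) (metis complex_norm_square mult.commute)
    ultimately have "complex_of_real (\<Sum>a<N. (cmod ((fs ! a) p0 X))\<^sup>2) = 0" by metis
    then have "(\<Sum>a<N. (cmod ((fs ! a) p0 X))\<^sup>2) = 0" by (simp only: of_real_eq_0_iff)
    then have "\<forall>a<N. (fs ! a) p0 X = 0" by (simp add: sum_nonneg_eq_0_iff)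
    then have "\<forall>f\<in>set (map (\<lambda>f. f p0) fs). f X = 0"
      by (auto simp: N_def in_set_conv_nth)
    moreover have "sz r c X" unfolding X_def q_def b_def by (rule sz_basis_comb)
    ultimately have "X = 0" using inj unfolding injective_at_def by blast
    then have "v $ k = 0" if "k < q" for k
      using basis_comb_eq_0[of "\<lambda>k. v $ k" c r k] that by (simp add: X_def q_def b_def)
    then have "v = 0\<^sub>v q" using v(1) by (intro eq_vecI) auto
    then show False using v(2) by simp
  qed
  have "injective_at r c (map (\<lambda>f. f p) fs)" if nz: "det (GM p) \<noteq> 0" for p
    unfolding injective_at_def
  proof (intro allI impI)
    fix X assume X: "sz r c X" and eqs: "\<forall>f\<in>set (map (\<lambda>f. f p) fs). f X = 0"
    define v where "v = vec q (\<lambda>k. ent X (k div c) (k mod c))"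
    have v: "v \<in> carrier_vec q" by (simp add: v_def)
    have Xv: "X = (\<Sum>l<q. sc (v $ l) (b l))"
      using basis_expand[OF X] by (simp add: v_def q_def b_def)
    have "(fs ! a) p X = 0" if "a < N" for a using eqs mem[OF that] by auto
    then have "(\<Sum>l<q. G k l p * v $ l) = 0" for k
      unfolding G_vec Xv[symmetric] by simp
    then have "GM p *\<^sub>v v = 0\<^sub>v q"
      using GM_vec[OF v, of _ p] GM[of p]
      by (intro eq_vecI) (simp_all only: index_zero_vec dim_mult_mat_vec carrier_matD)
    then have "v = 0\<^sub>v q"
      using nz det_0_iff_vec_prod_zero_field[OF GM] v by blast
    then show "X = 0" unfolding Xv by simp
  qed
  then show ?thesis by (intro bexI[OF _ gF] conjI ne allI impI)
qed

subsection \<open>Eigenvectors, inverses and idempotents\<close>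

lemma eigenvector_exists:
  assumes X: "sz d d X" and d: "d > 0"
  shows "\<exists>\<mu> v. sz d 1 v \<and> v \<noteq> 0 \<and> X * v = sc \<mu> v"
proof -
  define A where "A = to_mat d d X"
  have A: "A \<in> carrier_mat d d" by (simp add: A_def)
  have "degree (char_poly A) = d" using degree_monic_char_poly[OF A] by simp
  then have "\<not> constant (poly (char_poly A))" using d by (simp add: constant_degree)
  then obtain \<mu> where "poly (char_poly A) \<mu> = 0" using fundamental_theorem_of_algebra by blast
  then have "eigenvalue A \<mu>" using eigenvalue_root_char_poly[OF A] by simp
  then obtain v where v: "v \<in> carrier_vec d" "v \<noteq> 0\<^sub>v d" "A *\<^sub>v v = \<mu> \<cdot>\<^sub>v v"
    using A unfolding eigenvalue_def eigenvector_def by auto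
  have "of_mat A * of_vec v = sc \<mu> (of_vec v)"
    using of_vec_mult[OF A v(1)] v(3) of_vec_smult[OF v(1)] by simp
  moreover have "of_mat A = X" using X by (simp add: A_def)
  moreover have "of_vec v \<noteq> 0"
    using v of_vec_inj[of v d "0\<^sub>v d"] by auto
  ultimately show ?thesis using v(1) by (metis sz_of_vec)
qed

text \<open>\<open>y * El j 0\<close> is column \<open>j\<close> of \<open>y\<close>; the solutions
  for the single columns are put back in place by \<open>El 0 j\<close>.\<close>

lemma surjective_columns:
  assumes "\<And>y. sz n 1 y \<Longrightarrow> \<exists>x. sz m 1 x \<and> M * x = y" and y: "sz n r y"
  shows "\<exists>x. sz m r x \<and> M * x = y"
proof -
  have "sz n 1 (y * El j 0)" if "j < r" for j
    using y by simp
  then have "\<forall>j. \<exists>x. j < r \<longrightarrow> sz m 1 x \<and> M * x = y * El j 0" using assms(1) by blast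
  then obtain x where x: "\<And>j. j < r \<Longrightarrow> sz m 1 (x j)" "\<And>j. j < r \<Longrightarrow> M * x j = y * El j 0" by metis
  have "sz m r (\<Sum>j<r. x j * El 0 j)"
    using x(1) by (auto intro!: rw_sum cl_sum)
  moreover have "M * (\<Sum>j<r. x j * El 0 j) = y"
  proof (rule fmat_eqI)
    fix a b
    have "M * (\<Sum>j<r. x j * El 0 j) = (\<Sum>j<r. y * El j 0 * El 0 j)"
      by (simp add: sum_distrib_left mult.assoc[symmetric] x(2))
    then have "ent (M * (\<Sum>j<r. x j * El 0 j)) a b = (\<Sum>j<r. if b = j then ent y a j else 0)"
      by (simp add: ent_times_El cong: if_cong)
    also have "\<dots> = ent y a b" using y by (auto simp: rw_def cl_def not_less)
    finally show "ent (M * (\<Sum>j<r. x j * El 0 j)) a b = ent y a b" .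
  qed
  ultimately show ?thesis by blast
qed

lemma injective_columns:
  assumes "\<And>x. sz m 1 x \<Longrightarrow> M * x = 0 \<Longrightarrow> x = 0" and x: "sz m r x" and "M * x = 0"
  shows "x = 0"
proof (rule fmat_eqI)
  fix i j
  have "sz m 1 (x * El j 0)" using x by simp
  moreover have "M * (x * El j 0) = 0" using \<open>M * x = 0\<close> by (simp add: mult.assoc[symmetric])
  ultimately have "x * El j 0 = 0" using assms(1) by blast
  then have "ent (x * El j 0) i 0 = 0" by simp
  then show "ent x i j = ent 0 i j" by (simp add: ent_times_El)
qed

lemma linf_ent_mult: "linf (\<lambda>x. ent (M * x) i j)"
  by (simp add: linf_def distrib_left)

lemma size_le:
  assumes i: "sz d a i" and pi: "p * i = E a"
  shows "a \<le> d"
proof (rule ccontr)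
  assume "\<not> a \<le> d"
  then have "length (map (\<lambda>k x. ent (i * x) k 0) [0..<d]) < a * 1" by simp
  moreover have "linf f" if "f \<in> set (map (\<lambda>k x. ent (i * x) k 0) [0..<d])" for f
    using that by (auto simp: linf_ent_mult)
  ultimately obtain x where x: "sz a 1 x" "x \<noteq> 0" "\<forall>k<d. ent (i * x) k 0 = 0"
    using underdetermined[of "map (\<lambda>k x. ent (i * x) k 0) [0..<d]" a 1] by auto
  have "i * x = 0" by (rule sz_eqI[where n = d and m = 1]) (use x i in auto)
  then have "p * i * x = 0" by (simp add: mult.assoc)
  then show False using x pi by simp
qed

text \<open>A partial factorization of maximal size is complete. Otherwise
  \<open>f = e - i * p\<close> is a nonzero idempotent with \<open>f * i = 0\<close> and
  \<open>p * f = 0\<close>, and a column and a row of \<open>f\<close> through a nonzero entry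
  enlarge \<open>i\<close> and \<open>p\<close> by one. Bases of eigenspaces are obtained in this
  way from spectral projections.\<close>

lemma rank_factorization:
  assumes e: "sz d d e" and idem: "e * e = e"
  shows "\<exists>a i p. sz d a i \<and> sz a d p \<and> e = i * p \<and> p * i = E a"
proof -
  define Q where "Q a \<longleftrightarrow> (\<exists>i p. sz d a i \<and> sz a d p \<and> e * i = i \<and> p * e = p \<and> p * i = E a)" for a
  have "Q 0" unfolding Q_def
    by (intro exI[of _ 0]) (auto intro!: fmat_eqI)
  moreover have "a \<le> d" if "Q a" for a using that size_le unfolding Q_def by blast
  ultimately obtain a where a: "Q a" "\<And>b. Q b \<Longrightarrow> b \<le> a"
    using Nat.ex_has_greatest_nat[of Q 0 d] by blast
  from a(1) obtain i p where ip: "sz d a i" "sz a d p" "e * i = i" "p * e = p" "p * i = E a"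
    unfolding Q_def by blast
  have "e = i * p"
  proof (rule ccontr)
    assume ne: "e \<noteq> i * p"
    define f where "f = e - i * p"
    have f: "sz d d f" using e ip by (auto simp: f_def)
    have "i * p * (i * p) = i * (p * i) * p" by (simp add: mult.assoc)
    also have "\<dots> = i * p" using ip by simp
    finally have ipip: "i * p * (i * p) = i * p" .
    have eip: "e * (i * p) = i * p" using ip(3) by (metis mult.assoc)
    have ipe: "i * p * e = i * p" using ip(4) by (metis mult.assoc)
    have ff: "f * f = f"
      unfolding f_def by (simp only: right_diff_distrib left_diff_distrib idem ipip eip ipe) simp
    have fi: "f * i = 0" using ip by (simp add: f_def left_diff_distrib mult.assoc)
    have pf: "p * f = 0"
      using ip by (simp add: f_def right_diff_distrib mult.assoc[symmetric])
    have ef: "e * f = f" "f * e = f"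
      by (simp_all add: f_def right_diff_distrib left_diff_distrib idem eip ipe)
    have "f \<noteq> 0" using ne by (simp add: f_def)
    then obtain k l where kl: "ent f k l \<noteq> 0" by (metis ent_0 fmat_eqI)
    have lk: "k < d" "l < d" using kl f by (auto simp: rw_def cl_def not_le[symmetric])
    define v where "v = f * El l 0"
    \<comment> \<open>Since \<open>f * f = f\<close>, row \<open>k\<close> of \<open>f\<close> times
      column \<open>l\<close> is the entry (k, l) itself; the scaling turns this product into
      1.\<close>
    define w where "w = sc (1 / ent f k l) (El 0 k * f)"
    have v: "sz d 1 v" unfolding v_def using f by simp
    have w: "sz 1 d w" unfolding w_def using f by simp
    have "w * v = sc (1 / ent f k l) (El 0 k * (f * f) * El l 0)"
      by (simp add: w_def v_def mult.assoc)
    also have "\<dots> = El 0 0"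
      unfolding ff using kl by (intro fmat_eqI) (auto simp: ent_times_El ent_El_times)
    finally have wv: "w * v = El 0 0" .
    define i' where "i' = i + v * El 0 a"
    define p' where "p' = p + El a 0 * w"
    have "sz d (Suc a) i'" unfolding i'_def
      using v ip(1) cl_mono[of a i "Suc a"] by simp
    moreover have "sz (Suc a) d p'" unfolding p'_def
      using w ip(2) rw_mono[of a p "Suc a"] by simp
    moreover have "e * i' = i'" by (simp add: i'_def v_def distrib_left ip ef mult.assoc[symmetric])
    moreover have "p' * e = p'" by (simp add: p'_def w_def distrib_right ip ef mult.assoc)
    moreover have "p' * i' = E (Suc a)"
    proof -
      have "w * i = 0" by (simp add: w_def mult.assoc fi)
      moreover have "p * v = 0" by (simp add: v_def mult.assoc[symmetric] pf)
      moreover have "El a 0 * w * (v * El 0 a) = El a 0 * (w * v) * El 0 a" by (simp add: mult.assoc)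
      moreover have "p * (v * El 0 a) = p * v * El 0 a" "El a 0 * w * i = El a 0 * (w * i)"
        by (simp_all add: mult.assoc)
      ultimately have "p' * i' = E a + El a 0 * El 0 0 * El 0 a"
        unfolding p'_def i'_def distrib_left distrib_right ip(5) by (simp add: wv)
      also have "\<dots> = E (Suc a)"
        by (rule fmat_eqI) (auto simp: ent_times_El ent_El_times)
      finally show ?thesis .
    qed
    ultimately have "Q (Suc a)" unfolding Q_def by blast
    then show False using a(2) by fastforce
  qed
  then show ?thesis using ip by blast
qed

section \<open>Representations as pairs of finitely supported matrices\<close>

definition inv_pair :: "nat \<Rightarrow> fmat \<Rightarrow> fmat \<Rightarrow> bool" where
  "inv_pair d A A' \<longleftrightarrow> sz d d A \<and> sz d d A' \<and> A * A' = E d \<and> A' * A = E d"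

definition rep_pair :: "nat \<Rightarrow> fmat \<Rightarrow> fmat \<Rightarrow> bool" where
  "rep_pair d A B \<longleftrightarrow> (\<exists>A'. inv_pair d A A') \<and> (\<exists>B'. inv_pair d B B') \<and> A * A = B * B * B"

lemma rep_pairD:
  assumes "rep_pair d A B" shows "sz d d A" "sz d d B" "A * A = B * B * B"
  using assms by (auto simp: rep_pair_def inv_pair_def)

lemma invertible_mat_iff:
  assumes A: "A \<in> carrier_mat n n"
  shows "invertible_mat A \<longleftrightarrow> (\<exists>A'. inv_pair n (of_mat A) A')"
proof
  assume "invertible_mat A"
  then obtain B where B: "A * B = 1\<^sub>m (dim_row A)" "B * A = 1\<^sub>m (dim_row B)"
    unfolding invertible_mat_def inverts_mat_def by blast
  have "dim_col (A * B) = n" "dim_col (B * A) = dim_row B" using A unfolding B by auto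
  then have Bc: "B \<in> carrier_mat n n" using A by (auto intro!: carrier_matI)
  have "inv_pair n (of_mat A) (of_mat B)"
    using A Bc B of_mat_mult[OF A Bc] of_mat_mult[OF Bc A] by (auto simp: inv_pair_def)
  then show "\<exists>A'. inv_pair n (of_mat A) A'" by blast
next
  assume "\<exists>A'. inv_pair n (of_mat A) A'"
  then obtain A' where A': "inv_pair n (of_mat A) A'" by blast
  define B where "B = to_mat n n A'"
  have Bc: "B \<in> carrier_mat n n" by (simp add: B_def)
  have B: "of_mat B = A'" using A' by (simp add: B_def inv_pair_def)
  have "A * B = 1\<^sub>m n" "B * A = 1\<^sub>m n"
    by (rule of_mat_inj[of _ n n]; use A Bc B A' in \<open>simp add: of_mat_mult[of _ n n _ n] inv_pair_def\<close>)+
  then show "invertible_mat A"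
    using A Bc unfolding invertible_mat_def inverts_mat_def by auto
qed

lemma rep_variety_iff:
  assumes A: "A \<in> carrier_mat n n" and B: "B \<in> carrier_mat n n"
  shows "(A, B) \<in> rep_variety n \<longleftrightarrow> rep_pair n (of_mat A) (of_mat B)"
proof -
  have AA: "A * A \<in> carrier_mat n n" and BB: "B * B \<in> carrier_mat n n" using A B by auto
  have BBB: "B * B * B \<in> carrier_mat n n" using BB B by (rule mult_carrier_mat)
  have "A ^\<^sub>m 2 = A * A" "B ^\<^sub>m 3 = B * B * B" using A B by (auto simp: numeral_eq_Suc)
  moreover have "A * A = B * B * B \<longleftrightarrow> of_mat A * of_mat A = of_mat B * of_mat B * of_mat B"
    using of_mat_inj[OF AA BBB] of_mat_mult[OF A A] of_mat_mult[OF BB B] of_mat_mult[OF B B] by auto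
  ultimately show ?thesis
    using A B by (auto simp: rep_variety_def rep_pair_def invertible_mat_iff)
qed

lemma rep_variety_carrier:
  "V \<in> rep_variety n \<Longrightarrow> fst V \<in> carrier_mat n n" "V \<in> rep_variety n \<Longrightarrow> snd V \<in> carrier_mat n n"
  by (auto simp: rep_variety_def)

lemma rep_variety_rp: "V \<in> rep_variety n \<Longrightarrow> rep_pair n (of_mat (fst V)) (of_mat (snd V))"
  using rep_variety_iff[of "fst V" n "snd V"] rep_variety_carrier[of V n] by simp

lemma rep_variety_dim: "V \<in> rep_variety n \<Longrightarrow> rep_dim V = n"
  using rep_variety_carrier(1)[of V n] by (simp add: rep_dim_def)

lemma to_mat_rep_variety: "rep_pair n A B \<Longrightarrow> (to_mat n n A, to_mat n n B) \<in> rep_variety n"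
  using rep_variety_iff[of "to_mat n n A" n "to_mat n n B"] by (simp add: rep_pairD)

text \<open>
  Stable subspaces occur below as column spaces and null spaces of matrices \<open>M\<close>; their
  stability is witnessed by \<open>A * M = M * A'\<close> and \<open>M * A = A' * M\<close>, respectively.
\<close>

definition simple_pair :: "nat \<Rightarrow> fmat \<Rightarrow> fmat \<Rightarrow> bool" where
  "simple_pair d A B \<longleftrightarrow> rep_pair d A B \<and> d > 0 \<and> (\<exists>c. c \<noteq> 0 \<and> A * A = sc c (E d)) \<and>
     (\<forall>q M A' B'. sz d q M \<and> A * M = M * A' \<and> B * M = M * B' \<longrightarrow>
        M = 0 \<or> (\<forall>y. sz d 1 y \<longrightarrow> (\<exists>x. sz q 1 x \<and> M * x = y))) \<and>
     (\<forall>q M A' B'. sz q d M \<and> M * A = A' * M \<and> M * B = B' * M \<longrightarrow>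
        M = 0 \<or> (\<forall>x. sz d 1 x \<and> M * x = 0 \<longrightarrow> x = 0))"

lemma simple_rep_in_variety: "simple_rep V \<Longrightarrow> V \<in> rep_variety (rep_dim V)"
  unfolding simple_rep_def is_rep_def by (erule conjunct1)

text \<open>Turns a stable set of columns into a \<open>subrep\<close>. Stability under
  \<open>A'\<close> and \<open>B'\<close> enters because \<open>subrep\<close> asks for equality of
  images: \<open>w\<close> has to be the image of \<open>A' * w\<close>.\<close>

lemma simple_stable:
  assumes V: "simple_rep V" and d: "d = rep_dim V"
    and A: "A = of_mat (fst V)" "inv_pair d A A'" and B: "B = of_mat (snd V)" "inv_pair d B B'"
    and W: "\<And>w. w \<in> W \<Longrightarrow> sz d 1 w" "0 \<in> W" "\<And>v w. v \<in> W \<Longrightarrow> w \<in> W \<Longrightarrow> v + w \<in> W"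
      "\<And>c w. w \<in> W \<Longrightarrow> sc c w \<in> W"
    and stab: "\<And>w. w \<in> W \<Longrightarrow> A * w \<in> W" "\<And>w. w \<in> W \<Longrightarrow> A' * w \<in> W"
      "\<And>w. w \<in> W \<Longrightarrow> B * w \<in> W" "\<And>w. w \<in> W \<Longrightarrow> B' * w \<in> W"
  shows "W = {0} \<or> W = {w. sz d 1 w}"
proof -
  define U where "U = {v \<in> carrier_vec d. of_vec v \<in> W}"
  have car: "fst V \<in> carrier_mat d d" "snd V \<in> carrier_mat d d"
    using rep_variety_carrier simple_rep_in_variety[OF V] unfolding d by blast+
  have "submodule class_ring U (module_vec TYPE(complex) d)"
    unfolding submodule_def
  proof (intro conjI allI impI)
    show "module class_ring (module_vec TYPE(complex) d)"
      by (rule vec_module)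
  next
    show "U \<subseteq> carrier (module_vec TYPE(complex) d)" by (auto simp: U_def module_vec_simps)
  next
    fix v w assume "v \<in> U" "w \<in> U"
    then show "v \<oplus>\<^bsub>module_vec TYPE(complex) d\<^esub> w \<in> U"
      by (simp add: U_def module_vec_simps of_vec_add[of v d w] W(3))
  next
    show "\<zero>\<^bsub>module_vec TYPE(complex) d\<^esub> \<in> U" using W(2) by (simp add: U_def module_vec_simps)
  next
    fix c v assume "v \<in> U"
    then show "c \<odot>\<^bsub>module_vec TYPE(complex) d\<^esub> v \<in> U"
      by (simp add: U_def module_vec_simps of_vec_smult[of v d] W(4))
  qed
  then have sub: "subspace class_ring U (module_vec TYPE(complex) d)"
    by (simp add: subspace_def vec_vs)
  have image: "(\<lambda>u. M *\<^sub>v u) ` U = U"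
    if M: "M \<in> carrier_mat d d" and ip: "inv_pair d (of_mat M) M'"
      and st: "\<And>w. w \<in> W \<Longrightarrow> of_mat M * w \<in> W" "\<And>w. w \<in> W \<Longrightarrow> M' * w \<in> W" for M M'
  proof
    show "(\<lambda>u. M *\<^sub>v u) ` U \<subseteq> U"
      using M by (auto simp: U_def of_vec_mult[OF M] st(1))
    show "U \<subseteq> (\<lambda>u. M *\<^sub>v u) ` U"
    proof
      fix u assume u: "u \<in> U"
      define w where "w = M' * of_vec u"
      have w: "w \<in> W" using st(2) u by (simp add: w_def U_def)
      have Mw: "of_mat M * w = of_vec u"
        using ip u W(1) by (simp add: w_def mult.assoc[symmetric] inv_pair_def U_def)
      have "to_vec d w \<in> U" using w W(1)[OF w] by (simp add: U_def)
      moreover have "M *\<^sub>v to_vec d w = u"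
        by (rule of_vec_inj[of _ d])
          (use M u W(1)[OF w] Mw in \<open>auto simp: U_def of_vec_mult[OF M to_vec_carrier]\<close>)
      ultimately show "u \<in> (\<lambda>u. M *\<^sub>v u) ` U" by (metis image_eqI)
    qed
  qed
  have "(\<lambda>u. fst V *\<^sub>v u) ` U = U"
    by (rule image[OF car(1), of A']) (use A stab in simp_all)
  moreover have "(\<lambda>u. snd V *\<^sub>v u) ` U = U"
    by (rule image[OF car(2), of B']) (use B stab in simp_all)
  ultimately have "subrep U V"
    unfolding subrep_def d[symmetric] using sub by (intro conjI)
  then have U: "U = {0\<^sub>v d} \<or> U = carrier_vec d"
    using V unfolding simple_rep_def d[symmetric] by blast
  have WU: "w \<in> W \<longleftrightarrow> to_vec d w \<in> U" if "sz d 1 w" for w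
    using that by (simp add: U_def)
  have zero: "w = 0" if "sz d 1 w" "to_vec d w = 0\<^sub>v d" for w
    using of_to_vec[OF that(1)] that(2) by simp
  from U show ?thesis
  proof
    assume U0: "U = {0\<^sub>v d}"
    have "w = 0" if "w \<in> W" for w
    proof (rule zero[OF W(1)[OF that]])
      show "to_vec d w = 0\<^sub>v d" using iffD1[OF WU[OF W(1)[OF that]] that] unfolding U0 by simp
    qed
    then show ?thesis using W(2) by (intro disjI1) blast
  next
    assume "U = carrier_vec d"
    then have UI: "to_vec d w \<in> U" for w using to_vec_carrier by metis
    have "W = {w. sz d 1 w}"
    proof (rule Set.set_eqI, rule iffI)
      fix w assume "w \<in> W" then show "w \<in> {w. sz d 1 w}" by (intro CollectI W(1))
    next
      fix w assume "w \<in> {w. sz d 1 w}"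
      then have "sz d 1 w" by (rule CollectD)
      then show "w \<in> W" using iffD2[OF WU UI] by blast
    qed
    then show ?thesis by (rule disjI2)
  qed
qed

lemma zero_from_columns:
  assumes "sz d q M" "\<And>x. sz q 1 x \<Longrightarrow> M * x = 0" shows "M = 0"
proof (rule sz_eqI[where n = d and m = q])
  fix i j assume "j < q"
  then have "M * El j 0 = 0" using assms(2) by simp
  then have "ent (M * El j 0) i 0 = 0" by simp
  then show "ent M i j = ent 0 i j" by (simp add: ent_times_El)
qed (use assms(1) in auto)

lemma inv_commute:
  assumes "inv_pair d A A'" "sz d d M" "A * M = M * A"
  shows "A' * M = M * A'"
proof -
  have "A' * M = A' * (M * (A * A'))" using assms by (simp add: inv_pair_def)
  also have "\<dots> = A' * (M * A) * A'" by (simp add: mult.assoc)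
  also have "\<dots> = A' * A * (M * A')" unfolding assms(3)[symmetric] by (simp add: mult.assoc)
  also have "\<dots> = M * A'" using assms by (simp add: inv_pair_def)
  finally show ?thesis .
qed

lemma inv_pair_nz: "inv_pair d A A' \<Longrightarrow> sz d q v \<Longrightarrow> A * v = 0 \<Longrightarrow> v = 0"
proof -
  assume a: "inv_pair d A A'" "sz d q v" "A * v = 0"
  then have "v = A' * A * v" by (simp add: inv_pair_def)
  then show "v = 0" using a(3) by (simp add: mult.assoc)
qed

text \<open>An eigenspace of the central element \<open>A * A\<close> is stable under the generators
  and their inverses, hence everything; this gives the nonzero scalar. Then \<open>A'\<close> is a
  multiple of \<open>A\<close> and \<open>B'\<close> a multiple of \<open>B * B\<close>, so
  stability under the generators alone suffices, and this is what column spaces and null spaces of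
  intertwining matrices provide.\<close>

lemma simple_rep_simple_pair:
  assumes V: "simple_rep V"
  shows "simple_pair (rep_dim V) (of_mat (fst V)) (of_mat (snd V))"
proof -
  define d A B where "d = rep_dim V" and "A = of_mat (fst V)" and "B = of_mat (snd V)"
  have rep_pair: "rep_pair d A B"
    using rep_variety_rp[OF simple_rep_in_variety[OF V]] by (simp add: d_def A_def B_def)
  note [simp] = rep_pairD(1,2)[OF rep_pair]
  have d: "d > 0" using V by (simp add: simple_rep_def d_def)
  obtain A' B' where inv: "inv_pair d A A'" "inv_pair d B B'" using rep_pair by (auto simp: rep_pair_def)
  note stable = simple_stable[OF V d_def A_def inv(1) B_def inv(2)]
  define C where "C = A * A"
  have C: "sz d d C" unfolding C_def by simp
  have CA: "A * C = C * A" by (simp add: C_def mult.assoc)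
  have CB: "B * C = C * B" by (simp add: C_def rep_pairD(3)[OF rep_pair] mult.assoc)
  have CA': "A' * C = C * A'" using inv_commute[OF inv(1) C CA] .
  have CB': "B' * C = C * B'" using inv_commute[OF inv(2) C CB] .
  obtain \<mu> v where v: "sz d 1 v" "v \<noteq> 0" "C * v = sc \<mu> v"
    using eigenvector_exists[OF C d] by blast
  have "\<mu> \<noteq> 0"
  proof
    assume "\<mu> = 0"
    then have "A * (A * v) = 0" using v by (simp add: C_def mult.assoc)
    moreover have "sz d 1 (A * v)" using v by simp
    ultimately have "v = 0" using inv_pair_nz[OF inv(1)] v(1) by blast
    then show False using v by simp
  qed
  define W where "W = {w. sz d 1 w \<and> C * w = sc \<mu> w}"
  have comm: "X * w \<in> W" if "w \<in> W" "sz d d X" "X * C = C * X" for X w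
  proof -
    have "C * (X * w) = X * (C * w)" using that(3) by (metis mult.assoc)
    also have "\<dots> = sc \<mu> (X * w)" using that(1) by (simp add: W_def)
    moreover have "sz d 1 (X * w)" using that by (auto simp: W_def)
    ultimately show ?thesis by (simp add: W_def)
  qed
  have "W = {0} \<or> W = {w. sz d 1 w}"
  proof (rule stable)
    show "A * w \<in> W" "A' * w \<in> W" "B * w \<in> W" "B' * w \<in> W" if "w \<in> W" for w
      using comm[OF that] CA CB CA' CB' inv by (auto simp: inv_pair_def)
    show "sc c w \<in> W" if "w \<in> W" for c w
      using that by (simp add: W_def mult.commute)
    show "v + w \<in> W" if "v \<in> W" "w \<in> W" for v w
      using that by (simp add: W_def distrib_left sc_add)
  qed (simp_all add: W_def)
  moreover have "v \<in> W" using v by (simp add: W_def)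
  ultimately have W: "C * w = sc \<mu> w" if "sz d 1 w" for w
    using v(2) that by (auto simp: W_def)
  have "C - sc \<mu> (E d) = 0"
  proof (rule zero_from_columns[where d = d and q = d])
    show "(C - sc \<mu> (E d)) * x = 0" if "sz d 1 x" for x
      using that W[OF that] by (simp add: left_diff_distrib)
    show "sz d d (C - sc \<mu> (E d))" using C by simp
  qed
  then have C\<mu>: "A * A = sc \<mu> (E d)" "B * B * B = sc \<mu> (E d)"
    using rep_pairD(3)[OF rep_pair] by (auto simp: C_def)
  have A'_eq: "A' = sc (1/\<mu>) A"
  proof -
    have "A' = sc (1/\<mu>) (A' * sc \<mu> (E d))" using \<open>\<mu> \<noteq> 0\<close> inv by (simp add: inv_pair_def)
    also have "A' * sc \<mu> (E d) = A' * A * A" by (simp only: C\<mu>(1)[symmetric] mult.assoc)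
    finally show ?thesis using inv by (simp add: inv_pair_def)
  qed
  have B'_eq: "B' = sc (1/\<mu>) (B * B)"
  proof -
    have "B' = sc (1/\<mu>) (B' * sc \<mu> (E d))" using \<open>\<mu> \<noteq> 0\<close> inv by (simp add: inv_pair_def)
    also have "B' * sc \<mu> (E d) = B' * B * B * B" by (simp only: C\<mu>(2)[symmetric] mult.assoc)
    finally show ?thesis using inv by (simp add: inv_pair_def)
  qed
  have stable2: "W = {0} \<or> W = {w. sz d 1 w}"
    if W: "\<And>w. w \<in> W \<Longrightarrow> sz d 1 w" "0 \<in> W" "\<And>v w. v \<in> W \<Longrightarrow> w \<in> W \<Longrightarrow> v + w \<in> W"
      "\<And>c w. w \<in> W \<Longrightarrow> sc c w \<in> W"
    and AB: "\<And>w. w \<in> W \<Longrightarrow> A * w \<in> W" "\<And>w. w \<in> W \<Longrightarrow> B * w \<in> W" for W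
    by (rule stable) (use W AB in \<open>auto simp: A'_eq B'_eq mult.assoc\<close>)
  have img: "M = 0 \<or> (\<forall>y. sz d 1 y \<longrightarrow> (\<exists>x. sz q 1 x \<and> M * x = y))"
    if M: "sz d q M" "A * M = M * A1" "B * M = M * B1" for q M A1 B1
  proof -
    define W where "W = {M * x | x. sz q 1 x}"
    have inW: "M * x \<in> W" if "sz q 1 x" for x using that by (auto simp: W_def)
    \<comment> \<open>\<open>X\<close> carries no size bound. \<open>E q\<close> cuts
      \<open>X * x\<close> down to \<open>q\<close> rows, which changes nothing after multiplication
      by \<open>M\<close>.\<close>
    have red: "M * X * x \<in> W" if "sz q 1 x" for X x
    proof -
      have "M * (E q * (X * x)) = M * X * x" using M(1) by (simp add: mult.assoc[symmetric])
      moreover have "sz q 1 (E q * (X * x))" using that by simp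
      ultimately show ?thesis using inW by metis
    qed
    have "W = {0} \<or> W = {w. sz d 1 w}"
    proof (rule stable2)
      show "0 \<in> W" using inW[of 0] by simp
      show "sz d 1 w" if "w \<in> W" for w using that M(1) by (auto simp: W_def)
      show "v + w \<in> W" if vw: "v \<in> W" "w \<in> W" for v w
      proof -
        obtain x y where "v = M * x" "w = M * y" "sz q 1 x" "sz q 1 y" using vw by (auto simp: W_def)
        then show ?thesis using inW[of "x + y"] by (simp add: distrib_left)
      qed
      show "sc c w \<in> W" if w: "w \<in> W" for c w
      proof -
        obtain x where "w = M * x" "sz q 1 x" using w by (auto simp: W_def)
        then show ?thesis using inW[of "sc c x"] by simp
      qed
      show "A * w \<in> W" if "w \<in> W" for w
        using that red M(2) by (auto simp: W_def mult.assoc[symmetric])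
      show "B * w \<in> W" if "w \<in> W" for w
        using that red M(3) by (auto simp: W_def mult.assoc[symmetric])
    qed
    moreover have "M = 0" if "W = {0}"
      using zero_from_columns[OF M(1)] inW that by auto
    moreover have "\<exists>x. sz q 1 x \<and> M * x = y" if "W = {w. sz d 1 w}" "sz d 1 y" for y
    proof -
      have "y \<in> W" using that by simp
      then show ?thesis by (auto simp: W_def)
    qed
    ultimately show ?thesis by metis
  qed
  have ker: "M = 0 \<or> (\<forall>x. sz d 1 x \<and> M * x = 0 \<longrightarrow> x = 0)"
    if M: "sz q d M" "M * A = A1 * M" "M * B = B1 * M" for q M A1 B1
  proof -
    define W where "W = {x. sz d 1 x \<and> M * x = 0}"
    have "W = {0} \<or> W = {w. sz d 1 w}"
    proof (rule stable2)
      show "A * w \<in> W" if "w \<in> W" for w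
      proof -
        have "M * (A * w) = A1 * (M * w)" using M(2) by (metis mult.assoc)
        then show ?thesis using that by (simp add: W_def)
      qed
      show "B * w \<in> W" if "w \<in> W" for w
      proof -
        have "M * (B * w) = B1 * (M * w)" using M(3) by (metis mult.assoc)
        then show ?thesis using that by (simp add: W_def)
      qed
    qed (simp_all add: W_def distrib_left)
    moreover have "M = 0" if "W = {w. sz d 1 w}"
    proof (rule zero_from_columns[OF M(1)])
      fix x assume "sz d 1 x"
      then have "x \<in> W" using that by simp
      then show "M * x = 0" by (simp add: W_def)
    qed
    moreover have "x = 0" if "W = {0}" "sz d 1 x" "M * x = 0" for x
    proof -
      have "x \<in> W" unfolding W_def using that(2,3) by simp
      then show ?thesis using that(1) by simp
    qed
    ultimately show ?thesis by metis
  qed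
  show ?thesis
    unfolding simple_pair_def A_def[symmetric] B_def[symmetric] d_def[symmetric]
  proof (intro conjI allI impI)
    show "\<exists>c. c \<noteq> 0 \<and> A * A = sc c (E d)" using C\<mu>(1) \<open>\<mu> \<noteq> 0\<close> by blast
  next
    fix q M A' B' assume h: "sz d q M \<and> A * M = M * A' \<and> B * M = M * B'"
    show "M = 0 \<or> (\<forall>y. sz d 1 y \<longrightarrow> (\<exists>x. sz q 1 x \<and> M * x = y))"
      by (rule img[OF conjunct1[OF h] conjunct1[OF conjunct2[OF h]] conjunct2[OF conjunct2[OF h]]])
  next
    fix q M A' B' assume h: "sz q d M \<and> M * A = A' * M \<and> M * B = B' * M"
    show "M = 0 \<or> (\<forall>x. sz d 1 x \<and> M * x = 0 \<longrightarrow> x = 0)"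
      by (rule ker[OF conjunct1[OF h] conjunct1[OF conjunct2[OF h]] conjunct2[OF conjunct2[OF h]]])
  qed (rule rep_pair, rule d)
qed

lemma simple_pairD:
  assumes "simple_pair d A B"
  shows "rep_pair d A B" "d > 0" "\<exists>c. c \<noteq> 0 \<and> A * A = sc c (E d)"
    "\<lbrakk>sz d q M; A * M = M * A'; B * M = M * B'; M \<noteq> 0; sz d 1 y\<rbrakk> \<Longrightarrow> \<exists>x. sz q 1 x \<and> M * x = y"
    "\<lbrakk>sz q d M; M * A = A' * M; M * B = B' * M; M \<noteq> 0; sz d 1 x; M * x = 0\<rbrakk> \<Longrightarrow> x = 0"
  using assms unfolding simple_pair_def by blast+

lemma schur:
  assumes S: "simple_pair d A B" and X: "sz d d X" "X * A = A * X" "X * B = B * X"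
  shows "\<exists>c. X = sc c (E d)"
proof -
  obtain \<mu> v where v: "sz d 1 v" "v \<noteq> 0" "X * v = sc \<mu> v"
    using eigenvector_exists[OF X(1) simple_pairD(2)[OF S]] by blast
  define M where "M = X - sc \<mu> (E d)"
  have AB: "sz d d A" "sz d d B" using rep_pairD[OF simple_pairD(1)[OF S]] by auto
  have M: "sz d d M" "M * A = A * M" "M * B = B * M"
    using X AB by (auto simp: M_def left_diff_distrib right_diff_distrib)
  have "M * v = 0" using v by (simp add: M_def left_diff_distrib)
  then have "M = 0" using simple_pairD(5)[OF S M _ v(1)] v(2) by blast
  then show ?thesis by (auto simp: M_def)
qed

definition pair_iso :: "nat \<Rightarrow> fmat \<Rightarrow> fmat \<Rightarrow> nat \<Rightarrow> fmat \<Rightarrow> fmat \<Rightarrow> bool" where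
  "pair_iso d A B d' A' B' \<longleftrightarrow> d = d' \<and>
     (\<exists>P Q. sz d' d P \<and> sz d d' Q \<and> P * Q = E d' \<and> Q * P = E d \<and> P * A = A' * P \<and> P * B = B' * P)"

lemma simple_hom_zero:
  assumes S: "simple_pair d A B" and S': "simple_pair d' A' B'" and ni: "\<not> pair_iso d A B d' A' B'"
    and P: "sz d' d P" "P * A = A' * P" "P * B = B' * P"
  shows "P = 0"
proof (rule ccontr)
  assume nz: "P \<noteq> 0"
  have "\<exists>x. sz d 1 x \<and> P * x = y" if "sz d' 1 y" for y
    using simple_pairD(4)[OF S' P(1) P(2)[symmetric] P(3)[symmetric] nz that] .
  from surjective_columns[OF this conjI[OF rw_simps(2) cl_simps(2)]] obtain Q where Q: "sz d d' Q" "P * Q = E d'" by blast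
  have "sz d d (Q * P - E d)" using Q P by auto
  moreover have "P * (Q * P - E d) = 0"
    using Q P by (simp add: right_diff_distrib mult.assoc[symmetric])
  ultimately have "Q * P - E d = 0"
    using injective_columns[where m = d and r = d and M = P and x = "Q * P - E d"] simple_pairD(5)[OF S P nz] by blast
  then have QP: "Q * P = E d" by simp
  have "(of_nat d :: complex) = of_nat d'" using tr_mult_commute[of P Q] Q QP by simp
  then have "d = d'" by (simp only: of_nat_eq_iff)
  then show False using ni Q QP P unfolding pair_iso_def by blast
qed

lemma rep_iso_pair_iso:
  assumes V: "V \<in> rep_variety n" and W: "W \<in> rep_variety m"
    and iso: "pair_iso n (of_mat (fst V)) (of_mat (snd V)) m (of_mat (fst W)) (of_mat (snd W))"
  shows "rep_iso V W"
proof -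
  obtain P Q where nm: "n = m" and P: "sz m n P" "sz n m Q" "P * Q = E m" "Q * P = E n"
      "P * of_mat (fst V) = of_mat (fst W) * P" "P * of_mat (snd V) = of_mat (snd W) * P"
    using iso unfolding pair_iso_def by blast
  define R where "R = to_mat n n P"
  have R: "R \<in> carrier_mat n n" "of_mat R = P" using P nm by (simp_all add: R_def)
  note car = rep_variety_carrier[OF V] rep_variety_carrier[OF W]
  have "invertible_mat R"
    unfolding invertible_mat_iff[OF R(1)] R(2) inv_pair_def using P nm by auto
  moreover have "R * fst V = fst W * R" "R * snd V = snd W * R"
    by (rule of_mat_inj[of _ n n];
        use R car nm P in \<open>simp add: of_mat_mult[of _ n n _ n] mult_carrier_mat[of _ n n _ n]\<close>)+
  ultimately show ?thesis
    unfolding rep_iso_def rep_hom_def using R nm rep_variety_dim[OF V] rep_variety_dim[OF W] by auto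
qed

section \<open>Direct sums\<close>

text \<open>The decomposition is recorded by injections and projections instead of block positions,
  so that a change of basis and the merging of two summands only alter \<open>i\<close> and
  \<open>p\<close>.\<close>

definition dsum :: "nat \<Rightarrow> 'l set \<Rightarrow> ('l \<Rightarrow> nat) \<Rightarrow> ('l \<Rightarrow> fmat) \<Rightarrow> ('l \<Rightarrow> fmat) \<Rightarrow> bool" where
  "dsum n I d i p \<longleftrightarrow> finite I \<and>
     (\<forall>l\<in>I. sz n (d l) (i l) \<and> sz (d l) n (p l) \<and> p l * i l = E (d l)) \<and>
     (\<forall>l\<in>I. \<forall>k\<in>I. l \<noteq> k \<longrightarrow> p l * i k = 0) \<and> (\<Sum>l\<in>I. i l * p l) = E n"

definition glue :: "'l set \<Rightarrow> ('l \<Rightarrow> fmat) \<Rightarrow> ('l \<Rightarrow> fmat) \<Rightarrow> ('l \<Rightarrow> fmat) \<Rightarrow> fmat" where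
  "glue I i p M = (\<Sum>l\<in>I. i l * M l * p l)"

lemma dsumD:
  assumes "dsum n I d i p"
  shows "finite I" "l \<in> I \<Longrightarrow> rw n (i l)" "l \<in> I \<Longrightarrow> cl (d l) (i l)" "l \<in> I \<Longrightarrow> rw (d l) (p l)"
    "l \<in> I \<Longrightarrow> cl n (p l)" "l \<in> I \<Longrightarrow> p l * i l = E (d l)"
    "l \<in> I \<Longrightarrow> k \<in> I \<Longrightarrow> l \<noteq> k \<Longrightarrow> p l * i k = 0" "(\<Sum>l\<in>I. i l * p l) = E n"
  using assms unfolding dsum_def by blast+

lemma sz_glue: "dsum n I d i p \<Longrightarrow> sz n n (glue I i p M)"
  unfolding glue_def by (intro conjI rw_sum cl_sum) (simp_all add: dsumD)

lemma p_glue: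
  assumes D: "dsum n I d i p" and k: "k \<in> I" and M: "rw (d k) (M k)"
  shows "p k * glue I i p M = M k * p k"
proof -
  have "p k * glue I i p M = (\<Sum>l\<in>I. p k * i l * (M l * p l))"
    by (simp add: glue_def sum_distrib_left mult.assoc)
  also have "\<dots> = (\<Sum>l\<in>I. if l = k then M k * p k else 0)"
    by (rule sum.cong[OF refl]) (use dsumD(6,7)[OF D] k M in auto)
  finally show ?thesis using k dsumD(1)[OF D] by simp
qed

lemma glue_i:
  assumes D: "dsum n I d i p" and k: "k \<in> I" and M: "cl (d k) (M k)"
  shows "glue I i p M * i k = i k * M k"
proof -
  have "glue I i p M * i k = (\<Sum>l\<in>I. i l * M l * (p l * i k))"
    by (simp add: glue_def sum_distrib_right mult.assoc)
  also have "\<dots> = (\<Sum>l\<in>I. if l = k then i k * M k else 0)"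
    by (rule sum.cong[OF refl]) (use dsumD(6,7)[OF D] k M in auto)
  finally show ?thesis using k dsumD(1)[OF D] by simp
qed

lemma glue_mult:
  assumes D: "dsum n I d i p" and N: "\<And>l. l \<in> I \<Longrightarrow> rw (d l) (N l)"
  shows "glue I i p M * glue I i p N = glue I i p (\<lambda>l. M l * N l)"
proof -
  have "glue I i p M * glue I i p N = (\<Sum>l\<in>I. i l * M l * (p l * glue I i p N))"
    by (simp add: glue_def[of I i p M] sum_distrib_right mult.assoc)
  also have "\<dots> = (\<Sum>l\<in>I. i l * (M l * N l) * p l)"
    by (rule sum.cong[OF refl]) (simp add: p_glue[OF D _ N] mult.assoc)
  finally show ?thesis by (simp add: glue_def)
qed

lemma glue_E: "dsum n I d i p \<Longrightarrow> glue I i p (\<lambda>l. E (d l)) = E n"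
  using dsumD(8)[of n I d i p] by (simp add: glue_def dsumD)

lemma glue_cong: "(\<And>l. l \<in> I \<Longrightarrow> M l = N l) \<Longrightarrow> glue I i p M = glue I i p N"
  by (simp add: glue_def)

lemma glue_inv_pair:
  assumes D: "dsum n I d i p" and M: "\<And>l. l \<in> I \<Longrightarrow> inv_pair (d l) (M l) (M' l)"
  shows "inv_pair n (glue I i p M) (glue I i p M')"
proof -
  have "glue I i p M * glue I i p M' = glue I i p (\<lambda>l. E (d l))"
    using M by (subst glue_mult[OF D]) (auto simp: inv_pair_def intro: glue_cong)
  moreover have "glue I i p M' * glue I i p M = glue I i p (\<lambda>l. E (d l))"
    using M by (subst glue_mult[OF D]) (auto simp: inv_pair_def intro: glue_cong)
  ultimately show ?thesis using sz_glue[OF D] by (simp add: inv_pair_def glue_E[OF D])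
qed

lemma glue_rp:
  assumes D: "dsum n I d i p" and AB: "\<And>l. l \<in> I \<Longrightarrow> rep_pair (d l) (A l) (B l)"
  shows "rep_pair n (glue I i p A) (glue I i p B)"
proof -
  have "\<forall>l. \<exists>A' B'. l \<in> I \<longrightarrow> inv_pair (d l) (A l) A' \<and> inv_pair (d l) (B l) B'"
    using AB unfolding rep_pair_def by meson
  then obtain A' B' where "\<And>l. l \<in> I \<Longrightarrow> inv_pair (d l) (A l) (A' l)"
    "\<And>l. l \<in> I \<Longrightarrow> inv_pair (d l) (B l) (B' l)" by metis
  then have "inv_pair n (glue I i p A) (glue I i p A')" "inv_pair n (glue I i p B) (glue I i p B')"
    by (simp_all add: glue_inv_pair[OF D])
  moreover have "glue I i p A * glue I i p A = glue I i p B * glue I i p B * glue I i p B"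
    using rep_pairD[OF AB] by (simp add: glue_mult[OF D] mult.assoc cong: glue_cong)
  ultimately show ?thesis unfolding rep_pair_def by blast
qed

section \<open>Endomorphisms and central elements of a direct sum\<close>

definition scalar_end :: "nat \<Rightarrow> fmat \<Rightarrow> fmat \<Rightarrow> bool" where
  "scalar_end d A B \<longleftrightarrow>
     (\<forall>X. sz d d X \<and> X * A = A * X \<and> X * B = B * X \<longrightarrow> (\<exists>c. X = sc c (E d)))"

lemma dsum_zero:
  assumes D: "dsum n I d i p" and X: "sz n n X" and z: "\<And>l k. l \<in> I \<Longrightarrow> k \<in> I \<Longrightarrow> p l * X * i k = 0"
  shows "X = 0"
proof -
  have "X = (\<Sum>l\<in>I. i l * p l) * X * (\<Sum>l\<in>I. i l * p l)" using X by (simp add: dsumD(8)[OF D])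
  also have "\<dots> = (\<Sum>l\<in>I. \<Sum>k\<in>I. i l * (p l * X * i k) * p k)"
    by (simp add: sum_distrib_left sum_distrib_right mult.assoc) (rule sum.swap)
  also have "\<dots> = 0" using z by simp
  finally show ?thesis .
qed

text \<open>A block of \<open>X\<close> between different summands intertwines central elements that
  act by different scalars, hence vanishes. A diagonal block is a scalar by
  \<open>scalar_end\<close>, and its corner entry detects this scalar. So the \<open>card I\<close>
  corner entries separate the endomorphisms, whose dimension is therefore at most
  \<open>card I\<close>.\<close>

lemma glue_end_zero:
  assumes D: "dsum n I d i p" and AB: "\<And>l. l \<in> I \<Longrightarrow> rep_pair (d l) (A l) (B l)"
    and c: "\<And>l. l \<in> I \<Longrightarrow> A l * A l = sc (c l) (E (d l))" "inj_on c I"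
    and d: "\<And>l. l \<in> I \<Longrightarrow> d l > 0" and sc: "\<And>l. l \<in> I \<Longrightarrow> scalar_end (d l) (A l) (B l)"
    and X: "sz n n X" "X * glue I i p A = glue I i p A * X" "X * glue I i p B = glue I i p B * X"
    and z: "\<And>l. l \<in> I \<Longrightarrow> ent (p l * X * i l) 0 0 = 0"
  shows "X = 0"
proof (rule dsum_zero[OF D X(1)])
  fix l k assume l: "l \<in> I" and k: "k \<in> I"
  have szs: "rw (d l) (A l)" "rw (d l) (B l)" "cl (d l) (A l)" "cl (d l) (B l)"
     "cl (d k) (A k)" "cl (d k) (B k)" using rep_pairD[OF AB] l k by auto
  have comm: "p l * X * i k * M k = M l * (p l * X * i k)"
    if "X * glue I i p M = glue I i p M * X" "rw (d l) (M l)" "cl (d k) (M k)" for M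
  proof -
    have "p l * X * i k * M k = p l * (X * glue I i p M) * i k"
      by (simp add: mult.assoc glue_i[OF D k, of M, OF that(3)])
    also have "\<dots> = p l * glue I i p M * X * i k" by (simp add: that(1) mult.assoc)
    also have "\<dots> = M l * (p l * X * i k)" by (simp add: mult.assoc p_glue[OF D l, of M, OF that(2)])
    finally show ?thesis .
  qed
  note cA = comm[OF X(2) szs(1,5)] and cB = comm[OF X(3) szs(2,6)]
  show "p l * X * i k = 0"
  proof (cases "l = k")
    case False
    have "sc (c k) (p l * X * i k) = p l * X * i k * A k * A k"
      using c(1)[OF k] dsumD(3)[OF D k] by (simp add: mult.assoc)
    also have "\<dots> = A l * (p l * X * i k * A k)"
      by (subst cA) (simp only: mult.assoc)
    also have "\<dots> = A l * A l * (p l * X * i k)"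
      by (subst cA) (simp only: mult.assoc)
    also have "\<dots> = sc (c l) (p l * X * i k)" using c(1)[OF l] dsumD(4)[OF D l] by (simp add: mult.assoc)
    finally have "sc (c k - c l) (p l * X * i k) = 0" by (simp add: sc_diff_left)
    moreover have "c k \<noteq> c l" using c(2) l k False by (auto dest: inj_onD)
    ultimately show ?thesis by simp
  next
    case True
    have "sz (d l) (d l) (p l * X * i l)" using dsumD[OF D] l by simp
    then obtain x where x: "p l * X * i l = sc x (E (d l))"
      using sc[OF l] cA cB unfolding scalar_end_def True[symmetric] by blast
    have "ent (sc x (E (d l))) 0 0 = 0" using z[OF l] unfolding x .
    then have "x = 0" using d[OF l] by simp
    then show ?thesis using x True by simp
  qed
qed

text \<open>The ring \<open>fmat\<close> has no unit element; the power with exponent zero is the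
  local unit \<open>E n\<close>.\<close>

primrec mpow :: "nat \<Rightarrow> fmat \<Rightarrow> nat \<Rightarrow> fmat" where
  "mpow n C 0 = E n"
| "mpow n C (Suc j) = C * mpow n C j"

lemma mpow_glue:
  assumes D: "dsum n I d i p"
  shows "mpow n (glue I i p (\<lambda>l. sc (c l) (E (d l)))) j = glue I i p (\<lambda>l. sc (c l ^ j) (E (d l)))"
  by (induction j) (simp_all add: glue_E[OF D] glue_mult[OF D] mult.commute)

text \<open>A linear relation among the powers is a polynomial of degree below \<open>card I\<close>
  that vanishes at the \<open>card I\<close> distinct scalars \<open>c l\<close>.\<close>

lemma glue_mpow_independent:
  assumes D: "dsum n I d i p" and d: "\<And>l. l \<in> I \<Longrightarrow> d l > 0" and c: "inj_on c I"
    and z: "(\<Sum>j<card I. sc (x j) (mpow n (glue I i p (\<lambda>l. sc (c l) (E (d l)))) j)) = 0"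
    and j: "j < card I"
  shows "x j = 0"
proof -
  define q where "q = (\<Sum>j<card I. monom (x j) j)"
  have "poly q (c k) = 0" if k: "k \<in> I" for k
  proof -
    have "0 = p k * (\<Sum>j<card I. sc (x j) (mpow n (glue I i p (\<lambda>l. sc (c l) (E (d l)))) j)) * i k"
      by (simp add: z)
    also have "\<dots> = (\<Sum>j<card I. sc (x j) (sc (c k ^ j) (E (d k))))"
      unfolding mpow_glue[OF D] sum_distrib_left sum_distrib_right
    proof (rule sum.cong[OF refl])
      fix j
      have "p k * glue I i p (\<lambda>l. sc (c l ^ j) (E (d l))) = sc (c k ^ j) (E (d k)) * p k"
        by (rule p_glue[OF D k]) simp
      then show "p k * sc (x j) (glue I i p (\<lambda>l. sc (c l ^ j) (E (d l)))) * i k = sc (x j) (sc (c k ^ j) (E (d k)))"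
        using dsumD[OF D] k by (simp add: mult.assoc)
    qed
    finally have "(\<Sum>j<card I. sc (x j) (sc (c k ^ j) (E (d k)))) = 0" by simp
    then have "ent (\<Sum>j<card I. sc (x j) (sc (c k ^ j) (E (d k)))) 0 0 = 0" by simp
    then show ?thesis using d[OF k] by (simp add: q_def poly_sum poly_monom)
  qed
  then have sub: "c ` I \<subseteq> {y. poly q y = 0}" by auto
  have "q = 0"
  proof (rule ccontr)
    assume q: "q \<noteq> 0"
    have "card (c ` I) \<le> card {y. poly q y = 0}" by (rule card_mono[OF poly_roots_finite[OF q] sub])
    also have "\<dots> \<le> degree q" by (rule card_poly_roots_bound[OF q])
    finally have "card I \<le> degree q" using c by (simp add: card_image)
    moreover have "degree q < card I"
      unfolding q_def using j by (intro degree_sum_less) (auto intro: le_less_trans[OF degree_monom_le])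
    ultimately show False by simp
  qed
  then have "coeff q j = 0" by simp
  then show ?thesis using j by (simp add: q_def coeff_sum)
qed

subsection \<open>Sums of two representations\<close>

text \<open>Injection of the last \<open>b\<close> of \<open>a + b\<close> coordinates. The first
  \<open>a\<close> coordinates are served by \<open>E a\<close>, which is both their injection and
  their projection because matrices of all sizes share one ring.\<close>

definition inj2 :: "nat \<Rightarrow> nat \<Rightarrow> fmat" where
  "inj2 a b = Fm (a + b) b (\<lambda>i j. if i = a + j then 1 else 0)"

definition proj2 :: "nat \<Rightarrow> nat \<Rightarrow> fmat" where
  "proj2 a b = Fm b (a + b) (\<lambda>i j. if j = a + i then 1 else 0)"

lemma rw_cl_inj2 [simp]: "rw (a + b) (inj2 a b)" "cl b (inj2 a b)" "rw b (proj2 a b)" "cl (a + b) (proj2 a b)"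
  using sz_Fm unfolding inj2_def proj2_def by blast+

lemma rw_cl_E_add [simp]: "rw (a + b) (E a)" "cl (a + b) (E a)"
  by (auto intro: rw_mono[of a] cl_mono[of a])

lemma ent_inj2_times: "ent (inj2 a b * x) i j = (if a \<le> i \<and> i < a + b then ent x (i - a) j else 0)"
proof -
  have "ent (inj2 a b * x) i j = (\<Sum>k<b. ent (inj2 a b) i k * ent x k j)"
    by (rule ent_times[of "a + b"]) simp
  also have "\<dots> = (\<Sum>k<b. if k = i - a then (if a \<le> i \<and> i < a + b then ent x (i - a) j else 0) else 0)"
    by (rule sum.cong) (auto simp: inj2_def)
  finally show ?thesis by auto
qed

lemma ent_times_proj2: "ent (x * proj2 a b) i j = (if a \<le> j \<and> j < a + b then ent x i (j - a) else 0)"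
proof -
  have "ent (x * proj2 a b) i j = (\<Sum>k<b. ent x i k * ent (proj2 a b) k j)"
    by (rule ent_times'[of b "proj2 a b" "a + b"]) simp
  also have "\<dots> = (\<Sum>k<b. if k = j - a then (if a \<le> j \<and> j < a + b then ent x i (j - a) else 0) else 0)"
    by (rule sum.cong) (auto simp: proj2_def)
  finally show ?thesis by auto
qed

lemma proj2_inj2 [simp]: "proj2 a b * inj2 a b = E b"
proof (rule sz_eqI[where n = b and m = b])
  fix i j assume ij: "i < b" "j < b"
  have "ent (proj2 a b * inj2 a b) i j = (\<Sum>k<a+b. ent (proj2 a b) i k * ent (inj2 a b) k j)"
    by (rule ent_times[of b]) simp
  also have "\<dots> = (\<Sum>k<a+b. if k = a + i then (if i = j then 1 else 0) else 0)"
    using ij by (intro sum.cong) (auto simp: proj2_def inj2_def)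
  finally show "ent (proj2 a b * inj2 a b) i j = ent (E b) i j" using ij by simp
qed simp_all

lemma E_inj2 [simp]: "E a * inj2 a b = 0"
proof (rule fmat_eqI)
  fix i j
  have "ent (E a * inj2 a b) i j = (\<Sum>k<a. ent (E a) i k * ent (inj2 a b) k j)"
    by (rule ent_times[of a]) simp
  also have "\<dots> = 0" by (rule sum.neutral) (auto simp: inj2_def)
  finally show "ent (E a * inj2 a b) i j = ent 0 i j" by simp
qed

lemma proj2_E [simp]: "proj2 a b * E a = 0"
proof (rule fmat_eqI)
  fix i j
  have "ent (proj2 a b * E a) i j = (\<Sum>k<a. ent (proj2 a b) i k * ent (E a) k j)"
    by (rule ent_times'[of a "E a" a]) simp
  also have "\<dots> = 0" by (rule sum.neutral) (auto simp: proj2_def)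
  finally show "ent (proj2 a b * E a) i j = ent 0 i j" by simp
qed

lemma E_add_inj2_proj2: "E a + inj2 a b * proj2 a b = E (a + b)"
  by (rule fmat_eqI) (auto simp: ent_times_proj2, auto simp: inj2_def)

lemma cl_inj2_zero [simp]: "cl a x \<Longrightarrow> x * inj2 a b = 0"
  using E_inj2[of a b] by (metis E_right mult.assoc mult_zero_right)

lemma rw_proj2_zero [simp]: "rw a x \<Longrightarrow> proj2 a b * x = 0"
  using proj2_E[of a b] by (metis E_left mult.assoc mult_zero_left)

lemma cl_inj2_zero' [simp]: "cl a x \<Longrightarrow> x * (inj2 a b * y) = 0"
  by (simp add: mult.assoc[symmetric])

lemma rw_proj2_zero' [simp]: "rw a x \<Longrightarrow> proj2 a b * (x * y) = 0"
  by simp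

lemma proj2_inj2' [simp]: "rw b y \<Longrightarrow> proj2 a b * (inj2 a b * y) = y"
  by (simp add: mult.assoc[symmetric])

lemma of_mat_four_block:
  assumes A: "A \<in> carrier_mat a a" and D: "D \<in> carrier_mat b b"
  shows "of_mat (four_block_mat A (0\<^sub>m a b) (0\<^sub>m b a) D)
    = of_mat A + inj2 a b * of_mat D * proj2 a b"
proof (rule sz_eqI[where n = "a + b" and m = "a + b"])
  show "sz (a + b) (a + b) (of_mat A + inj2 a b * of_mat D * proj2 a b)"
    using A rw_mono[of a "of_mat A" "a + b"] cl_mono[of a "of_mat A" "a + b"] by simp
  fix i j assume "i < a + b" "j < a + b"
  then show "ent (of_mat (four_block_mat A (0\<^sub>m a b) (0\<^sub>m b a) D)) i j
      = ent (of_mat A + inj2 a b * of_mat D * proj2 a b) i j"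
    using A D by (auto simp: ent_times_proj2 ent_inj2_times of_mat_def)
qed (use A D in auto)

lemma dsum_Cons:
  fixes d :: "nat \<Rightarrow> nat" and a :: nat
  assumes D: "dsum N {..<m} d i p"
  defines "d' \<equiv> \<lambda>l. case l of 0 \<Rightarrow> a | Suc l \<Rightarrow> d l" and "i' \<equiv> case_nat (E a) (\<lambda>l. inj2 a N * i l)"
    and "p' \<equiv> case_nat (E a) (\<lambda>l. p l * proj2 a N)"
  shows "dsum (a + N) {..<Suc m} d' i' p'"
    and "\<And>M M'. rw a M \<Longrightarrow> cl a M \<Longrightarrow>
      glue {..<Suc m} i' p' (case_nat M M') = M + inj2 a N * glue {..<m} i p M' * proj2 a N"
proof -
  note D' = dsumD[OF D]
  have sumeq: "(\<Sum>l\<in>{..<Suc m}. f l) = f 0 + (\<Sum>l<m. f (Suc l))" for f :: "nat \<Rightarrow> fmat"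
    by (rule sum.lessThan_Suc_shift)
  show "dsum (a + N) {..<Suc m} d' i' p'"
    unfolding dsum_def
  proof (intro conjI ballI impI)
    fix l assume "l \<in> {..<Suc m}"
    then show "rw (a + N) (i' l)" "cl (d' l) (i' l)" "rw (d' l) (p' l)" "cl (a + N) (p' l)"
      "p' l * i' l = E (d' l)"
      using D' by (auto simp: i'_def p'_def d'_def mult.assoc split: nat.split)
  next
    fix l k assume "l \<in> {..<Suc m}" "k \<in> {..<Suc m}" "l \<noteq> k"
    then show "p' l * i' k = 0"
      using D' by (auto simp: i'_def p'_def d'_def mult.assoc split: nat.split)
  next
    have "(\<Sum>l<m. inj2 a N * i l * (p l * proj2 a N)) = inj2 a N * (\<Sum>l<m. i l * p l) * proj2 a N"
      by (simp add: sum_distrib_left sum_distrib_right mult.assoc)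
    also have "\<dots> = inj2 a N * proj2 a N" using D'(8) by simp
    finally show "(\<Sum>l<Suc m. i' l * p' l) = E (a + N)"
      unfolding sumeq by (simp add: i'_def p'_def E_add_inj2_proj2)
  qed simp
  show "glue {..<Suc m} i' p' (case_nat M M') = M + inj2 a N * glue {..<m} i p M' * proj2 a N"
    if "rw a M" "cl a M" for M M'
    using that unfolding glue_def sumeq
    by (simp add: i'_def p'_def sum_distrib_left sum_distrib_right mult.assoc)
qed

lemma direct_sum_reps_dsum:
  assumes "\<And>V. V \<in> set Vs \<Longrightarrow> V \<in> rep_variety (rep_dim V)"
  shows "\<exists>N i p. dsum N {..<length Vs} (\<lambda>l. rep_dim (Vs ! l)) i p \<and>
     fst (direct_sum_reps Vs) \<in> carrier_mat N N \<and> snd (direct_sum_reps Vs) \<in> carrier_mat N N \<and>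
     of_mat (fst (direct_sum_reps Vs)) = glue {..<length Vs} i p (\<lambda>l. of_mat (fst (Vs ! l))) \<and>
     of_mat (snd (direct_sum_reps Vs)) = glue {..<length Vs} i p (\<lambda>l. of_mat (snd (Vs ! l)))"
  using assms
proof (induction Vs)
  case Nil
  have "E 0 = 0" by (rule fmat_eqI) simp
  then have "dsum 0 {..<length ([] :: b3_rep list)} d i p" for d i p by (simp add: dsum_def)
  then show ?case by (intro exI[of _ 0] exI[of _ "\<lambda>_. 0"]) (auto simp: direct_sum_reps_def glue_def)
next
  case (Cons V Vs)
  then obtain N i p where D: "dsum N {..<length Vs} (\<lambda>l. rep_dim (Vs ! l)) i p"
    and car: "fst (direct_sum_reps Vs) \<in> carrier_mat N N" "snd (direct_sum_reps Vs) \<in> carrier_mat N N"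
    and eq: "of_mat (fst (direct_sum_reps Vs)) = glue {..<length Vs} i p (\<lambda>l. of_mat (fst (Vs ! l)))"
     "of_mat (snd (direct_sum_reps Vs)) = glue {..<length Vs} i p (\<lambda>l. of_mat (snd (Vs ! l)))"
    by auto
  define a where "a = rep_dim V"
  have V: "fst V \<in> carrier_mat a a" "snd V \<in> carrier_mat a a"
    using rep_variety_carrier Cons.prems[of V] unfolding a_def by auto
  have step: "diag_block_mat (M # Ms) \<in> carrier_mat (a + N) (a + N) \<and>
      of_mat (diag_block_mat (M # Ms)) = of_mat M + inj2 a N * of_mat (diag_block_mat Ms) * proj2 a N"
    if "M \<in> carrier_mat a a" "diag_block_mat Ms \<in> carrier_mat N N" for M Ms
    using that of_mat_four_block[OF that] by (auto simp: Let_def)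
  have cn: "(\<lambda>l. f ((V # Vs) ! l)) = case_nat (f V) (\<lambda>l. f (Vs ! l))" for f :: "b3_rep \<Rightarrow> 'a"
    by (auto simp: fun_eq_iff split: nat.split)
  note C = dsum_Cons[OF D, of a]
  let ?i = "case_nat (E a) (\<lambda>l. inj2 a N * i l)" and ?p = "case_nat (E a) (\<lambda>l. p l * proj2 a N)"
  have "dsum (a + N) {..<length (V # Vs)} (\<lambda>l. rep_dim ((V # Vs) ! l)) ?i ?p"
    using C(1) unfolding cn a_def by simp
  moreover have "of_mat (fst (direct_sum_reps (V # Vs)))
      = glue {..<length (V # Vs)} ?i ?p (\<lambda>l. of_mat (fst ((V # Vs) ! l)))"
    unfolding cn[of "\<lambda>V. of_mat (fst V)"]
    using C(2)[of "of_mat (fst V)"] V step[of "fst V" "map fst Vs"] car eq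
    by (simp add: direct_sum_reps_def del: diag_block_mat.simps)
  moreover have "of_mat (snd (direct_sum_reps (V # Vs)))
      = glue {..<length (V # Vs)} ?i ?p (\<lambda>l. of_mat (snd ((V # Vs) ! l)))"
    unfolding cn[of "\<lambda>V. of_mat (snd V)"]
    using C(2)[of "of_mat (snd V)"] V step[of "snd V" "map snd Vs"] car eq
    by (simp add: direct_sum_reps_def del: diag_block_mat.simps)
  moreover have "fst (direct_sum_reps (V # Vs)) \<in> carrier_mat (a + N) (a + N)"
    "snd (direct_sum_reps (V # Vs)) \<in> carrier_mat (a + N) (a + N)"
    using V car step[of "fst V" "map fst Vs"] step[of "snd V" "map snd Vs"]
    by (simp_all add: direct_sum_reps_def del: diag_block_mat.simps)
  ultimately show ?case by (intro exI conjI)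
qed

text \<open>The isomorphism is absorbed into the injections and projections, so that
  \<open>V\<close> itself, not just a conjugate of it, is a glued sum. The curves constructed later
  then pass through \<open>V\<close>.\<close>

lemma rep_iso_direct_sum:
  assumes V: "V \<in> rep_variety n" and iso: "rep_iso V (direct_sum_reps Vs)"
    and Vs: "\<And>V. V \<in> set Vs \<Longrightarrow> V \<in> rep_variety (rep_dim V)"
  shows "\<exists>i p. dsum n {..<length Vs} (\<lambda>l. rep_dim (Vs ! l)) i p \<and>
     of_mat (fst V) = glue {..<length Vs} i p (\<lambda>l. of_mat (fst (Vs ! l))) \<and>
     of_mat (snd V) = glue {..<length Vs} i p (\<lambda>l. of_mat (snd (Vs ! l)))"
proof -
  define W where "W = direct_sum_reps Vs"
  obtain N i p where D: "dsum N {..<length Vs} (\<lambda>l. rep_dim (Vs ! l)) i p"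
    and car: "fst W \<in> carrier_mat N N" "snd W \<in> carrier_mat N N"
    and eq: "of_mat (fst W) = glue {..<length Vs} i p (\<lambda>l. of_mat (fst (Vs ! l)))"
     "of_mat (snd W) = glue {..<length Vs} i p (\<lambda>l. of_mat (snd (Vs ! l)))"
    using direct_sum_reps_dsum[OF Vs] unfolding W_def by metis
  have dW: "rep_dim W = N" using car by (simp add: rep_dim_def)
  obtain P where P: "P \<in> carrier_mat N n" "P * fst V = fst W * P" "P * snd V = snd W * P" "invertible_mat P"
    using iso rep_variety_dim[OF V] dW unfolding rep_iso_def rep_hom_def W_def[symmetric] by auto
  have "N = n" using P(1,4) unfolding invertible_mat_def by auto
  note P = P[unfolded this] and car = car[unfolded this] and D = D[unfolded this]
  obtain Q where Q: "inv_pair n (of_mat P) Q" using P(4) invertible_mat_iff[OF P(1)] by blast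
  define i' p' where "i' = (\<lambda>l. Q * i l)" and "p' = (\<lambda>l. p l * of_mat P)"
  have pi: "p' l * i' k = p l * i k" if "l < length Vs" for l k
  proof -
    have "p' l * i' k = p l * (of_mat P * Q) * i k" by (simp add: p'_def i'_def mult.assoc)
    then show ?thesis using Q dsumD(5)[OF D, of l] that by (simp add: inv_pair_def)
  qed
  have gl: "glue {..<length Vs} i' p' M = Q * glue {..<length Vs} i p M * of_mat P" for M
    by (simp add: glue_def i'_def p'_def sum_distrib_left sum_distrib_right mult.assoc)
  have "(\<Sum>l<length Vs. i' l * p' l) = Q * (\<Sum>l<length Vs. i l * p l) * of_mat P"
    by (simp add: i'_def p'_def sum_distrib_left sum_distrib_right mult.assoc)
  also have "\<dots> = E n" using dsumD(8)[OF D] Q by (simp add: inv_pair_def)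
  finally have s: "(\<Sum>l<length Vs. i' l * p' l) = E n" .
  have D2: "dsum n {..<length Vs} (\<lambda>l. rep_dim (Vs ! l)) i' p'"
    unfolding dsum_def
    using s Q dsumD[OF D] by (auto simp: pi) (auto simp: i'_def p'_def inv_pair_def)
  have "of_mat M = Q * of_mat M' * of_mat P"
    if "M \<in> carrier_mat n n" "M' \<in> carrier_mat n n" "P * M = M' * P" for M M'
  proof -
    have "of_mat M = Q * (of_mat P * of_mat M)" using Q that(1)
      by (simp add: inv_pair_def mult.assoc[symmetric])
    also have "of_mat P * of_mat M = of_mat M' * of_mat P"
      using that P(1) by (simp add: of_mat_mult[symmetric, of _ n n _ n])
    finally show ?thesis by (simp add: mult.assoc)
  qed
  note conj = this
  have "of_mat (fst V) = glue {..<length Vs} i' p' (\<lambda>l. of_mat (fst (Vs ! l)))"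
    unfolding gl eq(1)[symmetric] by (rule conj[OF rep_variety_carrier(1)[OF V] car(1) P(2)])
  moreover have "of_mat (snd V) = glue {..<length Vs} i' p' (\<lambda>l. of_mat (snd (Vs ! l)))"
    unfolding gl eq(2)[symmetric] by (rule conj[OF rep_variety_carrier(2)[OF V] car(2) P(3)])
  ultimately show ?thesis using D2 by (intro exI conjI)
qed

text \<open>Summand \<open>b\<close> is attached to summand \<open>a\<close> behind its
  \<open>d a\<close> coordinates and the index \<open>b\<close> disappears. The second claim says
  that the block sum of \<open>M a\<close> and \<open>M b\<close> in the new slot glues to the same
  matrix, so a deformation of this block sum starts at the given representation.\<close>

lemma dsum_merge:
  assumes D: "dsum n I d i p" and ab: "a \<in> I" "b \<in> I" "a \<noteq> b"
  defines "d' \<equiv> d(a := d a + d b)" and "i' \<equiv> i(a := i a + i b * proj2 (d a) (d b))"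
    and "p' \<equiv> p(a := p a + inj2 (d a) (d b) * p b)"
  shows "dsum n (I - {b}) d' i' p'"
    and "\<And>M. sz (d a) (d a) (M a) \<Longrightarrow> sz (d b) (d b) (M b) \<Longrightarrow>
      glue (I - {b}) i' p' (M(a := M a + inj2 (d a) (d b) * M b * proj2 (d a) (d b))) = glue I i p M"
proof -
  note D' = dsumD[OF D]
  let ?J = "inj2 (d a) (d b)" and ?Q = "proj2 (d a) (d b)"
  have fin: "finite (I - {b})" "finite (I - {a,b})" using D'(1) by auto
  have split: "(\<Sum>l\<in>I-{b}. f l) = f a + (\<Sum>l\<in>I-{a,b}. f l)" for f :: "'a \<Rightarrow> fmat"
  proof -
    have I: "I - {b} = insert a (I - {a,b})" using ab by blast
    show ?thesis by (subst I, subst sum.insert[OF fin(2)]) simp_all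
  qed
  have split2: "(\<Sum>l\<in>I. f l) = f a + f b + (\<Sum>l\<in>I-{a,b}. f l)" for f :: "'a \<Rightarrow> fmat"
  proof -
    have I: "I = insert a (insert b (I - {a,b}))" using ab by auto
    have nin: "a \<notin> insert b (I - {a,b})" "b \<notin> I - {a,b}" using ab(3) by auto
    show ?thesis
      by (subst I, subst sum.insert[OF _ nin(1)], use fin(2) in simp, subst sum.insert[OF fin(2) nin(2)])
        (simp only: add.assoc)
  qed
  have z: "p a * i b = 0" "p b * i a = 0" "p a * i a = E (d a)" "p b * i b = E (d b)"
    using D'(6,7) ab by simp_all
  have z': "p a * (i b * x) = 0" "p b * (i a * x) = 0" "p b * (i b * x) = E (d b) * x"
     "p a * (i a * x) = E (d a) * x" for x
    using z by (simp_all add: mult.assoc[symmetric])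
  have pe: "(p a + ?J * p b) * (i a + i b * ?Q) = E (d a + d b)"
    by (simp add: distrib_left distrib_right mult.assoc z z' E_add_inj2_proj2[symmetric] del: rw_cl_E_add)
  have glue_one: "(i a + i b * ?Q) * (M a + ?J * M b * ?Q) * (p a + ?J * p b) = i a * M a * p a + i b * M b * p b"
    if "sz (d a) (d a) (M a)" "sz (d b) (d b) (M b)" for M
  proof -
    have Qp: "?Q * (p a) = 0" and iJ: "i a * ?J = 0"
      using D'(3,4) ab by auto
    have "(i a + i b * ?Q) * (M a + ?J * M b * ?Q) = i a * M a + i b * M b * ?Q"
      using that D' ab by (simp add: distrib_left distrib_right mult.assoc)
    moreover have "(i a * M a + i b * M b * ?Q) * (p a + ?J * p b) = i a * M a * p a + i b * M b * p b"
      using that D' ab by (simp add: distrib_left distrib_right mult.assoc)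
    ultimately show ?thesis by simp
  qed
  show "dsum n (I - {b}) d' i' p'"
    unfolding dsum_def
  proof (intro conjI ballI impI)
    show "finite (I - {b})" by (rule fin)
  next
    fix l assume l: "l \<in> I - {b}"
    then show "rw n (i' l)" "cl (d' l) (i' l)" "rw (d' l) (p' l)" "cl n (p' l)" "p' l * i' l = E (d' l)"
      using D' ab pe cl_mono[of "d a" "i a" "d a + d b"] rw_mono[of "d a" "p a" "d a + d b"]
      by (auto simp: i'_def p'_def d'_def)
  next
    fix l k assume "l \<in> I - {b}" "k \<in> I - {b}" "l \<noteq> k"
    then show "p' l * i' k = 0"
      using D' ab by (auto simp: i'_def p'_def distrib_left distrib_right mult.assoc)
        (simp_all add: mult.assoc[symmetric])
  next
    have "(i a + i b * ?Q) * (p a + ?J * p b) = i a * p a + i b * p b"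
      using D' ab by (simp add: distrib_left distrib_right mult.assoc)
    then show "(\<Sum>l\<in>I - {b}. i' l * p' l) = E n"
      unfolding split D'(8)[symmetric] split2 by (auto simp: i'_def p'_def intro!: sum.cong)
  qed
  show "glue (I - {b}) i' p' (M(a := M a + ?J * M b * ?Q)) = glue I i p M"
    if "sz (d a) (d a) (M a)" "sz (d b) (d b) (M b)" for M
    unfolding glue_def split split2 using glue_one[OF that]
    by (auto simp: i'_def p'_def intro!: sum.cong)
qed

section \<open>Irreducible components\<close>

lemma irreducible_in_iff:
  "irreducible_in X S \<longleftrightarrow> S \<subseteq> topspace X \<and> S \<noteq> {} \<and>
     (\<forall>C D. closedin X C \<and> closedin X D \<and> S \<subseteq> C \<union> D \<longrightarrow> S \<subseteq> C \<or> S \<subseteq> D)"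
proof (cases "S \<subseteq> topspace X")
  case True
  then have ts: "topspace (subtopology X S) = S" by (rule topspace_subtopology_subset)
  show ?thesis
  proof
    assume "irreducible_in X S"
    then have ne: "S \<noteq> {}" and irr: "\<And>C D. closedin (subtopology X S) C \<Longrightarrow> closedin (subtopology X S) D \<Longrightarrow>
        S = C \<union> D \<Longrightarrow> C = S \<or> D = S"
      unfolding irreducible_in_def irreducible_space_def ts by auto
    have "S \<subseteq> C \<or> S \<subseteq> D" if "closedin X C" "closedin X D" "S \<subseteq> C \<union> D" for C D
    proof -
      have "closedin (subtopology X S) (C \<inter> S)" "closedin (subtopology X S) (D \<inter> S)"
        unfolding closedin_subtopology using that(1,2) by auto
      moreover have "S = (C \<inter> S) \<union> (D \<inter> S)" using that(3) by auto
      ultimately have "C \<inter> S = S \<or> D \<inter> S = S" by (rule irr)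
      then show ?thesis by blast
    qed
    then show "S \<subseteq> topspace X \<and> S \<noteq> {} \<and>
     (\<forall>C D. closedin X C \<and> closedin X D \<and> S \<subseteq> C \<union> D \<longrightarrow> S \<subseteq> C \<or> S \<subseteq> D)"
      using True ne by simp
  next
    assume h: "S \<subseteq> topspace X \<and> S \<noteq> {} \<and>
     (\<forall>C D. closedin X C \<and> closedin X D \<and> S \<subseteq> C \<union> D \<longrightarrow> S \<subseteq> C \<or> S \<subseteq> D)"
    have "C = S \<or> D = S"
      if "closedin (subtopology X S) C" "closedin (subtopology X S) D" "S = C \<union> D" for C D
    proof -
      obtain C' D' where C': "closedin X C'" "C = C' \<inter> S" and D': "closedin X D'" "D = D' \<inter> S"
        using \<open>closedin (subtopology X S) C\<close> \<open>closedin (subtopology X S) D\<close>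
        unfolding closedin_subtopology by auto
      have "S \<subseteq> C' \<union> D'" using C'(2) D'(2) \<open>S = C \<union> D\<close> by blast
      then have "S \<subseteq> C' \<or> S \<subseteq> D'" using h C'(1) D'(1) by simp
      then show ?thesis using C'(2) D'(2) by blast
    qed
    then show "irreducible_in X S"
      unfolding irreducible_in_def irreducible_space_def ts using h by auto
  qed
qed (simp add: irreducible_in_def)

text \<open>By Zorn's lemma: a point of the union of a chain outside \<open>C\<close> and one
  outside \<open>D\<close> lie in a common member of the chain, which contradicts its
  irreducibility.\<close>

lemma irreducible_component_exists:
  assumes "irreducible_in X S"
  shows "\<exists>Z. irreducible_component X Z \<and> S \<subseteq> Z"
proof -
  define \<A> where "\<A> = {W. irreducible_in X W \<and> S \<subseteq> W}"
  have "\<exists>M\<in>\<A>. \<forall>Y\<in>\<A>. M \<subseteq> Y \<longrightarrow> Y = M"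
  proof (rule subset_Zorn_nonempty)
    show "\<A> \<noteq> {}" using assms by (auto simp: \<A>_def)
    fix \<C> assume ne: "\<C> \<noteq> {}" and chain: "subset.chain \<A> \<C>"
    have irr: "\<And>W. W \<in> \<C> \<Longrightarrow> irreducible_in X W" "\<And>W. W \<in> \<C> \<Longrightarrow> S \<subseteq> W"
      using chain by (auto simp: subset.chain_def \<A>_def)
    have "\<Union>\<C> \<subseteq> topspace X" using irr(1) by (auto simp: irreducible_in_iff)
    moreover have "\<Union>\<C> \<noteq> {}" using ne irr by (auto simp: irreducible_in_iff)
    moreover have "\<Union>\<C> \<subseteq> C \<or> \<Union>\<C> \<subseteq> D"
      if "closedin X C" "closedin X D" "\<Union>\<C> \<subseteq> C \<union> D" for C D
    proof (rule ccontr)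
      assume "\<not> (\<Union>\<C> \<subseteq> C \<or> \<Union>\<C> \<subseteq> D)"
      then obtain x y W1 W2 where xy: "W1 \<in> \<C>" "x \<in> W1" "x \<notin> C" "W2 \<in> \<C>" "y \<in> W2" "y \<notin> D" by blast
      have "W1 \<subseteq> W2 \<or> W2 \<subseteq> W1" using chain xy(1,4) by (auto simp: subset.chain_def)
      then obtain W where W: "W \<in> \<C>" "x \<in> W" "y \<in> W" using xy by blast
      have "W \<subseteq> C \<union> D" using that(3) W(1) by blast
      then have "W \<subseteq> C \<or> W \<subseteq> D" using irr(1)[OF W(1)] that(1,2) by (simp add: irreducible_in_iff)
      then show False using W xy by blast
    qed
    ultimately have "irreducible_in X (\<Union>\<C>)" by (simp add: irreducible_in_iff)
    moreover have "S \<subseteq> \<Union>\<C>" using ne irr(2) by blast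
    ultimately show "\<Union>\<C> \<in> \<A>" by (simp add: \<A>_def)
  qed
  then obtain Z where Z: "Z \<in> \<A>" "\<And>Y. Y \<in> \<A> \<Longrightarrow> Z \<subseteq> Y \<Longrightarrow> Y = Z" by auto
  have "W = Z" if "irreducible_in X W" "Z \<subseteq> W" for W
    using Z that by (auto simp: \<A>_def)
  then show ?thesis using Z(1) unfolding irreducible_component_def \<A>_def by auto
qed

lemma closedin_vanishing:
  "f \<in> poly_funs n \<Longrightarrow> closedin (rep_zariski n) {V \<in> rep_variety n. f V = 0}"
  unfolding closedin_rep_zariski by (rule exI[of _ "{f}"]) simp

lemma irreducible_common_point:
  assumes irr: "irreducible_in (rep_zariski n) Z" and f: "f \<in> poly_funs n" "g \<in> poly_funs n"
    and P: "P \<in> Z" "f P \<noteq> 0" and Q: "Q \<in> Z" "g Q \<noteq> 0"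
  shows "\<exists>R\<in>Z. f R \<noteq> 0 \<and> g R \<noteq> 0"
proof (rule ccontr)
  assume no: "\<not> ?thesis"
  have Z: "Z \<subseteq> rep_variety n" using irr by (simp add: irreducible_in_iff topspace_rep_zariski)
  have "Z \<subseteq> {V \<in> rep_variety n. f V = 0} \<union> {V \<in> rep_variety n. g V = 0}" using no Z by blast
  then have "Z \<subseteq> {V \<in> rep_variety n. f V = 0} \<or> Z \<subseteq> {V \<in> rep_variety n. g V = 0}"
    using irr closedin_vanishing[OF f(1)] closedin_vanishing[OF f(2)] unfolding irreducible_in_iff by auto
  then show False using P Q by blast
qed

section \<open>Polynomial families\<close>

definition pfun :: "(complex \<Rightarrow> complex) set" where
  "pfun = {f. \<exists>p. \<forall>t. f t = poly p t}"

lemma fun_alg_pfun: "fun_alg pfun"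
  unfolding fun_alg_def pfun_def
proof (intro conjI allI ballI; clarsimp)
  show "\<exists>p. \<forall>t. c = poly p t" for c :: complex by (rule exI[of _ "[:c:]"]) simp
  fix f g :: "complex \<Rightarrow> complex" and p q assume h: "\<forall>t. f t = poly p t" "\<forall>t. g t = poly q t"
  show "\<exists>r. \<forall>t. poly p t + poly q t = poly r t" by (rule exI[of _ "p + q"]) simp
  show "\<exists>r. \<forall>t. poly p t * poly q t = poly r t" by (rule exI[of _ "p * q"]) simp
qed

lemma pfun_poly: "(\<lambda>t. poly p t) \<in> pfun"
  by (auto simp: pfun_def)

text \<open>On the line the nonempty Zariski open sets are cofinite. Generic properties of the
  parameter are therefore stated with the filter \<open>cofinite\<close>, and finitely many of them
  can be met at one parameter.\<close>

lemma pfun_nonzero_cofinite: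
  assumes "f \<in> pfun" "f t0 \<noteq> 0" shows "eventually (\<lambda>t. f t \<noteq> 0) cofinite"
proof -
  obtain p where p: "\<And>t. f t = poly p t" using assms(1) by (auto simp: pfun_def)
  have "p \<noteq> 0" using assms(2) p by auto
  then show ?thesis using poly_roots_finite by (simp add: eventually_cofinite p)
qed

lemma cofinite_complex_ex: "eventually P (cofinite :: complex filter) \<Longrightarrow> \<exists>t. P t"
proof (rule ccontr)
  assume P: "eventually P (cofinite :: complex filter)" and "\<nexists>t. P t"
  then have "finite (UNIV :: complex set)" by (simp add: eventually_cofinite)
  then show False using infinite_UNIV_char_0 by blast
qed

text \<open>The size bound is uniform in the parameter, so that the entries of a product are sums of
  a fixed finite length and remain in \<open>F\<close>.\<close>

definition pmat :: "('p \<Rightarrow> complex) set \<Rightarrow> ('p \<Rightarrow> fmat) \<Rightarrow> bool" where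
  "pmat F M \<longleftrightarrow> (\<exists>N. \<forall>t. sz N N (M t)) \<and> (\<forall>i j. (\<lambda>t. ent (M t) i j) \<in> F)"

lemma pmat_ent: "pmat F M \<Longrightarrow> (\<lambda>t. ent (M t) i j) \<in> F"
  by (simp add: pmat_def)

lemma pmat_const: "fun_alg F \<Longrightarrow> pmat F (\<lambda>_. x)"
  unfolding pmat_def by (intro conjI allI fun_algD(1)) (use sz_ex[of x] in auto)

lemma pmat_bound2:
  assumes "pmat F M" "pmat F N"
  shows "\<exists>K. (\<forall>t. sz K K (M t)) \<and> (\<forall>t. sz K K (N t))"
proof -
  obtain a b where "\<forall>t. sz a a (M t)" "\<forall>t. sz b b (N t)" using assms by (auto simp: pmat_def)
  then have "(\<forall>t. sz (max a b) (max a b) (M t)) \<and> (\<forall>t. sz (max a b) (max a b) (N t))"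
    using rw_mono[of _ _ "max a b"] cl_mono[of _ _ "max a b"] by (metis max.cobounded1 max.cobounded2)
  then show ?thesis by (rule exI)
qed

lemma pmat_add:
  assumes F: "fun_alg F" and "pmat F M" "pmat F N" shows "pmat F (\<lambda>t. M t + N t)"
proof -
  obtain K where "\<forall>t. sz K K (M t)" "\<forall>t. sz K K (N t)" using pmat_bound2[OF assms(2,3)] by auto
  then have "\<forall>t. sz K K (M t + N t)" by simp
  moreover have "(\<lambda>t. ent (M t + N t) i j) \<in> F" for i j
    using fun_algD(2)[OF F pmat_ent[OF assms(2)] pmat_ent[OF assms(3)]] by simp
  ultimately show ?thesis unfolding pmat_def by blast
qed

lemma pmat_mult:
  assumes F: "fun_alg F" and M: "pmat F M" and N: "pmat F N" shows "pmat F (\<lambda>t. M t * N t)"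
proof -
  obtain K where K: "\<forall>t. sz K K (M t)" "\<forall>t. sz K K (N t)" using pmat_bound2[OF M N] by auto
  then have "\<forall>t. sz K K (M t * N t)" by simp
  moreover have "(\<lambda>t. ent (M t * N t) i j) \<in> F" for i j
  proof -
    have "ent (M t * N t) i j = (\<Sum>k<K. ent (M t) i k * ent (N t) k j)" for t
      by (rule ent_times[of K]) (use K in simp)
    then show ?thesis
      using fun_alg_sum[OF F, of "{..<K}" "\<lambda>k t. ent (M t) i k * ent (N t) k j"]
        fun_algD(3)[OF F pmat_ent[OF M] pmat_ent[OF N]] by simp
  qed
  ultimately show ?thesis unfolding pmat_def by blast
qed

lemma pmat_sc:
  assumes F: "fun_alg F" and M: "pmat F M" and f: "f \<in> F" shows "pmat F (\<lambda>t. sc (f t) (M t))"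
proof -
  obtain K where "\<forall>t. sz K K (M t)" using M by (auto simp: pmat_def)
  then have "\<forall>t. sz K K (sc (f t) (M t))" by simp
  moreover have "(\<lambda>t. ent (sc (f t) (M t)) i j) \<in> F" for i j
    using fun_algD(3)[OF F f pmat_ent[OF M]] by simp
  ultimately show ?thesis unfolding pmat_def by blast
qed

lemma pmat_diff:
  assumes F: "fun_alg F" and "pmat F M" "pmat F N" shows "pmat F (\<lambda>t. M t - N t)"
  using pmat_add[OF F assms(2) pmat_sc[OF F assms(3) fun_algD(1)[OF F, of "-1"]]]
  by (simp add: sc_uminus_left)

lemma pmat_sum:
  assumes F: "fun_alg F" and "\<And>a. a \<in> S \<Longrightarrow> pmat F (M a)" shows "pmat F (\<lambda>t. \<Sum>a\<in>S. M a t)"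
  using assms(2)
proof (induction S rule: infinite_finite_induct)
  case (insert a S)
  then show ?case using pmat_add[OF F, of "M a" "\<lambda>t. \<Sum>a\<in>S. M a t"] by simp
qed (simp_all add: pmat_const[OF F])

lemma pmat_tr:
  assumes F: "fun_alg F" and M: "pmat F M" shows "(\<lambda>t. tr (M t)) \<in> F"
proof -
  obtain K where K: "\<forall>t. sz K K (M t)" using M by (auto simp: pmat_def)
  have "tr (M t) = (\<Sum>i<K. ent (M t) i i)" for t by (rule tr_eq[where n = K and m = K]) (use K in simp)
  then show ?thesis using fun_alg_sum[OF F, of "{..<K}" "\<lambda>i t. ent (M t) i i"] pmat_ent[OF M] by simp
qed

lemma pmat_mpow: "fun_alg F \<Longrightarrow> pmat F M \<Longrightarrow> pmat F (\<lambda>t. mpow n (M t) j)"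
  by (induction j) (auto intro: pmat_const pmat_mult)

text \<open>Polynomial functions on the variety pull back to polynomials in the parameter. If one of
  them detects a point outside \<open>C\<close> and another a point outside \<open>D\<close>, both
  are nonzero at cofinitely many parameters, hence at a common one in \<open>T\<close>. The set
  \<open>T\<close> is only cofinite because twisting factors vanish at finitely many
  parameters.\<close>

lemma curve_irreducible:
  assumes A: "pmat pfun A" and B: "pmat pfun B" and T: "eventually (\<lambda>t. t \<in> T) cofinite"
    and rep_pair: "\<And>t. t \<in> T \<Longrightarrow> rep_pair n (A t) (B t)"
  shows "irreducible_in (rep_zariski n) ((\<lambda>t. (to_mat n n (A t), to_mat n n (B t))) ` T)"
proof -
  define \<gamma> where "\<gamma> t = (to_mat n n (A t), to_mat n n (B t))" for t
  have pull: "(\<lambda>t. f (\<gamma> t)) \<in> pfun" if "f \<in> poly_funs n" for f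
    using that
  proof induction
    case (fst_entry i j)
    then show ?case using pmat_ent[OF A] by (simp add: \<gamma>_def to_mat_def)
  next
    case (snd_entry i j)
    then show ?case using pmat_ent[OF B] by (simp add: \<gamma>_def to_mat_def)
  qed (auto intro: fun_algD[OF fun_alg_pfun])
  have in_var: "\<gamma> t \<in> rep_variety n" if "t \<in> T" for t
    unfolding \<gamma>_def by (rule to_mat_rep_variety[OF rep_pair[OF that]])
  have ne: "T \<noteq> {}" using cofinite_complex_ex[OF T] by auto
  have "\<gamma> ` T \<subseteq> C \<or> \<gamma> ` T \<subseteq> D"
    if C: "closedin (rep_zariski n) C" and D: "closedin (rep_zariski n) D" and sub: "\<gamma> ` T \<subseteq> C \<union> D" for C D
  proof (rule ccontr)
    assume "\<not> (\<gamma> ` T \<subseteq> C \<or> \<gamma> ` T \<subseteq> D)"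
    then obtain s u where s: "s \<in> T" "\<gamma> s \<notin> C" and u: "u \<in> T" "\<gamma> u \<notin> D"
      unfolding image_subset_iff by metis
    obtain P Q where P: "P \<subseteq> poly_funs n" "C = {V \<in> rep_variety n. \<forall>p\<in>P. p V = 0}"
      and Q: "Q \<subseteq> poly_funs n" "D = {V \<in> rep_variety n. \<forall>p\<in>Q. p V = 0}"
      using C D unfolding closedin_rep_zariski by auto
    obtain f where f: "f \<in> P" "f (\<gamma> s) \<noteq> 0" using s P(2) in_var[OF s(1)] by auto
    obtain g where g: "g \<in> Q" "g (\<gamma> u) \<noteq> 0" using u Q(2) in_var[OF u(1)] by auto
    have "eventually (\<lambda>t. f (\<gamma> t) \<noteq> 0) cofinite"
      using pfun_nonzero_cofinite[OF pull[of f]] f P(1) by auto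
    moreover have "eventually (\<lambda>t. g (\<gamma> t) \<noteq> 0) cofinite"
      using pfun_nonzero_cofinite[OF pull[of g]] g Q(1) by auto
    ultimately have "eventually (\<lambda>t. t \<in> T \<and> f (\<gamma> t) \<noteq> 0 \<and> g (\<gamma> t) \<noteq> 0) cofinite"
      using T by (simp add: eventually_conj_iff)
    then obtain t where "t \<in> T" "f (\<gamma> t) \<noteq> 0" "g (\<gamma> t) \<noteq> 0" using cofinite_complex_ex by blast
    then show False using sub f(1) g(1) P(2) Q(2) by blast
  qed
  then show ?thesis
    unfolding irreducible_in_iff topspace_rep_zariski \<gamma>_def[symmetric] using ne in_var by auto
qed

text \<open>Cutting to size \<open>n\<close> makes the size bound hold for every pair, as
  \<open>pmat\<close> requires, and not only on the variety, where the result is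
  \<open>of_mat (fst P)\<close>.\<close>

definition fst_fm :: "nat \<Rightarrow> b3_rep \<Rightarrow> fmat" where
  "fst_fm n P = Fm n n (\<lambda>i j. fst P $$ (i, j))"

definition snd_fm :: "nat \<Rightarrow> b3_rep \<Rightarrow> fmat" where
  "snd_fm n P = Fm n n (\<lambda>i j. snd P $$ (i, j))"

lemma fst_snd_fm_to_mat [simp]:
  assumes "sz n n A" shows "fst_fm n (to_mat n n A, C) = A" "snd_fm n (C, to_mat n n A) = A"
  by (rule sz_eqI[where n = n and m = n]; use assms in \<open>auto simp: fst_fm_def snd_fm_def to_mat_def\<close>)+

lemma sz_fst_snd_fm [simp]: "rw n (fst_fm n P)" "cl n (fst_fm n P)" "rw n (snd_fm n P)" "cl n (snd_fm n P)"
  using sz_Fm unfolding fst_fm_def snd_fm_def by blast+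

lemma rep_variety_fm: "P \<in> rep_variety n \<Longrightarrow> rep_pair n (fst_fm n P) (snd_fm n P)"
proof -
  assume P: "P \<in> rep_variety n"
  have "fst_fm n P = of_mat (fst P)" "snd_fm n P = of_mat (snd P)"
    using rep_variety_carrier[OF P] by (auto simp: fst_fm_def snd_fm_def of_mat_def)
  then show ?thesis using rep_variety_rp[OF P] by simp
qed

lemma fun_alg_poly_funs: "fun_alg (poly_funs n)"
  unfolding fun_alg_def by (auto intro: poly_funs.const poly_funs.add poly_funs.mult)

lemma pmat_fst_snd_fm: "pmat (poly_funs n) (fst_fm n)" "pmat (poly_funs n) (snd_fm n)"
proof -
  have "(\<lambda>P. ent (fst_fm n P) i j) \<in> poly_funs n" "(\<lambda>P. ent (snd_fm n P) i j) \<in> poly_funs n" for i j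
    by (cases "i < n \<and> j < n"; auto simp: fst_fm_def snd_fm_def
        intro: poly_funs.const poly_funs.fst_entry poly_funs.snd_entry)+
  moreover have "\<forall>P. sz n n (fst_fm n P)" "\<forall>P. sz n n (snd_fm n P)" by simp_all
  ultimately show "pmat (poly_funs n) (fst_fm n)" "pmat (poly_funs n) (snd_fm n)"
    unfolding pmat_def by blast+
qed

definition entries :: "nat \<Rightarrow> nat \<Rightarrow> ('p \<Rightarrow> fmat \<Rightarrow> fmat) \<Rightarrow> ('p \<Rightarrow> fmat \<Rightarrow> complex) list" where
  "entries r c L = concat (map (\<lambda>i. map (\<lambda>j p X. ent (L p X) i j) [0..<c]) [0..<r])"

lemma set_entries: "set (entries r c L) = {\<lambda>p X. ent (L p X) i j | i j. i < r \<and> j < c}"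
  by (auto simp: entries_def) (intro exI conjI; (rule refl | assumption))

lemma entries_zero:
  assumes "\<forall>f\<in>set (entries r c L). f p X = 0" "sz r c (L p X)"
  shows "L p X = 0"
  by (rule sz_eqI[where n = r and m = c]) (use assms in \<open>force simp: set_entries\<close>)+

text \<open>Commutation with the generators and vanishing of the corner entries form one linear
  system with coefficients polynomial in \<open>P\<close>, so \<open>injective_open\<close> applies.
  The functionals built from \<open>p\<close> and \<open>i\<close> stay fixed while \<open>P\<close>
  moves; no decomposition of \<open>P\<close> is involved. Where \<open>f\<close> is nonzero, the
  endomorphisms of \<open>P\<close> have dimension at most \<open>card I\<close>.\<close>

lemma end_zero_open:
  assumes A: "sz n n A" and B: "sz n n B" and I: "finite I"
    and z: "\<And>X. sz n n X \<Longrightarrow> X * A = A * X \<Longrightarrow> X * B = B * X \<Longrightarrow>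
      (\<And>l. l \<in> I \<Longrightarrow> ent (p l * X * i l) 0 0 = 0) \<Longrightarrow> X = 0"
  shows "\<exists>f \<in> poly_funs n. f (to_mat n n A, to_mat n n B) \<noteq> 0 \<and>
    (\<forall>P X. f P \<noteq> 0 \<and> sz n n X \<and> X * fst_fm n P = fst_fm n P * X \<and> X * snd_fm n P = snd_fm n P * X \<and>
      (\<forall>l\<in>I. ent (p l * X * i l) 0 0 = 0) \<longrightarrow> X = 0)"
proof -
  let ?F = "poly_funs n"
  note F = fun_alg_poly_funs[of n]
  define L1 where "L1 P X = X * fst_fm n P - fst_fm n P * X" for P X
  define L2 where "L2 P X = X * snd_fm n P - snd_fm n P * X" for P X
  obtain ls where ls: "set ls = I" using finite_list[OF I] by blast
  define fs where "fs = entries n n L1 @ entries n n L2 @ map (\<lambda>l (_::b3_rep) X. ent (p l * X * i l) 0 0) ls"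
  have fs_cases: "(\<exists>a b. f = (\<lambda>P X. ent (L1 P X) a b)) \<or> (\<exists>a b. f = (\<lambda>P X. ent (L2 P X) a b)) \<or>
      (\<exists>l. f = (\<lambda>P X. ent (p l * X * i l) 0 0))" if "f \<in> set fs" for f
    using that by (auto simp: fs_def set_entries)
  have L1: "linf (\<lambda>X. ent (L1 P X) a b)" and L2: "linf (\<lambda>X. ent (L2 P X) a b)" for P a b
    by (auto simp: linf_def L1_def L2_def algebra_simps)
  have L3: "linf (\<lambda>X. ent (p l * X * i l) 0 0)" for l
    by (simp add: linf_def algebra_simps)
  have p1: "pmat ?F (\<lambda>P. L1 P X)" and p2: "pmat ?F (\<lambda>P. L2 P X)" for X
    unfolding L1_def L2_def
    by (intro pmat_diff[OF F] pmat_mult[OF F] pmat_const[OF F] pmat_fst_snd_fm)+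
  have "\<exists>g\<in>?F. g (to_mat n n A, to_mat n n B) \<noteq> 0 \<and>
      (\<forall>P. g P \<noteq> 0 \<longrightarrow> injective_at n n (map (\<lambda>f. f P) fs))"
  proof (rule injective_open[OF F])
    show "linf (f P)" if "f \<in> set fs" for f P
      using fs_cases[OF that] by (elim disjE exE) (simp_all add: L1 L2 L3)
    show "(\<lambda>P. f P X) \<in> ?F" if "f \<in> set fs" for f X
      using fs_cases[OF that]
      by (elim disjE exE) (simp_all add: pmat_ent[OF p1] pmat_ent[OF p2] fun_algD(1)[OF F])
    show "injective_at n n (map (\<lambda>f. f (to_mat n n A, to_mat n n B)) fs)"
      unfolding injective_at_def
    proof (intro allI impI)
      fix X assume X: "sz n n X"
        and eq: "\<forall>f\<in>set (map (\<lambda>f. f (to_mat n n A, to_mat n n B)) fs). f X = 0"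
      have "L1 (to_mat n n A, to_mat n n B) X = 0"
        by (rule entries_zero[where L = L1 and r = n and c = n])
          (use eq X in \<open>simp_all add: fs_def ball_Un L1_def\<close>)
      moreover have "L2 (to_mat n n A, to_mat n n B) X = 0"
        by (rule entries_zero[where L = L2 and r = n and c = n])
          (use eq X in \<open>simp_all add: fs_def ball_Un L2_def\<close>)
      moreover have "ent (p l * X * i l) 0 0 = 0" if "l \<in> I" for l
        using eq that ls by (auto simp: fs_def)
      ultimately show "X = 0" using z[OF X] A B by (simp add: L1_def L2_def)
    qed
  qed
  then obtain g where g: "g \<in> ?F" "g (to_mat n n A, to_mat n n B) \<noteq> 0"
    "\<And>P. g P \<noteq> 0 \<Longrightarrow> injective_at n n (map (\<lambda>f. f P) fs)" by auto
  have main: "X = 0" if "g P \<noteq> 0" and X: "sz n n X" and c: "X * fst_fm n P = fst_fm n P * X" "X * snd_fm n P = snd_fm n P * X"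
    and l: "\<forall>l\<in>I. ent (p l * X * i l) 0 0 = 0" for P X
  proof -
    have "\<forall>f\<in>set (map (\<lambda>f. f P) fs). f X = 0"
      using c l ls by (auto simp: fs_def set_entries L1_def L2_def)
    then show ?thesis using g(3)[OF that(1)] X unfolding injective_at_def by simp
  qed
  show ?thesis
    by (intro bexI[OF _ g(1)] conjI allI impI g(2)) (elim conjE, rule main; assumption?; simp)
qed

text \<open>The polynomial in \<open>C\<close> with coefficient column \<open>x\<close>.
  Independence of the powers becomes injectivity in \<open>x\<close>, the form that
  \<open>injective_open\<close> handles.\<close>

definition mcomb :: "nat \<Rightarrow> nat \<Rightarrow> fmat \<Rightarrow> fmat \<Rightarrow> fmat" where
  "mcomb n m C x = (\<Sum>j<m. sc (ent x j 0) (mpow n C j))"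

lemma sz_mpow [simp]: "rw n C \<Longrightarrow> rw n (mpow n C j)" "cl n C \<Longrightarrow> cl n (mpow n C j)"
  by (induction j) simp_all

lemma sz_mcomb: "sz n n C \<Longrightarrow> sz n n (mcomb n m C x)"
  unfolding mcomb_def by (auto intro!: rw_sum cl_sum)

lemma mcomb_add: "mcomb n m C (x + y) = mcomb n m C x + mcomb n m C y"
  by (simp add: mcomb_def sc_add_left sum.distrib)

lemma mcomb_sc: "mcomb n m C (sc c x) = sc c (mcomb n m C x)"
  by (simp add: mcomb_def sc_sum)

lemma mcomb_commute:
  assumes "sz n n X" "X * C = C * X" shows "mcomb n m C x * X = X * mcomb n m C x"
proof -
  have "mpow n C j * X = X * mpow n C j" for j
  proof (induction j)
    case (Suc j)
    then show ?case using assms(2) by (metis mpow.simps(2) mult.assoc)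
  qed (use assms in simp)
  then show ?thesis by (simp add: mcomb_def sum_distrib_left sum_distrib_right)
qed

lemma powers_independent_open:
  assumes A: "sz n n A"
    and z: "\<And>x. sz m 1 x \<Longrightarrow> mcomb n m (A * A) x = 0 \<Longrightarrow> x = 0"
  shows "\<exists>f \<in> poly_funs n. f (to_mat n n A, B) \<noteq> 0 \<and>
    (\<forall>P x. f P \<noteq> 0 \<and> sz m 1 x \<and> mcomb n m (fst_fm n P * fst_fm n P) x = 0 \<longrightarrow> x = 0)"
proof -
  let ?F = "poly_funs n"
  note F = fun_alg_poly_funs[of n]
  define L where "L P = mcomb n m (fst_fm n P * fst_fm n P)" for P
  define fs where "fs = entries n n L"
  have szL: "sz n n (L P x)" for P x unfolding L_def by (rule sz_mcomb) simp
  have p: "pmat ?F (\<lambda>P. L P x)" for x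
    unfolding L_def mcomb_def
    by (intro pmat_sum[OF F] pmat_sc[OF F] pmat_mpow[OF F] pmat_mult[OF F] pmat_fst_snd_fm fun_algD(1)[OF F])
  have "\<exists>g\<in>?F. g (to_mat n n A, B) \<noteq> 0 \<and> (\<forall>P. g P \<noteq> 0 \<longrightarrow> injective_at m 1 (map (\<lambda>f. f P) fs))"
  proof (rule injective_open[OF F])
    show "linf (f P)" if "f \<in> set fs" for f P
      using that by (auto simp: fs_def set_entries linf_def L_def mcomb_add mcomb_sc)
    show "(\<lambda>P. f P X) \<in> ?F" if "f \<in> set fs" for f X
      using that pmat_ent[OF p] by (auto simp: fs_def set_entries)
    show "injective_at m 1 (map (\<lambda>f. f (to_mat n n A, B)) fs)"
      unfolding injective_at_def
    proof (intro allI impI)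
      fix x assume x: "sz m 1 x" and eq: "\<forall>f\<in>set (map (\<lambda>f. f (to_mat n n A, B)) fs). f x = 0"
      have "L (to_mat n n A, B) x = 0"
        by (rule entries_zero[where L = L and r = n and c = n, OF _ szL[of "(to_mat n n A, B)" x]]) (use eq in \<open>auto simp: fs_def\<close>)
      then show "x = 0" using z[OF x] A by (simp add: L_def)
    qed
  qed
  then obtain g where g: "g \<in> ?F" "g (to_mat n n A, B) \<noteq> 0"
    "\<And>P. g P \<noteq> 0 \<Longrightarrow> injective_at m 1 (map (\<lambda>f. f P) fs)" by auto
  have main: "x = 0" if "g P \<noteq> 0" and x: "sz m 1 x" and c: "mcomb n m (fst_fm n P * fst_fm n P) x = 0" for P x
  proof -
    have "\<forall>f\<in>set (map (\<lambda>f. f P) fs). f x = 0" using c by (auto simp: fs_def set_entries L_def)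
    then show ?thesis using g(3)[OF that(1)] x unfolding injective_at_def by simp
  qed
  show ?thesis
    by (intro bexI[OF _ g(1)] conjI allI impI g(2)) (elim conjE, rule main; assumption?; simp)
qed

section \<open>Twisting the summands\<close>

text \<open>The weights 3 and 2 make both sides of \<open>A * A = B * B * B\<close> scale by the
  same factor \<open>s ^ 6\<close>.\<close>

lemma twist_rp:
  assumes "rep_pair d A B" "s \<noteq> 0" shows "rep_pair d (sc (s ^ 3) A) (sc (s ^ 2) B)"
proof -
  obtain A' B' where inv: "inv_pair d A A'" "inv_pair d B B'" using assms(1) by (auto simp: rep_pair_def)
  have "inv_pair d (sc (s ^ 3) A) (sc (1 / s ^ 3) A')" "inv_pair d (sc (s ^ 2) B) (sc (1 / s ^ 2) B')"
    using inv assms(2) by (simp_all add: inv_pair_def)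
  moreover have "sc (s ^ 3) A * sc (s ^ 3) A = sc (s ^ 2) B * sc (s ^ 2) B * sc (s ^ 2) B"
    using rep_pairD(3)[OF assms(1)] by (simp add: power_add[symmetric])
  ultimately show ?thesis unfolding rep_pair_def by blast
qed

lemma twist_scalar_end:
  assumes "scalar_end d A B" "a \<noteq> 0" "b \<noteq> 0" shows "scalar_end d (sc a A) (sc b B)"
  unfolding scalar_end_def
proof (intro allI impI)
  fix X assume X: "sz d d X \<and> X * sc a A = sc a A * X \<and> X * sc b B = sc b B * X"
  then have "X * A = A * X" "X * B = B * X"
    by (auto intro: sc_cancel[OF assms(2)] sc_cancel[OF assms(3)])
  then show "\<exists>c. X = sc c (E d)" using assms(1) X unfolding scalar_end_def by blast
qed

lemma simple_scalar_end: "simple_pair d A B \<Longrightarrow> scalar_end d A B"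
  unfolding scalar_end_def by (intro allI impI schur[of d A B]) simp_all

lemma twist_factor_cofinite:
  "eventually (\<lambda>t::complex. 1 + of_nat l * t \<noteq> 0) cofinite"
  using pfun_nonzero_cofinite[OF pfun_poly[of "[:1, of_nat l:]"], of 0] by (simp add: mult.commute)

text \<open>For different \<open>l\<close> and \<open>k\<close> at least one index \<open>a\<close>
  is positive, and at the zero -1/a of its factor the other factor does not vanish. So the two sixth
  powers, multiplied by nonzero constants, are different polynomials in \<open>t\<close> and agree
  at finitely many parameters only.\<close>

lemma twisted_scalars_distinct:
  assumes I: "finite (I :: nat set)" and c: "\<And>l. l \<in> I \<Longrightarrow> c l \<noteq> (0 :: complex)"
  shows "eventually (\<lambda>t. inj_on (\<lambda>l. (1 + of_nat l * t) ^ 6 * c l) I) cofinite"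
proof -
  have pair: "eventually (\<lambda>t. l \<noteq> k \<longrightarrow> (1 + of_nat l * t) ^ 6 * c l \<noteq> (1 + of_nat k * t) ^ 6 * c k) cofinite"
    if lk: "l \<in> I" "k \<in> I" for l k
  proof (cases "l = k")
    case False
    let ?f = "\<lambda>t. (1 + of_nat l * t) ^ 6 * c l - (1 + of_nat k * t) ^ 6 * c k"
    let ?p = "smult (c l) ([:1, of_nat l:] ^ 6) - smult (c k) ([:1, of_nat k:] ^ 6)"
    have "?f = (\<lambda>t. poly ?p t)" by (auto simp: mult.commute)
    then have f: "?f \<in> pfun" using pfun_poly by metis
    have "?f (- 1 / of_nat a) \<noteq> 0" if "a = l \<and> l > 0 \<or> a = k \<and> k > 0" for a
    proof -
      have r: "1 + of_nat b * (- 1 / of_nat a :: complex) = 0 \<longleftrightarrow> b = a" for b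
        using that by (auto simp: field_simps)
      show ?thesis using r[of l] r[of k] that False c lk by auto
    qed
    then obtain t where "?f t \<noteq> 0" using False by (metis gr0I)
    from pfun_nonzero_cofinite[OF f this] show ?thesis by (rule eventually_mono) simp
  qed simp
  have "eventually (\<lambda>t. \<forall>l\<in>I. \<forall>k\<in>I. l \<noteq> k \<longrightarrow>
      (1 + of_nat l * t) ^ 6 * c l \<noteq> (1 + of_nat k * t) ^ 6 * c k) cofinite"
    using pair by (simp add: eventually_ball_finite_distrib I)
  then show ?thesis by (rule eventually_mono) (auto simp: inj_on_def)
qed

text \<open>Summand \<open>l\<close> is twisted by 1 + l t, a factor that is 1 at the starting point
  and different for different summands. Cofinitely many parameters give distinct central scalars and
  summands with scalar endomorphisms. At such a point \<open>P0\<close> the endomorphisms are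
  separated by \<open>card I\<close> corner entries and the first \<open>card I\<close> powers of
  the central element are independent; both facts are returned as open conditions.\<close>

lemma twisted_family:
  fixes I :: "nat set" and A B :: "nat \<Rightarrow> complex \<Rightarrow> fmat"
  assumes D: "dsum n I d i p" and d: "\<And>l. l \<in> I \<Longrightarrow> d l > 0"
    and AB: "\<And>l. l \<in> I \<Longrightarrow> pmat pfun (A l)" "\<And>l. l \<in> I \<Longrightarrow> pmat pfun (B l)"
    and rep_pair: "\<And>l t. l \<in> I \<Longrightarrow> rep_pair (d l) (A l t) (B l t)"
    and c: "\<And>l t. l \<in> I \<Longrightarrow> A l t * A l t = sc (c l) (E (d l))" "\<And>l. l \<in> I \<Longrightarrow> c l \<noteq> 0"
    and se: "\<And>l. l \<in> I \<Longrightarrow> eventually (\<lambda>t. scalar_end (d l) (A l t) (B l t)) cofinite"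
  shows "\<exists>S P0. irreducible_in (rep_zariski n) S \<and> P0 \<in> S \<and>
    (to_mat n n (glue I i p (\<lambda>l. A l 0)), to_mat n n (glue I i p (\<lambda>l. B l 0))) \<in> S \<and>
    (\<exists>f\<in>poly_funs n. f P0 \<noteq> 0 \<and>
      (\<forall>P X. f P \<noteq> 0 \<and> sz n n X \<and> X * fst_fm n P = fst_fm n P * X \<and> X * snd_fm n P = snd_fm n P * X \<and>
        (\<forall>l\<in>I. ent (p l * X * i l) 0 0 = 0) \<longrightarrow> X = 0)) \<and>
    (\<exists>f\<in>poly_funs n. f P0 \<noteq> 0 \<and>
      (\<forall>P x. f P \<noteq> 0 \<and> sz (card I) 1 x \<and> mcomb n (card I) (fst_fm n P * fst_fm n P) x = 0 \<longrightarrow> x = 0))"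
proof -
  define s :: "nat \<Rightarrow> complex \<Rightarrow> complex" where "s l t = 1 + of_nat l * t" for l t
  define A' where "A' t = (\<lambda>l. sc (s l t ^ 3) (A l t))" for t
  define B' where "B' t = (\<lambda>l. sc (s l t ^ 2) (B l t))" for t
  define GA where "GA t = glue I i p (A' t)" for t
  define GB where "GB t = glue I i p (B' t)" for t
  define T where "T = {t. \<forall>l\<in>I. s l t \<noteq> 0}"
  note F = fun_alg_pfun
  note fin = dsumD(1)[OF D]
  have s_pfun: "(\<lambda>t. s l t ^ k) \<in> pfun" for l k
    using pfun_poly[of "[:1, of_nat l:] ^ k"] by (simp add: s_def mult.commute)
  have pm: "pmat pfun GA" "pmat pfun GB"
    unfolding GA_def GB_def glue_def A'_def B'_def
    by (intro pmat_sum[OF F] pmat_mult[OF F] pmat_sc[OF F] pmat_const[OF F] s_pfun AB; assumption)+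
  have evT: "eventually (\<lambda>t. t \<in> T) cofinite"
    unfolding T_def s_def using twist_factor_cofinite by (simp add: eventually_ball_finite_distrib fin)
  have rep_pair': "rep_pair (d l) (A' t l) (B' t l)" if "t \<in> T" "l \<in> I" for t l
    unfolding A'_def B'_def by (rule twist_rp[OF rep_pair]) (use that in \<open>auto simp: T_def\<close>)
  have rpG: "rep_pair n (GA t) (GB t)" if "t \<in> T" for t
    unfolding GA_def GB_def by (rule glue_rp[OF D rep_pair'[OF that]])
  have c': "A' t l * A' t l = sc (s l t ^ 6 * c l) (E (d l))" if "l \<in> I" for t l
    using c(1)[OF that] by (simp add: A'_def power_add[symmetric])
  have szG: "sz n n (GA t)" "sz n n (GB t)" for t unfolding GA_def GB_def by (rule sz_glue[OF D])+
  define S where "S = (\<lambda>t. (to_mat n n (GA t), to_mat n n (GB t))) ` T"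
  have irr: "irreducible_in (rep_zariski n) S"
    unfolding S_def by (rule curve_irreducible[OF pm evT rpG])
  have "eventually (\<lambda>t. \<forall>l\<in>I. scalar_end (d l) (A l t) (B l t)) cofinite"
    using se by (simp add: eventually_ball_finite_distrib fin)
  moreover have "eventually (\<lambda>t. inj_on (\<lambda>l. s l t ^ 6 * c l) I) cofinite"
    unfolding s_def by (rule twisted_scalars_distinct[OF fin c(2)])
  ultimately have "eventually (\<lambda>t. t \<in> T \<and> (\<forall>l\<in>I. scalar_end (d l) (A l t) (B l t)) \<and>
      inj_on (\<lambda>l. s l t ^ 6 * c l) I) cofinite"
    using evT by (simp add: eventually_conj_iff)
  then obtain t where t: "t \<in> T" "\<And>l. l \<in> I \<Longrightarrow> scalar_end (d l) (A l t) (B l t)"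
    "inj_on (\<lambda>l. s l t ^ 6 * c l) I" using cofinite_complex_ex by blast
  have se': "scalar_end (d l) (A' t l) (B' t l)" if "l \<in> I" for l
    unfolding A'_def B'_def by (rule twist_scalar_end[OF t(2)[OF that]]) (use t(1) that in \<open>auto simp: T_def\<close>)
  have z1: "X = 0" if "sz n n X" "X * GA t = GA t * X" "X * GB t = GB t * X"
    "\<And>l. l \<in> I \<Longrightarrow> ent (p l * X * i l) 0 0 = 0" for X
    using glue_end_zero[OF D rep_pair'[OF t(1)] c' t(3) d se' that(1) that(2)[unfolded GA_def] that(3)[unfolded GB_def] that(4)] .
  have "GA t * GA t = glue I i p (\<lambda>l. A' t l * A' t l)"
    unfolding GA_def by (rule glue_mult[OF D]) (use rep_pairD(1)[OF rep_pair'[OF t(1)]] in auto)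
  also have "\<dots> = glue I i p (\<lambda>l. sc (s l t ^ 6 * c l) (E (d l)))" by (rule glue_cong[OF c'])
  finally have GG: "GA t * GA t = glue I i p (\<lambda>l. sc (s l t ^ 6 * c l) (E (d l)))" .
  have z2: "x = 0" if x: "sz (card I) 1 x" "mcomb n (card I) (GA t * GA t) x = 0" for x
  proof (rule sz_eqI[OF x(1)])
    fix j k :: nat assume "j < card I" "k < 1"
    then show "ent x j k = ent 0 j k"
      using glue_mpow_independent[OF D d t(3) x(2)[unfolded mcomb_def GG]] by simp
  qed simp
  have "s l 0 = 1" for l by (simp add: s_def)
  then have "(to_mat n n (glue I i p (\<lambda>l. A l 0)), to_mat n n (glue I i p (\<lambda>l. B l 0))) \<in> S"
    unfolding S_def by (intro image_eqI[of _ _ 0]) (simp_all add: GA_def GB_def A'_def B'_def T_def)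
  moreover have "(to_mat n n (GA t), to_mat n n (GB t)) \<in> S" using t(1) by (auto simp: S_def)
  moreover have e1: "\<exists>f\<in>poly_funs n. f (to_mat n n (GA t), to_mat n n (GB t)) \<noteq> 0 \<and>
      (\<forall>P X. f P \<noteq> 0 \<and> sz n n X \<and> X * fst_fm n P = fst_fm n P * X \<and> X * snd_fm n P = snd_fm n P * X \<and>
        (\<forall>l\<in>I. ent (p l * X * i l) 0 0 = 0) \<longrightarrow> X = 0)"
    by (rule end_zero_open[OF szG(1)[of t] szG(2)[of t] fin]) (rule z1; blast)
  moreover have e2: "\<exists>f\<in>poly_funs n. f (to_mat n n (GA t), to_mat n n (GB t)) \<noteq> 0 \<and>
      (\<forall>P x. f P \<noteq> 0 \<and> sz (card I) 1 x \<and> mcomb n (card I) (fst_fm n P * fst_fm n P) x = 0 \<longrightarrow> x = 0)"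
    by (rule powers_independent_open[OF szG(1)[of t]]) (rule z2)
  ultimately show ?thesis
    using irr e1 e2
    by (intro exI[of _ S] exI[of _ "(to_mat n n (GA t), to_mat n n (GB t))"] conjI)
qed

text \<open>The pair is the value at 0 of a polynomial family whose generic member has only scalar
  endomorphisms. The central scalar \<open>c\<close> is constant along the family, because
  \<open>twisted_family\<close> tells summands apart by the twisting factors and fixed
  scalars.\<close>

definition deform :: "nat \<Rightarrow> fmat \<Rightarrow> fmat \<Rightarrow> bool" where
  "deform d A B \<longleftrightarrow> (\<exists>At Bt c. pmat pfun At \<and> pmat pfun Bt \<and> At 0 = A \<and> Bt 0 = B \<and> c \<noteq> 0 \<and>
     (\<forall>t. rep_pair d (At t) (Bt t) \<and> At t * At t = sc c (E d)) \<and>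
     eventually (\<lambda>t. scalar_end d (At t) (Bt t)) cofinite)"

text \<open>
  One curve through \<open>V\<close> twists all \<open>card I\<close> simple summands; near its generic point the powers of the
  central element span at least \<open>card I\<close> dimensions of the endomorphism ring. On the other curve
  two summands merge into an indecomposable with scalar endomorphisms; near its generic point the
  endomorphism ring has dimension less than \<open>card I\<close>. So the two curves lie in no common
  irreducible set.
\<close>

lemma two_components:
  fixes I :: "nat set"
  assumes D: "dsum n I d i p" and S: "\<And>l. l \<in> I \<Longrightarrow> simple_pair (d l) (A l) (B l)"
    and ab: "a \<in> I" "b \<in> I" "a \<noteq> b"
    and def: "deform (d a + d b) (A a + inj2 (d a) (d b) * A b * proj2 (d a) (d b))
      (B a + inj2 (d a) (d b) * B b * proj2 (d a) (d b))"
    and V: "V = (to_mat n n (glue I i p A), to_mat n n (glue I i p B))"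
  shows "\<exists>Z1 Z2. irreducible_component (rep_zariski n) Z1 \<and>
           irreducible_component (rep_zariski n) Z2 \<and> Z1 \<noteq> Z2 \<and> V \<in> Z1 \<inter> Z2"
proof -
  note F = fun_alg_pfun
  have "\<forall>l. \<exists>c. l \<in> I \<longrightarrow> c \<noteq> 0 \<and> A l * A l = sc c (E (d l))" using simple_pairD(3)[OF S] by metis
  then obtain c where c: "\<And>l. l \<in> I \<Longrightarrow> c l \<noteq> 0" "\<And>l. l \<in> I \<Longrightarrow> A l * A l = sc (c l) (E (d l))" by metis
  have szs: "sz (d l) (d l) (A l)" "sz (d l) (d l) (B l)" if "l \<in> I" for l
    using rep_pairD[OF simple_pairD(1)[OF S[OF that]]] by auto
  have "\<exists>S P0. irreducible_in (rep_zariski n) S \<and> P0 \<in> S \<and>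
    (to_mat n n (glue I i p (\<lambda>l. (\<lambda>_. A l) 0)), to_mat n n (glue I i p (\<lambda>l. (\<lambda>_. B l) 0))) \<in> S \<and>
    (\<exists>f\<in>poly_funs n. f P0 \<noteq> 0 \<and>
      (\<forall>P X. f P \<noteq> 0 \<and> sz n n X \<and> X * fst_fm n P = fst_fm n P * X \<and> X * snd_fm n P = snd_fm n P * X \<and>
        (\<forall>l\<in>I. ent (p l * X * i l) 0 0 = 0) \<longrightarrow> X = 0)) \<and> (\<exists>f\<in>poly_funs n. f P0 \<noteq> 0 \<and>
      (\<forall>P x. f P \<noteq> 0 \<and> sz (card I) 1 x \<and> mcomb n (card I) (fst_fm n P * fst_fm n P) x = 0 \<longrightarrow> x = 0))"
    by (rule twisted_family[OF D simple_pairD(2)[OF S], where A = "\<lambda>l t. A l" and B = "\<lambda>l t. B l" and c = c])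
      (simp_all add: simple_pairD(1)[OF S] c simple_scalar_end[OF S] pmat_const[OF F])
  then obtain S2 P2 where S2: "irreducible_in (rep_zariski n) S2" "P2 \<in> S2" "V \<in> S2"
    and ex2: "(\<exists>f\<in>poly_funs n. f P2 \<noteq> 0 \<and>
      (\<forall>P x. f P \<noteq> 0 \<and> sz (card I) 1 x \<and> mcomb n (card I) (fst_fm n P * fst_fm n P) x = 0 \<longrightarrow> x = 0))"
    unfolding V[symmetric] by (elim exE conjE) (rule that)
  from ex2 obtain f2 where f2: "f2 \<in> poly_funs n" "f2 P2 \<noteq> 0"
      "\<forall>P x. f2 P \<noteq> 0 \<and> sz (card I) 1 x \<and> mcomb n (card I) (fst_fm n P * fst_fm n P) x = 0 \<longrightarrow> x = 0"
    by (elim bexE conjE) (rule that)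
  obtain At Bt e where At: "pmat pfun At" "pmat pfun Bt" "e \<noteq> 0"
      "At 0 = A a + inj2 (d a) (d b) * A b * proj2 (d a) (d b)"
      "Bt 0 = B a + inj2 (d a) (d b) * B b * proj2 (d a) (d b)"
      "\<And>t. rep_pair (d a + d b) (At t) (Bt t)" "\<And>t. At t * At t = sc e (E (d a + d b))"
      "eventually (\<lambda>t. scalar_end (d a + d b) (At t) (Bt t)) cofinite"
    using def unfolding deform_def by auto
  define d' where "d' = d(a := d a + d b)"
  define i' where "i' = i(a := i a + i b * proj2 (d a) (d b))"
  define p' where "p' = p(a := p a + inj2 (d a) (d b) * p b)"
  define A' where "A' l t = (if l = a then At t else A l)" for l t
  define B' where "B' l t = (if l = a then Bt t else B l)" for l t
  define c' where "c' = c(a := e)"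
  note M = dsum_merge[OF D ab, folded d'_def i'_def p'_def]
  have gl: "glue (I - {b}) i' p' (\<lambda>l. A' l 0) = glue I i p A" "glue (I - {b}) i' p' (\<lambda>l. B' l 0) = glue I i p B"
    using M(2)[of A] M(2)[of B] szs ab At(4,5) by (auto simp: A'_def B'_def fun_upd_def cong: if_cong)
  have "\<exists>S P0. irreducible_in (rep_zariski n) S \<and> P0 \<in> S \<and>
    (to_mat n n (glue (I - {b}) i' p' (\<lambda>l. A' l 0)), to_mat n n (glue (I - {b}) i' p' (\<lambda>l. B' l 0))) \<in> S \<and>
    (\<exists>f\<in>poly_funs n. f P0 \<noteq> 0 \<and>
      (\<forall>P X. f P \<noteq> 0 \<and> sz n n X \<and> X * fst_fm n P = fst_fm n P * X \<and> X * snd_fm n P = snd_fm n P * X \<and>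
        (\<forall>l\<in>I - {b}. ent (p' l * X * i' l) 0 0 = 0) \<longrightarrow> X = 0)) \<and>
    (\<exists>f\<in>poly_funs n. f P0 \<noteq> 0 \<and>
      (\<forall>P x. f P \<noteq> 0 \<and> sz (card (I - {b})) 1 x \<and> mcomb n (card (I - {b})) (fst_fm n P * fst_fm n P) x = 0 \<longrightarrow> x = 0))"
  proof (rule twisted_family[OF M(1), where c = c'])
    fix l assume l: "l \<in> I - {b}"
    then have lI: "l \<in> I" by simp
    show "d' l > 0" using simple_pairD(2)[OF S[OF lI]] simple_pairD(2)[OF S[OF ab(1)]] by (simp add: d'_def)
    show "pmat pfun (A' l)" "pmat pfun (B' l)"
      using At(1,2) pmat_const[OF F] by (cases "l = a"; simp add: A'_def[abs_def] B'_def[abs_def])+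
    show "rep_pair (d' l) (A' l t) (B' l t)" for t
      using At(6) simple_pairD(1)[OF S[OF lI]] by (simp add: d'_def A'_def B'_def)
    show "A' l t * A' l t = sc (c' l) (E (d' l))" for t
      using At(7) c(2)[OF lI] by (simp add: d'_def A'_def c'_def)
    show "c' l \<noteq> 0" using c(1)[OF lI] At(3) by (simp add: c'_def)
    show "eventually (\<lambda>t. scalar_end (d' l) (A' l t) (B' l t)) cofinite"
      using At(8) simple_scalar_end[OF S[OF lI]] by (simp add: d'_def A'_def B'_def)
  qed
  then obtain S1 P1 where S1: "irreducible_in (rep_zariski n) S1" "P1 \<in> S1" "V \<in> S1"
    and ex1: "\<exists>f1\<in>poly_funs n. f1 P1 \<noteq> 0 \<and>
      (\<forall>P X. f1 P \<noteq> 0 \<and> sz n n X \<and> X * fst_fm n P = fst_fm n P * X \<and> X * snd_fm n P = snd_fm n P * X \<and>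
        (\<forall>l\<in>I - {b}. ent (p' l * X * i' l) 0 0 = 0) \<longrightarrow> X = 0)"
    unfolding gl V[symmetric] by (elim exE conjE) (rule that)
  from ex1 obtain f1 where f1: "f1 \<in> poly_funs n" "f1 P1 \<noteq> 0"
      "\<forall>P X. f1 P \<noteq> 0 \<and> sz n n X \<and> X * fst_fm n P = fst_fm n P * X \<and> X * snd_fm n P = snd_fm n P * X \<and>
        (\<forall>l\<in>I - {b}. ent (p' l * X * i' l) 0 0 = 0) \<longrightarrow> X = 0"
    by (elim bexE conjE) (rule that)
  obtain Z1 where Z1: "irreducible_component (rep_zariski n) Z1" "S1 \<subseteq> Z1"
    using irreducible_component_exists[OF S1(1)] by blast
  obtain Z2 where Z2: "irreducible_component (rep_zariski n) Z2" "S2 \<subseteq> Z2"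
    using irreducible_component_exists[OF S2(1)] by blast
  have "Z1 \<noteq> Z2"
  proof
    assume eq: "Z1 = Z2"
    have irr: "irreducible_in (rep_zariski n) Z1" using Z1(1) by (simp add: irreducible_component_def)
    have "P1 \<in> Z1" "P2 \<in> Z1" using S1(2) Z1(2) S2(2) Z2(2) eq by auto
    then obtain P where P: "P \<in> Z1" "f1 P \<noteq> 0" "f2 P \<noteq> 0"
      using irreducible_common_point[OF irr f1(1) f2(1) _ f1(2) _ f2(2)] by blast
    have "P \<in> rep_variety n" using irr P(1) by (auto simp: irreducible_in_iff topspace_rep_zariski)
    note rpP = rep_variety_fm[OF this]
    define C where "C = fst_fm n P * fst_fm n P"
    have comm: "fst_fm n P * C = C * fst_fm n P" "snd_fm n P * C = C * snd_fm n P"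
    proof -
      show "fst_fm n P * C = C * fst_fm n P" by (simp add: C_def mult.assoc)
      show "snd_fm n P * C = C * snd_fm n P" unfolding C_def rep_pairD(3)[OF rpP] by (simp add: mult.assoc)
    qed
    have fin: "finite I" by (rule dsumD(1)[OF D])
    obtain ls where ls: "set ls = I - {b}" "length ls = card (I - {b})"
      using finite_distinct_list[of "I - {b}"] fin distinct_card by (metis finite_Diff)
    \<comment> \<open>These are \<open>card I - 1\<close> functionals on \<open>card I\<close>
      coefficients. Some nonzero coefficient column passes them all; the resulting polynomial in
      \<open>C\<close> is an endomorphism of \<open>P\<close>, hence zero by \<open>f1\<close>, and
      \<open>f2\<close> then says that the column is zero.\<close>
    define fs where "fs = map (\<lambda>l x. ent (p' l * mcomb n (card I) C x * i' l) 0 0) ls"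
    have "card I > 0" using fin ab(1) by (auto simp: card_gt_0_iff)
    then have "length fs < card I * 1" using ls(2) ab(2) by (simp add: fs_def card_Diff_singleton)
    moreover have "linf f" if "f \<in> set fs" for f
      using that by (auto simp: fs_def linf_def mcomb_add mcomb_sc algebra_simps)
    ultimately obtain x where x: "sz (card I) 1 x" "x \<noteq> 0" "\<forall>f\<in>set fs. f x = 0"
      using underdetermined[of fs "card I" 1] by blast
    have z: "mcomb n (card I) C x = 0"
    proof (rule f1(3)[rule_format, of P], intro conjI)
      show "f1 P \<noteq> 0" by (rule P(2))
      show "rw n (mcomb n (card I) C x)" "cl n (mcomb n (card I) C x)"
        using sz_mcomb[of n C] by (simp_all add: C_def)
      show "mcomb n (card I) C x * fst_fm n P = fst_fm n P * mcomb n (card I) C x"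
        "mcomb n (card I) C x * snd_fm n P = snd_fm n P * mcomb n (card I) C x"
        by (rule mcomb_commute; simp add: comm)+
      show "\<forall>l\<in>I - {b}. ent (p' l * mcomb n (card I) C x * i' l) 0 0 = 0"
        using x(3) ls(1) by (simp add: fs_def)
    qed
    have "x = 0"
      by (rule f2(3)[rule_format, of P], intro conjI P(3)) (use x(1) z in \<open>simp_all add: C_def\<close>)
    then show False using x(2) by simp
  qed
  then show ?thesis using Z1 Z2 S1(3) S2(3) by blast
qed

section \<open>Deformations from nonsplit extensions\<close>

text \<open>The block matrix with diagonal \<open>X\<close>, \<open>Y\<close> and upper right corner
  \<open>u\<close>: the first \<open>a\<close> coordinates span the subrepresentation, the last
  \<open>b\<close> give the quotient.\<close>

definition tri :: "nat \<Rightarrow> nat \<Rightarrow> fmat \<Rightarrow> fmat \<Rightarrow> fmat \<Rightarrow> fmat" where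
  "tri a b X Y u = X + inj2 a b * Y * proj2 a b + u * proj2 a b"

lemma sz_tri [simp]:
  assumes "sz a a X" "sz b b Y" "sz a b u" shows "rw (a + b) (tri a b X Y u)" "cl (a + b) (tri a b X Y u)"
  using assms rw_mono[of a _ "a + b"] cl_mono[of a _ "a + b"] by (simp_all add: tri_def)

lemma tri_mult:
  assumes "sz a a X" "sz b b Y" "sz a b u" "sz a a X'" "sz b b Y'" "sz a b u'"
  shows "tri a b X Y u * tri a b X' Y' u' = tri a b (X * X') (Y * Y') (X * u' + u * Y')"
  using assms by (simp add: tri_def distrib_left distrib_right mult.assoc add.assoc)

lemma tri_E: "tri a b (E a) (E b) 0 = E (a + b)"
  by (simp add: tri_def E_add_inj2_proj2)

lemma tri_restrict:
  assumes "sz a a X" "sz b b Y" "sz a b u"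
  shows "tri a b X Y u * E a = X" "tri a b X Y u * inj2 a b = inj2 a b * Y + u"
    "E a * tri a b X Y u = X + u * proj2 a b" "proj2 a b * tri a b X Y u = Y * proj2 a b"
  using assms by (simp_all add: tri_def distrib_left distrib_right mult.assoc)

lemma tri_blocks:
  assumes "sz a a X" "sz b b Y" "sz a b u"
  shows "E a * (tri a b X Y u * E a) = X" "E a * (tri a b X Y u * inj2 a b) = u"
    "proj2 a b * (tri a b X Y u * inj2 a b) = Y"
  unfolding tri_restrict[OF assms] using assms by (simp_all add: distrib_left)

lemma tri_inv_pair:
  assumes "inv_pair a X X'" "inv_pair b Y Y'" "sz a b u"
  shows "inv_pair (a + b) (tri a b X Y u) (tri a b X' Y' (- (X' * u * Y')))"
proof -
  have "X * (X' * u * Y') = u * Y'" using assms by (simp add: inv_pair_def mult.assoc[symmetric])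
  moreover have "X' * u * Y' * Y = X' * u" using assms by (simp add: inv_pair_def mult.assoc)
  ultimately show ?thesis
    using assms by (simp add: inv_pair_def tri_mult tri_E)
qed

text \<open>The two sides of the cocycle condition are the upper right corners of the square of the
  first matrix and of the cube of the second.\<close>

lemma tri_rp:
  assumes rpA: "rep_pair a A B" and rpC: "rep_pair b C D" and uw: "sz a b u" "sz a b w"
    and cocycle: "A * u + u * C = B * B * w + B * w * D + w * D * D"
  shows "rep_pair (a + b) (tri a b A C u) (tri a b B D w)"
proof -
  note s = rep_pairD[OF rpA] rep_pairD[OF rpC]
  obtain A' B' C' D' where "inv_pair a A A'" "inv_pair a B B'" "inv_pair b C C'" "inv_pair b D D'"
    using rpA rpC unfolding rep_pair_def by auto
  then have "\<exists>M. inv_pair (a + b) (tri a b A C u) M" "\<exists>M. inv_pair (a + b) (tri a b B D w) M"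
    using tri_inv_pair[OF _ _ uw(1)] tri_inv_pair[OF _ _ uw(2)] by meson+
  moreover have "tri a b A C u * tri a b A C u = tri a b B D w * tri a b B D w * tri a b B D w"
    using s uw cocycle by (simp add: tri_mult) (simp add: algebra_simps)
  ultimately show ?thesis unfolding rep_pair_def by simp
qed

text \<open>The lower left block of \<open>X\<close> is a homomorphism from the sub to the quotient,
  hence zero. Then the diagonal blocks are scalars \<alpha> and \<beta> by Schur's lemma; if they
  differed, the upper right block divided by their difference would exhibit \<open>(u, w)\<close> as
  a coboundary. With equal scalars the upper right block is a homomorphism from the quotient to the
  sub, again zero.\<close>

lemma tri_scalar_end:
  assumes S: "simple_pair a A B" and S': "simple_pair b C D"
    and ni: "\<not> pair_iso a A B b C D" "\<not> pair_iso b C D a A B"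
    and uw: "sz a b u" "sz a b w"
    and nc: "\<not> (\<exists>z. sz a b z \<and> u = A * z - z * C \<and> w = B * z - z * D)"
  shows "scalar_end (a + b) (tri a b A C u) (tri a b B D w)"
  unfolding scalar_end_def
proof (intro allI impI)
  fix X assume h: "sz (a + b) (a + b) X \<and> X * tri a b A C u = tri a b A C u * X \<and>
    X * tri a b B D w = tri a b B D w * X"
  have X: "sz (a + b) (a + b) X" using h by simp
  have szs: "sz a a A" "sz a a B" "sz b b C" "sz b b D"
    using rep_pairD[OF simple_pairD(1)[OF S]] rep_pairD[OF simple_pairD(1)[OF S']] by auto
  define J Q where "J = inj2 a b" and "Q = proj2 a b"
  define X11 X12 X21 X22 where "X11 = E a * X * E a" and "X12 = E a * X * J"
    and "X21 = Q * X * E a" and "X22 = Q * X * J"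
  have sX: "sz a a X11" "sz a b X12" "sz b a X21" "sz b b X22"
    by (simp_all add: X11_def X12_def X21_def X22_def J_def Q_def)
  have blocks: "X21 * M = N * X21" "X21 = 0 \<Longrightarrow> X11 * M = M * X11" "X21 = 0 \<Longrightarrow> X22 * N = N * X22"
    "X12 * N + X11 * v = M * X12 + v * X22"
    if M: "sz a a M" "sz b b N" "sz a b v" and c: "X * tri a b M N v = tri a b M N v * X" for M N v
  proof -
    note r = tri_restrict[OF M, folded J_def Q_def]
    have "X21 * M = Q * (X * tri a b M N v) * E a" using M by (simp add: X21_def r mult.assoc)
    also have "\<dots> = N * X21" unfolding c by (simp add: X21_def r mult.assoc[symmetric])
    finally show "X21 * M = N * X21" .
    have "X11 * M = E a * (X * tri a b M N v) * E a" using M by (simp add: X11_def r mult.assoc)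
    also have "\<dots> = M * X11 + v * X21"
      unfolding c using M by (simp add: X11_def X21_def r mult.assoc[symmetric] distrib_right)
    finally show "X21 = 0 \<Longrightarrow> X11 * M = M * X11" by simp
    have "X22 * N + X21 * v = Q * (X * tri a b M N v) * J"
      using M by (simp add: X22_def X21_def r mult.assoc distrib_left)
    also have "\<dots> = N * X22" unfolding c by (simp add: X22_def r mult.assoc[symmetric])
    finally show "X21 = 0 \<Longrightarrow> X22 * N = N * X22" by simp
    have "X12 * N + X11 * v = E a * (X * tri a b M N v) * J"
      using M by (simp add: X12_def X11_def r mult.assoc distrib_left)
    also have "\<dots> = M * X12 + v * X22"
      unfolding c using M by (simp add: X12_def X22_def r mult.assoc[symmetric] distrib_right)
    finally show "X12 * N + X11 * v = M * X12 + v * X22" .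
  qed
  have cA: "X * tri a b A C u = tri a b A C u * X" and cB: "X * tri a b B D w = tri a b B D w * X"
    using h by simp_all
  note bA = blocks[OF szs(1,3) uw(1) cA] and bB = blocks[OF szs(2,4) uw(2) cB]
  have X21: "X21 = 0" using simple_hom_zero[OF S S' ni(1) sX(3) bA(1) bB(1)] .
  obtain \<alpha> where \<alpha>: "X11 = sc \<alpha> (E a)" using schur[OF S sX(1) bA(2)[OF X21] bB(2)[OF X21]] by blast
  obtain \<beta> where \<beta>: "X22 = sc \<beta> (E b)" using schur[OF S' sX(4) bA(3)[OF X21] bB(3)[OF X21]] by blast
  have e: "sc (\<alpha> - \<beta>) u = A * X12 - X12 * C" "sc (\<alpha> - \<beta>) w = B * X12 - X12 * D"
    using bA(4) bB(4) uw unfolding \<alpha> \<beta> by (simp_all add: sc_diff_left algebra_simps)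
  have "\<alpha> = \<beta>"
  proof (rule ccontr)
    assume ne: "\<alpha> \<noteq> \<beta>"
    let ?z = "sc (1 / (\<alpha> - \<beta>)) X12"
    have su: "sc (1 / (\<alpha> - \<beta>)) (sc (\<alpha> - \<beta>) x) = x" for x using ne by simp
    have f: "sc (1 / (\<alpha> - \<beta>)) (sc (\<alpha> - \<beta>) u) = A * ?z - ?z * C"
      "sc (1 / (\<alpha> - \<beta>)) (sc (\<alpha> - \<beta>) w) = B * ?z - ?z * D"
      unfolding e by (simp_all add: sc_diff)
    have "sz a b ?z" using sX(2) by simp
    then show False using nc f[unfolded su] by metis
  qed
  then have "X12 * C = A * X12" "X12 * D = B * X12" using e by simp_all
  then have X12: "X12 = 0" using simple_hom_zero[OF S' S ni(2) sX(2)] by simp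
  have "X = (E a + J * Q) * X * (E a + J * Q)"
    using X by (simp add: J_def Q_def E_add_inj2_proj2)
  also have "\<dots> = X11 + X12 * Q + J * X21 + J * X22 * Q"
    by (simp add: X11_def X12_def X21_def X22_def distrib_left distrib_right mult.assoc)
  also have "\<dots> = sc \<alpha> (E (a + b))"
    unfolding X12 X21 \<alpha> \<beta> \<open>\<alpha> = \<beta>\<close>
    by (simp add: J_def Q_def sc_add[symmetric] E_add_inj2_proj2)
  finally show "\<exists>c. X = sc c (E (a + b))" by blast
qed

text \<open>Multiplying the cocycle by \<open>t\<close> gives the direct sum at 0, while for nonzero
  \<open>t\<close> the class stays nontrivial, so that \<open>tri_scalar_end\<close>
  applies.\<close>

lemma nonsplit_deform:
  assumes S: "simple_pair a A B" and S': "simple_pair b C D"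
    and ni: "\<not> pair_iso a A B b C D" "\<not> pair_iso b C D a A B"
    and uw: "sz a b u" "sz a b w"
    and cocycle: "A * u + u * C = B * B * w + B * w * D + w * D * D"
    and nc: "\<not> (\<exists>z. sz a b z \<and> u = A * z - z * C \<and> w = B * z - z * D)"
  shows "deform (a + b) (A + inj2 a b * C * proj2 a b) (B + inj2 a b * D * proj2 a b)"
proof -
  note F = fun_alg_pfun
  have szs: "sz a a A" "sz a a B" "sz b b C" "sz b b D"
    using rep_pairD[OF simple_pairD(1)[OF S]] rep_pairD[OF simple_pairD(1)[OF S']] by auto
  define At where "At t = tri a b A C (sc t u)" for t
  define Bt where "Bt t = tri a b B D (sc t w)" for t
  have szt: "sz a b (sc t u)" "sz a b (sc t w)" for t using uw by simp_all
  have rep_pair: "rep_pair (a + b) (At t) (Bt t)" for t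
    unfolding At_def Bt_def
  proof (rule tri_rp[OF simple_pairD(1)[OF S] simple_pairD(1)[OF S'] szt])
    show "A * sc t u + sc t u * C = B * B * sc t w + B * sc t w * D + sc t w * D * D"
      using arg_cong[OF cocycle, of "sc t"] by (simp add: sc_add)
  qed
  have se: "scalar_end (a + b) (At t) (Bt t)" if t: "t \<noteq> 0" for t
    unfolding At_def Bt_def
  proof (rule tri_scalar_end[OF S S' ni szt])
    show "\<not> (\<exists>z. sz a b z \<and> sc t u = A * z - z * C \<and> sc t w = B * z - z * D)"
    proof
      assume "\<exists>z. sz a b z \<and> sc t u = A * z - z * C \<and> sc t w = B * z - z * D"
      then obtain z where z: "sz a b z" "sc t u = A * z - z * C" "sc t w = B * z - z * D" by blast
      have su: "sc (1 / t) (sc t x) = x" for x using t by simp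
      have f: "sc (1 / t) (sc t u) = A * sc (1 / t) z - sc (1 / t) z * C"
        "sc (1 / t) (sc t w) = B * sc (1 / t) z - sc (1 / t) z * D"
        unfolding z(2,3) by (simp_all add: sc_diff)
      have "sz a b (sc (1 / t) z)" using z(1) by simp
      then show False using nc f[unfolded su] by metis
    qed
  qed
  obtain c where c: "c \<noteq> 0" "A * A = sc c (E a)" using simple_pairD(3)[OF S] by blast
  have sq: "At t * At t = tri a b (A * A) (C * C) (sc t (A * u + u * C))" for t
    unfolding At_def using szs szt[of t] by (simp add: tri_mult sc_add)
  have szq: "sz a a (A * A)" "sz b b (C * C)" "sz a b (A * u + u * C)" using szs uw by simp_all
  \<comment> \<open>The central element is an endomorphism of the extension at 1, which has only
    scalar endomorphisms. Comparing blocks shows that both simple representations have the same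
    central scalar and that the corner of the square vanishes, which makes the square scalar for
    every \<open>t\<close>.\<close>
  have scal: "C * C = sc c (E b) \<and> A * u + u * C = 0"
  proof -
    have "sz (a + b) (a + b) (At 1 * At 1)" using rep_pairD[OF rep_pair[of 1]] by simp
    moreover have "At 1 * At 1 * At 1 = At 1 * (At 1 * At 1)" by (rule mult.assoc)
    moreover have "At 1 * At 1 * Bt 1 = Bt 1 * (At 1 * At 1)"
      unfolding rep_pairD(3)[OF rep_pair[of 1]] by (simp only: mult.assoc)
    ultimately obtain e where e: "At 1 * At 1 = sc e (E (a + b))"
      using se[of 1] unfolding scalar_end_def by auto
    then have T: "tri a b (A * A) (C * C) (A * u + u * C) = sc e (E (a + b))" using sq[of 1] by simp
    note bl = tri_blocks[OF szq, unfolded T]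
    have "A * A = sc e (E a)" using bl(1) by simp
    then have "ent (sc e (E a)) 0 0 = ent (sc c (E a)) 0 0" using c(2) by simp
    then have "e = c" using simple_pairD(2)[OF S] by simp
    then show ?thesis using bl(2,3) by simp
  qed
  have "tri a b (E a) (E b) 0 = E (a + b)" by (rule tri_E)
  then have sq2: "At t * At t = sc c (E (a + b))" for t
    unfolding sq c(2) scal[THEN conjunct1] scal[THEN conjunct2] by (simp add: tri_def sc_add[symmetric])
  have id: "(\<lambda>t. t) \<in> pfun" using pfun_poly[of "[:0, 1:]"] by simp
  have pm: "pmat pfun At" "pmat pfun Bt"
    unfolding At_def Bt_def tri_def
    by (intro pmat_add[OF F] pmat_mult[OF F] pmat_const[OF F] pmat_sc[OF F] id)+
  have "eventually (\<lambda>t::complex. t \<noteq> 0) cofinite"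
    using pfun_nonzero_cofinite[OF id, of 1] by simp
  then have "eventually (\<lambda>t. scalar_end (a + b) (At t) (Bt t)) cofinite"
    by (rule eventually_mono) (rule se)
  then show ?thesis
    unfolding deform_def
    by (intro exI[of _ At] exI[of _ Bt] exI[of _ c] conjI allI pm rep_pair sq2 c(1))
      (simp_all add: At_def Bt_def tri_def)
qed

subsection \<open>Extensions as cocycles\<close>

definition exact_pair :: "nat \<Rightarrow> nat \<Rightarrow> nat \<Rightarrow> fmat \<Rightarrow> fmat \<Rightarrow> bool" where
  "exact_pair N l m i p \<longleftrightarrow> sz N l i \<and> sz m N p \<and> p * i = 0 \<and>
     (\<forall>x. sz l 1 x \<and> i * x = 0 \<longrightarrow> x = 0) \<and>
     (\<forall>x. sz N 1 x \<and> p * x = 0 \<longrightarrow> (\<exists>y. sz l 1 y \<and> i * y = x)) \<and>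
     (\<forall>y. sz m 1 y \<longrightarrow> (\<exists>x. sz N 1 x \<and> p * x = y))"

lemma exact_pairI:
  assumes i: "i \<in> carrier_mat N l" and p: "p \<in> carrier_mat m N"
    and inj: "inj_on (\<lambda>w. i *\<^sub>v w) (carrier_vec l)"
    and ker: "(\<lambda>w. i *\<^sub>v w) ` carrier_vec l = {x \<in> carrier_vec N. p *\<^sub>v x = 0\<^sub>v m}"
    and surj: "(\<lambda>x. p *\<^sub>v x) ` carrier_vec N = carrier_vec m"
  shows "exact_pair N l m (of_mat i) (of_mat p)"
  unfolding exact_pair_def
proof (intro conjI allI impI)
  show "rw N (of_mat i)" "cl l (of_mat i)" "rw m (of_mat p)" "cl N (of_mat p)" using i p by auto
  show "of_mat p * of_mat i = 0"
  proof (rule zero_from_columns[where d = m and q = l])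
    fix x assume x: "sz l 1 x"
    have "i *\<^sub>v to_vec l x \<in> (\<lambda>w. i *\<^sub>v w) ` carrier_vec l" by simp
    then have h: "i *\<^sub>v to_vec l x \<in> carrier_vec N" "p *\<^sub>v (i *\<^sub>v to_vec l x) = 0\<^sub>v m"
      unfolding ker by auto
    have "of_mat p * (of_mat i * x) = of_vec (p *\<^sub>v (i *\<^sub>v to_vec l x))"
      using x by (simp add: of_vec_mult[OF p h(1)] of_vec_mult[OF i to_vec_carrier])
    then show "of_mat p * of_mat i * x = 0" by (simp add: h(2) mult.assoc)
  qed (use i p in auto)
next
  fix x assume x: "sz l 1 x \<and> of_mat i * x = 0"
  have "of_vec (i *\<^sub>v to_vec l x) = of_vec (i *\<^sub>v 0\<^sub>v l)"
    using x by (simp add: of_vec_mult[OF i to_vec_carrier] of_vec_mult[OF i zero_carrier_vec])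
  then have "i *\<^sub>v to_vec l x = i *\<^sub>v 0\<^sub>v l"
    by (rule of_vec_inj[where n = N, rotated 2]) (use i in auto)
  then have "to_vec l x = 0\<^sub>v l" using inj_onD[OF inj] by simp
  then show "x = 0" using of_to_vec[of l x] x by simp
next
  fix x assume x: "sz N 1 x \<and> of_mat p * x = 0"
  have "of_vec (p *\<^sub>v to_vec N x) = of_vec (0\<^sub>v m)"
    using x by (simp add: of_vec_mult[OF p to_vec_carrier])
  then have "p *\<^sub>v to_vec N x = 0\<^sub>v m"
    by (rule of_vec_inj[where n = m, rotated 2]) (use p in auto)
  then have "to_vec N x \<in> (\<lambda>w. i *\<^sub>v w) ` carrier_vec l" unfolding ker by simp
  then obtain w where w: "w \<in> carrier_vec l" "to_vec N x = i *\<^sub>v w" by blast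
  have "of_mat i * of_vec w = x" using of_vec_mult[OF i w(1)] w(2) of_to_vec[of N x] x by simp
  then show "\<exists>y. sz l 1 y \<and> of_mat i * y = x" using sz_of_vec[OF w(1)] by blast
next
  fix y assume y: "sz m 1 y"
  have "to_vec m y \<in> (\<lambda>x. p *\<^sub>v x) ` carrier_vec N" unfolding surj by simp
  then obtain x where x: "x \<in> carrier_vec N" "to_vec m y = p *\<^sub>v x" by blast
  have "of_mat p * of_vec x = y" using of_vec_mult[OF p x(1)] x(2) of_to_vec[of m y] y by simp
  then show "\<exists>x. sz N 1 x \<and> of_mat p * x = y" using sz_of_vec[OF x(1)] by blast
qed

text \<open>
  A right inverse \<open>s\<close> of \<open>p\<close> intertwines the actions up to \<open>i * u\<close> and \<open>i * w\<close>; changing \<open>s\<close> by \<open>i * z\<close>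
  changes \<open>(u, w)\<close> by a coboundary.
\<close>

lemma exact_split:
  assumes ex: "exact_pair N l m i p" and rpN: "rep_pair N A B" and rpW: "rep_pair l AW BW" and rpV: "rep_pair m AV BV"
    and i: "i * AW = A * i" "i * BW = B * i" and p: "p * A = AV * p" "p * B = BV * p"
    and H1: "\<forall>u w. sz l m u \<and> sz l m w \<and>
      AW * u + u * AV = BW * BW * w + BW * w * BV + w * BV * BV \<longrightarrow>
      (\<exists>z. sz l m z \<and> u = AW * z - z * AV \<and> w = BW * z - z * BV)"
  shows "\<exists>r s. sz l N r \<and> sz N m s \<and> i * r + s * p = E N \<and> r * i = E l \<and> p * s = E m \<and> r * s = 0 \<and>
    r * A = AW * r \<and> r * B = BW * r \<and> s * AV = A * s \<and> s * BV = B * s"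
proof -
  have szi: "sz N l i" "sz m N p" "p * i = 0" using ex by (auto simp: exact_pair_def)
  have inj: "x = 0" if "sz l q x" "i * x = 0" for q x
    by (rule injective_columns[where M = i and m = l and r = q]) (use ex that in \<open>auto simp: exact_pair_def\<close>)
  have "\<exists>s. sz N m s \<and> p * s = E m"
    by (rule surjective_columns[where n = m and m = N and r = m]) (use ex in \<open>auto simp: exact_pair_def\<close>)
  then obtain s0 where s0: "sz N m s0" "p * s0 = E m" by blast
  have ker: "\<exists>y. sz l q y \<and> i * y = x" if x: "sz N q x" "p * x = 0" for q x
  proof -
    have "\<forall>j. \<exists>y. sz l 1 y \<and> i * y = x * El j 0"
    proof
      fix j
      have "p * (x * El j 0) = 0" using x(2) by (simp add: mult.assoc[symmetric])
      moreover have "sz N 1 (x * El j 0)" using x(1) by simp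
      ultimately show "\<exists>y. sz l 1 y \<and> i * y = x * El j 0" using ex unfolding exact_pair_def by simp
    qed
    then obtain y where y: "\<And>j. sz l 1 (y j)" "\<And>j. i * y j = x * El j 0" by metis
    have "i * (\<Sum>j<q. y j * El 0 j) = x"
    proof (rule fmat_eqI)
      fix a b
      have "i * (\<Sum>j<q. y j * El 0 j) = (\<Sum>j<q. x * El j 0 * El 0 j)"
        by (simp add: sum_distrib_left mult.assoc[symmetric] y(2))
      then have "ent (i * (\<Sum>j<q. y j * El 0 j)) a b = (\<Sum>j<q. if b = j then ent x a j else 0)"
        by (simp add: ent_times_El cong: if_cong)
      also have "\<dots> = ent x a b" using x(1) by (auto simp: cl_def not_less)
      finally show "ent (i * (\<Sum>j<q. y j * El 0 j)) a b = ent x a b" .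
    qed
    moreover have "sz l q (\<Sum>j<q. y j * El 0 j)" using y(1) by (auto intro!: rw_sum cl_sum)
    ultimately show ?thesis by blast
  qed
  note sA = rep_pairD[OF rpN] and sV = rep_pairD[OF rpV] and sW = rep_pairD[OF rpW]
  have "p * (A * s0 - s0 * AV) = 0" "p * (B * s0 - s0 * BV) = 0"
    using p s0 sV by (simp_all add: right_diff_distrib mult.assoc[symmetric]) (simp_all add: mult.assoc)
  moreover have "sz N m (A * s0 - s0 * AV)" "sz N m (B * s0 - s0 * BV)" using sA s0 sV by simp_all
  ultimately obtain u w where u: "sz l m u" "i * u = A * s0 - s0 * AV" and w: "sz l m w" "i * w = B * s0 - s0 * BV"
    using ker by meson
  have As: "A * s0 = s0 * AV + i * u" and Bs: "B * s0 = s0 * BV + i * w" using u w by simp_all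
  have AAs: "A * A * s0 = s0 * AV * AV + i * (AW * u + u * AV)"
  proof -
    have "A * A * s0 = A * (s0 * AV + i * u)" by (simp only: mult.assoc As)
    also have "\<dots> = A * s0 * AV + (A * i) * u" by (simp only: distrib_left mult.assoc)
    finally have "A * A * s0 = A * s0 * AV + (A * i) * u" .
    also have "\<dots> = s0 * AV * AV + i * (AW * u + u * AV)"
      unfolding As i(1)[symmetric] by (simp add: distrib_left distrib_right mult.assoc)
    finally show ?thesis .
  qed
  have BBs: "B * B * s0 = s0 * BV * BV + i * (BW * w + w * BV)"
  proof -
    have "B * B * s0 = B * (s0 * BV + i * w)" by (simp only: mult.assoc Bs)
    also have "\<dots> = B * s0 * BV + (B * i) * w" by (simp only: distrib_left mult.assoc)
    finally have "B * B * s0 = B * s0 * BV + (B * i) * w" .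
    also have "\<dots> = s0 * BV * BV + i * (BW * w + w * BV)"
      unfolding Bs i(2)[symmetric] by (simp add: distrib_left distrib_right mult.assoc)
    finally show ?thesis .
  qed
  have BBBs: "B * B * B * s0 = s0 * BV * BV * BV + i * (BW * BW * w + BW * w * BV + w * BV * BV)"
  proof -
    have "B * B * B * s0 = B * s0 * BV * BV + (B * i) * (BW * w + w * BV)"
      using BBs by (simp add: mult.assoc distrib_left)
    also have "\<dots> = s0 * BV * BV * BV + i * (BW * BW * w + BW * w * BV + w * BV * BV)"
      unfolding Bs i(2)[symmetric] by (simp add: distrib_left distrib_right mult.assoc add_ac)
    finally show ?thesis .
  qed
  have "i * (AW * u + u * AV) = i * (BW * BW * w + BW * w * BV + w * BV * BV)"
    using AAs BBBs sA(3) sV(3) by (simp add: mult.assoc)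
  then have "i * ((AW * u + u * AV) - (BW * BW * w + BW * w * BV + w * BV * BV)) = 0"
    by (simp add: right_diff_distrib)
  moreover have "sz l m ((AW * u + u * AV) - (BW * BW * w + BW * w * BV + w * BV * BV))"
    using u w sV sW by simp
  ultimately have "AW * u + u * AV = BW * BW * w + BW * w * BV + w * BV * BV"
    using inj by (metis eq_iff_diff_eq_0)
  then obtain z where z: "sz l m z" "u = AW * z - z * AV" "w = BW * z - z * BV"
    using H1[rule_format, OF conjI[OF u(1) conjI[OF w(1)]]] by blast
  define s where "s = s0 - i * z"
  have s: "sz N m s" using s0 z szi by (simp add: s_def)
  have sAV: "s * AV = A * s"
  proof -
    have "A * s = s0 * AV + i * u - (A * i) * z" by (simp add: s_def right_diff_distrib As mult.assoc)
    also have "\<dots> = s * AV"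
      unfolding i(1)[symmetric] z(2) by (simp add: s_def algebra_simps)
    finally show ?thesis by simp
  qed
  have sBV: "s * BV = B * s"
  proof -
    have "B * s = s0 * BV + i * w - (B * i) * z" by (simp add: s_def right_diff_distrib Bs mult.assoc)
    also have "\<dots> = s * BV"
      unfolding i(2)[symmetric] z(3) by (simp add: s_def algebra_simps)
    finally show ?thesis by simp
  qed
  have ps: "p * s = E m" using s0 szi by (simp add: s_def right_diff_distrib mult.assoc[symmetric])
  have "p * (E N - s * p) = 0" using szi ps by (simp add: right_diff_distrib mult.assoc[symmetric])
  moreover have "sz N N (E N - s * p)" using s szi by simp
  \<comment> \<open>\<open>E N - s * p\<close> has its columns in the kernel of \<open>p\<close> and
    therefore factors through \<open>i\<close>; the factor is the retraction complementary to
    \<open>s\<close>.\<close>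
  ultimately obtain r where r: "sz l N r" "i * r = E N - s * p" using ker by meson
  have eq0: "x = y" if "sz l q x" "sz l q y" "i * x = i * y" for x y q
    using inj[of "x - y" q] that by (simp add: right_diff_distrib)
  have ri: "r * i = E l"
    by (rule eq0[where q = l]) (use r szi in \<open>simp_all add: mult.assoc[symmetric] left_diff_distrib, simp add: mult.assoc\<close>)
  have rs: "r * s = 0"
    by (rule eq0[where q = m]) (use r s ps in \<open>simp_all add: mult.assoc[symmetric] left_diff_distrib, simp add: mult.assoc\<close>)
  have hom: "r * M = M' * r"
    if "sz N N M" "sz l l M'" "i * M' = M * i" "p * M = M'' * p" "s * M'' = M * s" for M M' M''
  proof (rule eq0[where q = N])
    have "i * (r * M) = M - s * (p * M)"
      using r(2) that(1) by (simp add: mult.assoc[symmetric] left_diff_distrib)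
    also have "s * (p * M) = M * s * p" unfolding that(4) by (simp add: mult.assoc[symmetric] that(5))
    also have "M - M * s * p = M * (i * r)" unfolding r(2) using that(1) by (simp add: right_diff_distrib mult.assoc)
    also have "\<dots> = i * (M' * r)" by (simp add: mult.assoc[symmetric] that(3))
    finally show "i * (r * M) = i * (M' * r)" .
  qed (use r that in simp_all)
  have "r * A = AW * r" by (rule hom[OF _ _ i(1) p(1) sAV]) (use sA sW in simp_all)
  moreover have "r * B = BW * r" by (rule hom[OF _ _ i(2) p(2) sBV]) (use sA sW in simp_all)
  moreover have "i * r + s * p = E N" using r(2) by simp
  ultimately show ?thesis using r(1) s ri ps rs sAV sBV by (intro exI[of _ r] exI[of _ s] conjI) simp_all
qed

lemma rep_homD:
  assumes V: "V \<in> rep_variety n" and W: "W \<in> rep_variety m" and P: "P \<in> rep_hom V W"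
  shows "P \<in> carrier_mat m n" "of_mat P * of_mat (fst V) = of_mat (fst W) * of_mat P"
    "of_mat P * of_mat (snd V) = of_mat (snd W) * of_mat P"
proof -
  note car = rep_variety_carrier[OF V] rep_variety_carrier[OF W]
  have P': "P \<in> carrier_mat m n" "P * fst V = fst W * P" "P * snd V = snd W * P"
    using P unfolding rep_hom_def rep_variety_dim[OF V] rep_variety_dim[OF W] by blast+
  show "P \<in> carrier_mat m n" by (rule P'(1))
  show "of_mat P * of_mat (fst V) = of_mat (fst W) * of_mat P"
    using arg_cong[OF P'(2), of of_mat] of_mat_mult[OF P'(1) car(1)] of_mat_mult[OF car(3) P'(1)] by simp
  show "of_mat P * of_mat (snd V) = of_mat (snd W) * of_mat P"
    using arg_cong[OF P'(3), of of_mat] of_mat_mult[OF P'(1) car(2)] of_mat_mult[OF car(4) P'(1)] by simp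
qed

lemma rep_homI:
  assumes V: "V \<in> rep_variety n" and W: "W \<in> rep_variety m" and P: "sz m n P"
    "P * of_mat (fst V) = of_mat (fst W) * P" "P * of_mat (snd V) = of_mat (snd W) * P"
  shows "to_mat m n P \<in> rep_hom V W"
proof -
  note car = rep_variety_carrier[OF V] rep_variety_carrier[OF W]
  have eq: "to_mat m n P * M = M' * to_mat m n P"
    if M: "M \<in> carrier_mat n n" "M' \<in> carrier_mat m m" "P * of_mat M = of_mat M' * P" for M M'
  proof (rule of_mat_inj)
    show "to_mat m n P * M \<in> carrier_mat m n" by (rule mult_carrier_mat[OF to_mat_carrier M(1)])
    show "M' * to_mat m n P \<in> carrier_mat m n" by (rule mult_carrier_mat[OF M(2) to_mat_carrier])
    show "of_mat (to_mat m n P * M) = of_mat (M' * to_mat m n P)"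
      unfolding of_mat_mult[OF to_mat_carrier M(1)] of_mat_mult[OF M(2) to_mat_carrier] of_to_mat[OF P(1)]
      by (rule M(3))
  qed
  have "to_mat m n P * fst V = fst W * to_mat m n P" "to_mat m n P * snd V = snd W * to_mat m n P"
    by (rule eq[OF car(1) car(3) P(2)], rule eq[OF car(2) car(4) P(3)])
  then show ?thesis by (simp add: rep_hom_def rep_variety_dim[OF V] rep_variety_dim[OF W])
qed

text \<open>Makes \<open>Ext1_zero\<close> the class of an actual extension. When all extensions are
  equivalent, this class is then the whole set \<open>extensions V W\<close>.\<close>

lemma split_extension_mem:
  assumes V: "V \<in> rep_variety m" and W: "W \<in> rep_variety l"
  shows "split_extension V W \<in> extensions V W"
proof -
  define Ex i p where "Ex = direct_sum_reps [W, V]" and "i = 1\<^sub>m l @\<^sub>r (0\<^sub>m m l :: complex mat)"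
    and "p = transpose_mat (0\<^sub>m l m @\<^sub>r 1\<^sub>m m :: complex mat)"
  note dims = rep_variety_dim[OF V] rep_variety_dim[OF W]
  have split: "split_extension V W = (Ex, i, p)"
    unfolding split_extension_def Let_def dims Ex_def i_def p_def by (rule refl)
  note car = rep_variety_carrier[OF V] rep_variety_carrier[OF W]
  have one: "four_block_mat X (0\<^sub>m m 0) (0\<^sub>m 0 m) (0\<^sub>m 0 0) = X" if "X \<in> carrier_mat m m" for X :: "complex mat"
    by (rule eq_matI) (use that in auto)
  have Ex: "fst Ex = four_block_mat (fst W) (0\<^sub>m l m) (0\<^sub>m m l) (fst V)"
    "snd Ex = four_block_mat (snd W) (0\<^sub>m l m) (0\<^sub>m m l) (snd V)"
    using car by (simp_all add: Ex_def direct_sum_reps_def Let_def one)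
  have Exc: "fst Ex \<in> carrier_mat (l + m) (l + m)" "snd Ex \<in> carrier_mat (l + m) (l + m)"
    using car unfolding Ex by auto
  have of_Ex: "of_mat (fst Ex) = tri l m (of_mat (fst W)) (of_mat (fst V)) 0"
    "of_mat (snd Ex) = tri l m (of_mat (snd W)) (of_mat (snd V)) 0"
    using car unfolding Ex by (simp_all add: of_mat_four_block tri_def)
  have ic: "i \<in> carrier_mat (l + m) l" and pc: "p \<in> carrier_mat m (l + m)"
    by (auto simp: i_def p_def intro: carrier_append_rows)
  have oi: "of_mat i = E l"
    by (rule sz_eqI[where n = "l + m" and m = l])
      (use ic in \<open>auto simp: of_mat_def i_def append_rows_def\<close>)
  have op: "of_mat p = proj2 l m"
    by (rule sz_eqI[where n = m and m = "l + m"])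
      (use pc in \<open>auto simp: of_mat_def p_def append_rows_def proj2_def\<close>)
  note rpW = rep_variety_rp[OF W] and rpV = rep_variety_rp[OF V]
  note s = rep_pairD[OF rpW] rep_pairD[OF rpV]
  have rpE: "rep_pair (l + m) (of_mat (fst Ex)) (of_mat (snd Ex))"
    unfolding of_Ex by (rule tri_rp[OF rpW rpV]) simp_all
  then have E_var: "Ex \<in> rep_variety (l + m)" using rep_variety_iff[OF Exc] by simp
  have dE: "rep_dim Ex = l + m" by (rule rep_variety_dim[OF E_var])
  have "to_mat (l + m) l (E l) \<in> rep_hom W Ex"
    by (rule rep_homI[OF W E_var]) (use s in \<open>simp_all add: of_Ex tri_restrict\<close>)
  then have i_hom: "i \<in> rep_hom W Ex" using to_of_mat[OF ic] oi by simp
  have "to_mat m (l + m) (proj2 l m) \<in> rep_hom Ex V"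
    by (rule rep_homI[OF E_var V]) (use s in \<open>simp_all add: of_Ex tri_restrict\<close>)
  then have p_hom: "p \<in> rep_hom Ex V" using to_of_mat[OF pc] op by simp
  have inj: "inj_on (\<lambda>w. i *\<^sub>v w) (carrier_vec l)"
  proof (rule inj_onI)
    fix v w assume h: "v \<in> carrier_vec l" "w \<in> carrier_vec l" "i *\<^sub>v v = i *\<^sub>v w"
    then have "E l * of_vec v = E l * of_vec w"
      using of_vec_mult[OF ic h(1)] of_vec_mult[OF ic h(2)] by (simp add: oi)
    then show "v = w" using h of_vec_inj[OF h(1,2)] sz_of_vec[OF h(1)] sz_of_vec[OF h(2)] by simp
  qed
  have ker: "(\<lambda>w. i *\<^sub>v w) ` carrier_vec l = {x \<in> carrier_vec (l + m). p *\<^sub>v x = 0\<^sub>v m}"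
  proof (intro equalityI subsetI)
    fix x assume "x \<in> (\<lambda>w. i *\<^sub>v w) ` carrier_vec l"
    then obtain w where w: "w \<in> carrier_vec l" "x = i *\<^sub>v w" by blast
    then have x: "x \<in> carrier_vec (l + m)" using ic by auto
    have "of_vec (p *\<^sub>v x) = proj2 l m * (E l * of_vec w)"
      using of_vec_mult[OF pc x] of_vec_mult[OF ic w(1)] w(2) by (simp add: oi op)
    also have "\<dots> = of_vec (0\<^sub>v m)" by (simp add: mult.assoc[symmetric])
    finally have "p *\<^sub>v x = 0\<^sub>v m" by (rule of_vec_inj[where n = m, rotated 2])
      (use x in \<open>auto intro: mult_mat_vec_carrier[OF pc]\<close>)
    then show "x \<in> {x \<in> carrier_vec (l + m). p *\<^sub>v x = 0\<^sub>v m}" using x by simp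
  next
    fix x assume "x \<in> {x \<in> carrier_vec (l + m). p *\<^sub>v x = 0\<^sub>v m}"
    then have x: "x \<in> carrier_vec (l + m)" "p *\<^sub>v x = 0\<^sub>v m" by auto
    note sx = sz_of_vec[OF x(1)]
    have px: "proj2 l m * of_vec x = 0" using of_vec_mult[OF pc x(1)] x(2) by (simp add: op)
    have "of_vec x = (E l + inj2 l m * proj2 l m) * of_vec x" using sx by (simp add: E_add_inj2_proj2)
    also have "\<dots> = E l * of_vec x" using px by (simp add: distrib_right mult.assoc)
    finally have xe: "of_vec x = E l * of_vec x" .
    define w where "w = to_vec l (E l * of_vec x)"
    have "of_vec w = E l * of_vec x" unfolding w_def by (rule of_to_vec) (use sx in simp)
    moreover have "of_vec (i *\<^sub>v w) = E l * of_vec w"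
      using of_vec_mult[OF ic, of w] by (simp add: oi w_def)
    moreover have "E l * (E l * of_vec x) = E l * of_vec x" by (rule E_left) simp
    ultimately have "of_vec (i *\<^sub>v w) = of_vec x" using xe by metis
    then have "i *\<^sub>v w = x" by (rule of_vec_inj[where n = "l + m", rotated 2])
      (use ic x in \<open>auto simp: w_def intro: mult_mat_vec_carrier[OF ic]\<close>)
    moreover have "w \<in> carrier_vec l" by (simp add: w_def)
    ultimately show "x \<in> (\<lambda>w. i *\<^sub>v w) ` carrier_vec l" by blast
  qed
  have surj: "(\<lambda>x. p *\<^sub>v x) ` carrier_vec (l + m) = carrier_vec m"
  proof (intro equalityI subsetI)
    fix y assume "y \<in> (\<lambda>x. p *\<^sub>v x) ` carrier_vec (l + m)"
    then show "y \<in> carrier_vec m" using pc by auto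
  next
    fix y :: "complex vec" assume y: "y \<in> carrier_vec m"
    define x where "x = to_vec (l + m) (inj2 l m * of_vec y)"
    have "of_vec (p *\<^sub>v x) = of_vec y"
      using of_vec_mult[OF pc to_vec_carrier] sz_of_vec[OF y] by (simp add: x_def op)
    then have "p *\<^sub>v x = y" by (rule of_vec_inj[where n = m, rotated 2])
      (use pc y in \<open>auto simp: x_def intro: mult_mat_vec_carrier[OF pc]\<close>)
    moreover have "x \<in> carrier_vec (l + m)" by (simp add: x_def)
    ultimately show "y \<in> (\<lambda>x. p *\<^sub>v x) ` carrier_vec (l + m)" by blast
  qed
  show ?thesis
    unfolding split extensions_def
    using E_var i_hom p_hom inj ker surj by (simp add: is_rep_def dE dims)
qed

text \<open>By contraposition: if every cocycle is a coboundary, every extension splits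
  equivariantly by \<open>exact_split\<close>. Any two extensions are then equivalent, and the only
  class is that of the split one. The kernel of an extension in \<open>extensions V W\<close> is
  \<open>W\<close>, so cocycles are matrices from \<open>V\<close> to \<open>W\<close>.\<close>

lemma Ext1_cocycle:
  assumes V: "V \<in> rep_variety m" and W: "W \<in> rep_variety l" and ne: "Ext1 V W \<noteq> {Ext1_zero V W}"
  defines "AV \<equiv> of_mat (fst V)" and "BV \<equiv> of_mat (snd V)" and "AW \<equiv> of_mat (fst W)" and "BW \<equiv> of_mat (snd W)"
  shows "\<exists>u w. sz l m u \<and> sz l m w \<and> AW * u + u * AV = BW * BW * w + BW * w * BV + w * BV * BV \<and>
    \<not> (\<exists>z. sz l m z \<and> u = AW * z - z * AV \<and> w = BW * z - z * BV)"
proof (rule ccontr)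
  assume "\<not> ?thesis"
  then have H1: "\<forall>u w. sz l m u \<and> sz l m w \<and> AW * u + u * AV = BW * BW * w + BW * w * BV + w * BV * BV \<longrightarrow>
      (\<exists>z. sz l m z \<and> u = AW * z - z * AV \<and> w = BW * z - z * BV)"
    by blast
  note dims = rep_variety_dim[OF V] rep_variety_dim[OF W]
  have data: "\<exists>N r s. Ex \<in> rep_variety N \<and> i \<in> carrier_mat N l \<and> p \<in> carrier_mat m N \<and>
      of_mat i * AW = of_mat (fst Ex) * of_mat i \<and> of_mat i * BW = of_mat (snd Ex) * of_mat i \<and>
      of_mat p * of_mat (fst Ex) = AV * of_mat p \<and> of_mat p * of_mat (snd Ex) = BV * of_mat p \<and>
      of_mat p * of_mat i = 0 \<and> sz l N r \<and> sz N m s \<and> of_mat i * r + s * of_mat p = E N \<and>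
      r * of_mat i = E l \<and> of_mat p * s = E m \<and> r * s = 0 \<and>
      r * of_mat (fst Ex) = AW * r \<and> r * of_mat (snd Ex) = BW * r \<and>
      s * AV = of_mat (fst Ex) * s \<and> s * BV = of_mat (snd Ex) * s"
    if x: "(Ex, i, p) \<in> extensions V W" for Ex i p
  proof -
    define N where "N = rep_dim Ex"
    have Ex: "Ex \<in> rep_variety N" using x by (simp add: extensions_def is_rep_def N_def)
    have hom: "i \<in> rep_hom W Ex" "p \<in> rep_hom Ex V" using x by (simp_all add: extensions_def)
    note i = rep_homD[OF W Ex hom(1)] and p = rep_homD[OF Ex V hom(2)]
    have ex: "exact_pair N l m (of_mat i) (of_mat p)"
      by (rule exact_pairI[OF i(1) p(1)]) (use x in \<open>simp_all add: extensions_def dims N_def\<close>)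
    have pi: "of_mat p * of_mat i = 0" using ex by (simp add: exact_pair_def)
    from exact_split[OF ex rep_variety_rp[OF Ex] rep_variety_rp[OF W] rep_variety_rp[OF V] i(2,3) p(2,3)
        H1[unfolded AW_def AV_def BW_def BV_def]]
    obtain r s where "sz l N r \<and> sz N m s \<and> of_mat i * r + s * of_mat p = E N \<and> r * of_mat i = E l \<and>
      of_mat p * s = E m \<and> r * s = 0 \<and> r * of_mat (fst Ex) = of_mat (fst W) * r \<and>
      r * of_mat (snd Ex) = of_mat (snd W) * r \<and> s * of_mat (fst V) = of_mat (fst Ex) * s \<and>
      s * of_mat (snd V) = of_mat (snd Ex) * s" by (elim exE)
    then show ?thesis
      unfolding AW_def AV_def BW_def BV_def
      by (intro exI[of _ N] exI[of _ r] exI[of _ s]) (use Ex i p pi in simp)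
  qed
  have equiv: "((Ex, i, p), (Ex', i', p')) \<in> extension_equiv V W"
    if x: "(Ex, i, p) \<in> extensions V W" and y: "(Ex', i', p') \<in> extensions V W" for Ex i p Ex' i' p'
  proof -
    from data[OF x] obtain N r s where X: "Ex \<in> rep_variety N" "i \<in> carrier_mat N l" "p \<in> carrier_mat m N"
      "of_mat i * AW = of_mat (fst Ex) * of_mat i" "of_mat i * BW = of_mat (snd Ex) * of_mat i"
      "of_mat p * of_mat (fst Ex) = AV * of_mat p" "of_mat p * of_mat (snd Ex) = BV * of_mat p"
      "of_mat p * of_mat i = 0" "sz l N r" "sz N m s" "of_mat i * r + s * of_mat p = E N"
      "r * of_mat i = E l" "of_mat p * s = E m" "r * s = 0"
      "r * of_mat (fst Ex) = AW * r" "r * of_mat (snd Ex) = BW * r"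
      by (elim exE conjE) (rule that; assumption?; simp)
    from data[OF y] obtain N' r' s' where Y: "Ex' \<in> rep_variety N'" "i' \<in> carrier_mat N' l" "p' \<in> carrier_mat m N'"
      "of_mat i' * AW = of_mat (fst Ex') * of_mat i'" "of_mat i' * BW = of_mat (snd Ex') * of_mat i'"
      "of_mat p' * of_mat i' = 0" "sz l N' r'" "sz N' m s'" "of_mat i' * r' + s' * of_mat p' = E N'"
      "r' * of_mat i' = E l" "of_mat p' * s' = E m" "r' * s' = 0"
      "s' * AV = of_mat (fst Ex') * s'" "s' * BV = of_mat (snd Ex') * s'"
      by (elim exE conjE) (rule that; assumption?; simp)
    have szs: "sz N l (of_mat i)" "sz m N (of_mat p)" "sz N' l (of_mat i')" "sz m N' (of_mat p')"
      using X(2,3) Y(2,3) by auto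
    \<comment> \<open>Along the splittings \<open>f\<close> carries the sub by \<open>r\<close> and
      \<open>i'\<close> and the quotient by \<open>p\<close> and \<open>s'\<close>; exchanging the
      two extensions gives the inverse \<open>g\<close>.\<close>
    define f where "f = of_mat i' * r + s' * of_mat p"
    define g where "g = of_mat i * r' + s * of_mat p'"
    have sf: "sz N' N f" and sg: "sz N N' g" using szs X(9,10) Y(7,8) by (simp_all add: f_def g_def)
    have asc: "r * (of_mat i * x) = E l * x" "r * (s * x) = 0" "of_mat p * (of_mat i * x) = 0"
      "of_mat p * (s * x) = E m * x" "r' * (of_mat i' * x) = E l * x" "r' * (s' * x) = 0"
      "of_mat p' * (of_mat i' * x) = 0" "of_mat p' * (s' * x) = E m * x" for x
      using X(8,12-14) Y(6,10-12) by (simp_all add: mult.assoc[symmetric])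
    have fg: "f * g = E N'"
      using szs X(9,10) Y(7-9) by (simp add: f_def g_def distrib_left distrib_right mult.assoc asc)
    have gf: "g * f = E N"
      using szs X(9-11) Y(7,8) by (simp add: f_def g_def distrib_left distrib_right mult.assoc asc)
    have "(of_nat N :: complex) = of_nat N'" using tr_mult_commute[of f g] fg gf by simp
    then have NN: "N' = N" by (simp only: of_nat_eq_iff)
    define F where "F = to_mat N' N f"
    have Fc: "F \<in> carrier_mat N' N" and oF: "of_mat F = f" using sf by (simp_all add: F_def)
    have fhom: "f * of_mat (fst Ex) = of_mat (fst Ex') * f" "f * of_mat (snd Ex) = of_mat (snd Ex') * f"
      using X(6,7,15,16) Y(4,5,13,14)
      by (simp_all add: f_def distrib_left distrib_right mult.assoc) (simp_all add: mult.assoc[symmetric])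
    have "F \<in> rep_hom Ex Ex'" unfolding F_def by (rule rep_homI[OF X(1) Y(1) sf fhom])
    moreover have "invertible_mat F"
      using invertible_mat_iff[of F N] Fc oF sf sg fg gf NN by (auto simp: inv_pair_def)
    moreover have "F * i = i'"
    proof (rule of_mat_inj[where n = N' and m = l])
      show "of_mat (F * i) = of_mat i'"
        using szs X(8,12) by (simp add: of_mat_mult[OF Fc X(2)] oF f_def distrib_right mult.assoc)
    qed (use Fc X(2) Y(2) in auto)
    moreover have "p' * F = p"
    proof (rule of_mat_inj[where n = m and m = N])
      show "of_mat (p' * F) = of_mat p"
        using szs by (simp add: of_mat_mult[OF Y(3) Fc] oF f_def distrib_left asc)
    qed (use Fc X(3) Y(3) in auto)
    ultimately show ?thesis using x y unfolding extension_equiv_def by auto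
  qed
  have sub: "extension_equiv V W \<subseteq> extensions V W \<times> extensions V W"
    by (auto simp: extension_equiv_def)
  have cls: "extension_equiv V W `` {x} = extensions V W" if "x \<in> extensions V W" for x
  proof
    show "extension_equiv V W `` {x} \<subseteq> extensions V W" using sub by auto
    show "extensions V W \<subseteq> extension_equiv V W `` {x}"
    proof
      fix y assume "y \<in> extensions V W"
      then show "y \<in> extension_equiv V W `` {x}" using that equiv by (cases x; cases y) auto
    qed
  qed
  note mem = split_extension_mem[OF V W]
  have "Ext1 V W = {extensions V W}" unfolding Ext1_def quotient_def using cls mem by auto
  then show False using ne cls[OF mem] by (simp add: Ext1_zero_def)
qed

text \<open>The block of \<open>W\<close> comes first because \<open>W\<close> is the
  subrepresentation in an extension of \<open>V\<close> by \<open>W\<close>.\<close>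

lemma Ext1_deform:
  assumes V: "simple_rep V" and W: "simple_rep W" and ni: "\<not> rep_iso V W" "\<not> rep_iso W V"
    and ne: "Ext1 V W \<noteq> {Ext1_zero V W}"
  shows "deform (rep_dim W + rep_dim V)
    (of_mat (fst W) + inj2 (rep_dim W) (rep_dim V) * of_mat (fst V) * proj2 (rep_dim W) (rep_dim V))
    (of_mat (snd W) + inj2 (rep_dim W) (rep_dim V) * of_mat (snd V) * proj2 (rep_dim W) (rep_dim V))"
proof -
  note Vv = simple_rep_in_variety[OF V] and Wv = simple_rep_in_variety[OF W]
  obtain u w where uw: "sz (rep_dim W) (rep_dim V) u" "sz (rep_dim W) (rep_dim V) w"
    "of_mat (fst W) * u + u * of_mat (fst V) = of_mat (snd W) * of_mat (snd W) * w + of_mat (snd W) * w * of_mat (snd V)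
      + w * of_mat (snd V) * of_mat (snd V)"
    "\<not> (\<exists>z. sz (rep_dim W) (rep_dim V) z \<and> u = of_mat (fst W) * z - z * of_mat (fst V) \<and>
       w = of_mat (snd W) * z - z * of_mat (snd V))"
    using Ext1_cocycle[OF Vv Wv ne] by (elim exE conjE) (rule that; simp)
  show ?thesis
    by (rule nonsplit_deform[OF simple_rep_simple_pair[OF W] simple_rep_simple_pair[OF V] _ _ uw])
      (use rep_iso_pair_iso[OF Vv Wv] rep_iso_pair_iso[OF Wv Vv] ni in blast)+
qed

section \<open>Deformations of the double of a simple representation\<close>

lemma complex_root_exists: "n > 0 \<Longrightarrow> \<exists>z::complex. z ^ n = w"
proof -
  assume n: "n > 0"
  have "degree (monom (1::complex) n + [:- w:]) = n"
    using n by (subst degree_add_eq_left) (simp_all add: degree_monom_eq)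
  then have "\<not> constant (poly (monom 1 n + [:- w:]))" using n by (simp add: constant_degree)
  then obtain z where "poly (monom 1 n + [:- w:]) z = 0" using fundamental_theorem_of_algebra by blast
  then show ?thesis by (auto simp: poly_monom)
qed

lemma primitive_cube_root: "\<exists>\<omega>::complex. 1 + \<omega> + \<omega>\<^sup>2 = 0"
proof -
  have "\<not> constant (poly [:1, 1, 1 :: complex:])" by (simp add: constant_degree)
  then obtain z :: complex where "poly [:1, 1, 1:] z = 0" using fundamental_theorem_of_algebra by blast
  then show ?thesis by (intro exI[of _ z]) (simp add: power2_eq_square algebra_simps)
qed

section \<open>Dimension bounds for simple representations\<close>

lemma simple_stable_columns:
  assumes S: "simple_pair d A B" and M: "sz d q M" "A * M = M * A'" "B * M = M * B'" "M \<noteq> 0"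
  shows "d \<le> q"
proof -
  have "\<exists>x. sz q 1 x \<and> M * x = y" if "sz d 1 y" for y
    by (rule simple_pairD(4)[OF S M that])
  then have "\<exists>N. sz q d N \<and> M * N = E d"
    by (rule surjective_columns[where n = d and m = q and r = d]) simp_all
  then obtain N where "sz q d N" "M * N = E d" by blast
  then show ?thesis by (rule size_le)
qed

lemma common_eigenvector_dim:
  assumes S: "simple_pair d A B" and v: "sz d 1 v" "v \<noteq> 0" "A * v = sc x v" "B * v = sc y v"
  shows "d \<le> 1"
  by (rule simple_stable_columns[OF S v(1) _ _ v(2), of "sc x (E 1)" "sc y (E 1)"])
    (use v in simp_all)

text \<open>
  If both generators satisfy quadratic equations, completing the square gives \<open>T\<close> with \<open>T\<^sup>2\<close> scalar
  such that \<open>A T + T A\<close> is central, so that an eigenvector \<open>v\<close> of \<open>A\<close> spans a stable plane with \<open>T v\<close>.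
\<close>

lemma quadratic_dim:
  assumes S: "simple_pair d A B" and q: "B * B = sc s B + sc r (E d)"
  shows "d \<le> 2"
proof -
  have sA: "sz d d A" and sB: "sz d d B" using rep_pairD[OF simple_pairD(1)[OF S]] by auto
  obtain c where c: "A * A = sc c (E d)" using simple_pairD(3)[OF S] by blast
  define T where "T = B - sc (s / 2) (E d)"
  have sT: "sz d d T" using sB by (simp add: T_def)
  have BT: "B = T + sc (s / 2) (E d)" by (simp add: T_def)
  define \<kappa> where "\<kappa> = r + s\<^sup>2 / 4"
  have "T * T = B * B - sc s B + sc (s\<^sup>2 / 4) (E d)"
  proof (rule fmat_eqI)
    fix i j
    show "ent (T * T) i j = ent (B * B - sc s B + sc (s\<^sup>2 / 4) (E d)) i j"
      using sB by (simp add: T_def right_diff_distrib left_diff_distrib power2_eq_square)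
  qed
  then have TT: "T * T = sc \<kappa> (E d)" by (simp add: q \<kappa>_def sc_add_left)
  define Z where "Z = A * T + T * A"
  have sZ: "sz d d Z" using sA sT by (simp add: Z_def)
  have "A * A * T = T * (A * A)" "T * T * A = A * (T * T)" using c TT sA sT by simp_all
  then have ZA: "Z * A = A * Z" and ZT: "Z * T = T * Z"
    by (simp_all add: Z_def distrib_left distrib_right mult.assoc add.commute)
  have "Z * B = B * Z" unfolding BT using ZT sZ by (simp add: distrib_left distrib_right)
  then obtain \<zeta> where \<zeta>: "A * T + T * A = sc \<zeta> (E d)" using schur[OF S sZ ZA] by (auto simp: Z_def)
  obtain \<mu> v where v: "sz d 1 v" "v \<noteq> 0" "A * v = sc \<mu> v"
    using eigenvector_exists[OF sA simple_pairD(2)[OF S]] by blast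
  have ATv: "A * (T * v) = sc \<zeta> v - sc \<mu> (T * v)"
  proof -
    have "A * (T * v) + T * (A * v) = sc \<zeta> v"
      using arg_cong[OF \<zeta>, of "\<lambda>x. x * v"] v(1) by (simp add: distrib_right mult.assoc)
    then show ?thesis using v(3) by (simp add: algebra_simps)
  qed
  have TTv: "T * (T * v) = sc \<kappa> v"
    using arg_cong[OF TT, of "\<lambda>x. x * v"] v(1) by (simp add: mult.assoc)
  \<comment> \<open>The columns are \<open>v\<close> and \<open>T * v\<close>. They may be
    dependent: only the number of columns and \<open>M \<noteq> 0\<close> enter the bound.\<close>
  define M where "M = v * El 0 0 + T * v * El 0 1"
  have sM: "sz d 2 M" using v sT by (simp add: M_def)
  have El_mult: "El i j * El k l = (if j = k then El i l else 0)" for i j k l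
    by (rule fmat_eqI) (auto simp: ent_times_El)
  have vE: "v * (E 1 * x) = v * x" for x using v(1) by simp
  have "A * M = M * (sc \<mu> (El 0 0) + sc \<zeta> (El 0 1) - sc \<mu> (El 1 1))"
    by (simp add: M_def distrib_left distrib_right right_diff_distrib mult.assoc El_mult)
      (simp add: mult.assoc[symmetric] v(3) ATv[unfolded mult.assoc[symmetric]] left_diff_distrib)
  moreover have TM: "T * M = M * (El 1 0 + sc \<kappa> (El 0 1))"
    by (simp add: M_def distrib_left distrib_right mult.assoc El_mult)
      (simp add: mult.assoc[symmetric] TTv[unfolded mult.assoc[symmetric]])
  moreover have "B * M = M * (El 1 0 + sc \<kappa> (El 0 1) + sc (s / 2) (E 2))"
    unfolding BT distrib_right TM using sM by (simp add: distrib_left)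
  moreover have "M \<noteq> 0"
  proof
    assume "M = 0"
    have "M * El 0 0 = v * El 0 0"
      by (simp add: M_def distrib_right mult.assoc El_mult)
    then have "ent (v * El 0 0) i 0 = 0" for i using \<open>M = 0\<close> by (metis ent_0 mult_zero_left)
    then have "ent v i 0 = 0" for i by (simp add: ent_times_El)
    then have "v = 0" using v(1) by (intro sz_eqI[where n = d and m = 1]) auto
    then show False using v(2) by simp
  qed
  ultimately show ?thesis using simple_stable_columns[OF S sM] by blast
qed

text \<open>If the dimensions of an eigenspace of \<open>A\<close> and one of \<open>B\<close> add
  up to more than \<open>d\<close>, the eigenspaces share a nonzero vector, whose span is stable.
  This is impossible for a simple representation of dimension at least 2. The map \<open>L\<close>
  subtracts a vector of the second eigenspace from one of the first.\<close>

lemma eigenspaces_dim: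
  assumes S: "simple_pair d A B" and d: "d \<ge> 2"
    and e: "sz d a i" "sz a d p" "p * i = E a" "A * i = sc x i"
    and f: "sz d b j" "sz b d q" "q * j = E b" "B * j = sc y j"
  shows "a + b \<le> d"
proof (rule ccontr)
  assume "\<not> a + b \<le> d"
  define L where "L X = i * (E a * X) - j * (proj2 a b * X)" for X
  have len: "length (map (\<lambda>k X. ent (L X) k 0) [0..<d]) < (a + b) * 1" using \<open>\<not> a + b \<le> d\<close> by simp
  have lin: "linf f" if "f \<in> set (map (\<lambda>k X. ent (L X) k 0) [0..<d])" for f
    using that by (auto simp: linf_def L_def distrib_left algebra_simps)
  obtain X where X: "sz (a + b) 1 X" "X \<noteq> 0" "\<forall>k<d. ent (L X) k 0 = 0"
    using underdetermined[OF lin len] by auto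
  have "L X = 0"
    by (rule sz_eqI[where n = d and m = 1]) (use X e f in \<open>auto simp: L_def\<close>)
  then have v: "i * (E a * X) = j * (proj2 a b * X)" by (simp add: L_def)
  define v where "v = i * (E a * X)"
  have v2: "v = j * (proj2 a b * X)" unfolding v_def by (rule v)
  have sv: "sz d 1 v" using e X by (simp add: v_def)
  have "v \<noteq> 0"
  proof
    assume v0: "v = 0"
    have "E a * X = p * v" using e by (simp add: v_def mult.assoc[symmetric])
    moreover have "proj2 a b * X = q * v" using f by (simp add: v2 mult.assoc[symmetric])
    ultimately have "(E a + inj2 a b * proj2 a b) * X = 0" using v0 by (simp add: distrib_right mult.assoc)
    then show False using X by (simp add: E_add_inj2_proj2)
  qed
  moreover have "A * v = sc x v" using e(4) by (simp add: v_def mult.assoc[symmetric])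
  moreover have "B * v = sc y v" using f(4) by (simp add: v2 mult.assoc[symmetric])
  ultimately have "d \<le> 1" using common_eigenvector_dim[OF S sv] by blast
  then show False using d by simp
qed

text \<open>Let m be the smaller of \<open>a1\<close> and \<open>a2\<close>. The hypotheses say that
  each b is at most m, so the squares of the b sum to at most m d, while d^2 - a1^2 - a2^2 = 2 a1 a2
  is at least m d. Equality in both would force every b to be m and \<open>a1 = a2\<close>, hence 3
  m = d = 2 m, against m > 0.\<close>

lemma multiplicity_bound:
  fixes a1 a2 b0 b1 b2 d :: nat
  assumes "a1 + a2 = d" "b0 + b1 + b2 = d" "b0 > 0" "b1 > 0" "b2 > 0"
    and "a1 + b0 \<le> d" "a1 + b1 \<le> d" "a1 + b2 \<le> d" "a2 + b0 \<le> d" "a2 + b1 \<le> d" "a2 + b2 \<le> d"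
  shows "a1 * a1 + a2 * a2 + b0 * b0 + b1 * b1 + b2 * b2 < d * d"
proof -
  have main: "M * M + m * m + b0 * b0 + b1 * b1 + b2 * b2 < d * d"
    if h: "M + m = d" "m \<le> M" "b0 \<le> m" "b1 \<le> m" "b2 \<le> m" for M m :: nat
  proof -
    obtain k where k: "M = m + k" using h(2) le_Suc_ex by blast
    obtain c0 c1 c2 where c: "m = b0 + c0" "m = b1 + c1" "m = b2 + c2"
      using h(3-5) le_Suc_ex by metis
    have d: "d = 2 * m + k" using h(1) k by simp
    have "b0 * b0 + b0 * c0 = b0 * m" "b1 * b1 + b1 * c1 = b1 * m" "b2 * b2 + b2 * c2 = b2 * m"
      using c by (metis distrib_left)+
    moreover have "b0 * m + b1 * m + b2 * m = (2 * m + k) * m"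
      using assms(2) d by (metis distrib_right)
    moreover have "b0 * c0 + b1 * c1 + b2 * c2 + m * k > 0"
    proof (rule ccontr)
      assume "\<not> ?thesis"
      then have z: "b0 * c0 = 0" "b1 * c1 = 0" "b2 * c2 = 0" "m * k = 0" by auto
      then have "c0 = 0" "c1 = 0" "c2 = 0" "k = 0" using assms(3-5) c by auto
      then have "3 * m = 2 * m" using c d assms(2) by simp
      then show False using c assms(3) by simp
    qed
    ultimately have "b0 * b0 + b1 * b1 + b2 * b2 < (2 * m + k) * m + m * k"
      by linarith
    moreover have "M * M + m * m + ((2 * m + k) * m + m * k) = d * d"
      unfolding d k by (simp add: algebra_simps)
    ultimately show ?thesis by linarith
  qed
  show ?thesis
  proof (cases "a2 \<le> a1")
    case True
    then show ?thesis using main[of a1 a2] assms by simp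
  next
    case False
    then show ?thesis using main[of a2 a1] assms by (simp add: add.commute)
  qed
qed

text \<open>In the application \<open>i * p\<close> is a spectral projection and
  \<open>p * Y * i\<close> the diagonal block of \<open>Y\<close> on its image. The list
  \<open>gs\<close> leaves out the corner entry of the block, which the trace recovers from the
  others; this saves one condition in the dimension count.\<close>

lemma block_functionals:
  assumes "sz d a i" "sz a d p"
  defines "fs \<equiv> concat (map (\<lambda>k. map (\<lambda>l Y. ent (p * Y * i) k l) [0..<a]) [0..<a])"
  shows "length fs = a * a" "\<And>f. f \<in> set fs \<Longrightarrow> linf f"
    "\<And>Y. (\<forall>f\<in>set fs. f Y = 0) \<Longrightarrow> p * Y * i = 0"
    "a > 0 \<Longrightarrow> \<exists>gs. length gs = a * a - 1 \<and> set gs \<subseteq> set fs \<and>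
       (\<forall>Y. (\<forall>g\<in>set gs. g Y = 0) \<and> tr (p * Y * i) = 0 \<longrightarrow> p * Y * i = 0)"
proof -
  show "length fs = a * a" by (simp add: fs_def length_concat comp_def sum_list_triv)
  show "linf f" if "f \<in> set fs" for f using that by (auto simp: fs_def linf_def algebra_simps)
  have all: "p * Y * i = 0" if "\<And>k l. k < a \<Longrightarrow> l < a \<Longrightarrow> ent (p * Y * i) k l = 0" for Y
    by (rule sz_eqI[where n = a and m = a]) (use assms that in simp_all)
  then show "p * Y * i = 0" if "\<forall>f\<in>set fs. f Y = 0" for Y using that by (auto simp: fs_def)
  assume a: "a > 0"
  define rest where "rest = map (\<lambda>l Y. ent (p * Y * i) 0 l) [1..<a]"
  define row where "row k = map (\<lambda>l Y. ent (p * Y * i) k l) [0..<a]" for k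
  define gs where "gs = rest @ concat (map row [1..<a])"
  have "length gs = (a - 1) + (a - 1) * a"
    by (simp add: gs_def rest_def row_def length_concat comp_def sum_list_triv)
  also have "\<dots> = a * a - 1" using a by (cases a) (simp_all add: algebra_simps)
  finally have "length gs = a * a - 1" .
  moreover have "set gs \<subseteq> set fs" using a by (force simp: gs_def rest_def row_def fs_def)
  moreover have "p * Y * i = 0" if z: "\<forall>g\<in>set gs. g Y = 0" "tr (p * Y * i) = 0" for Y
  proof -
    have nz: "ent (p * Y * i) k l = 0" if "k < a" "l < a" "k \<noteq> 0 \<or> l \<noteq> 0" for k l
    proof -
      have "(\<lambda>Y. ent (p * Y * i) k l) \<in> set gs"
      proof (cases "k = 0")
        case True
        then have "(\<lambda>Y. ent (p * Y * i) k l) \<in> set rest"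
          unfolding rest_def set_map using that by (intro image_eqI[of _ _ l]) auto
        then show ?thesis by (simp add: gs_def)
      next
        case False
        have "(\<lambda>Y. ent (p * Y * i) k l) \<in> set (row k)"
          unfolding row_def set_map using that by (intro image_eqI[of _ _ l]) auto
        moreover have "k \<in> set [1..<a]" using that False by simp
        ultimately have "(\<lambda>Y. ent (p * Y * i) k l) \<in> (\<Union>k\<in>set [1..<a]. set (row k))" by (intro UN_I)
        then show ?thesis by (simp add: gs_def)
      qed
      then show ?thesis using z(1) by (rule bspec[rotated])
    qed
    have "tr (p * Y * i) = (\<Sum>k<a. ent (p * Y * i) k k)"
      by (rule tr_eq[where n = a and m = a]) (use assms in simp)
    also have "\<dots> = (\<Sum>k<a. if k = 0 then ent (p * Y * i) 0 0 else 0)"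
      by (rule sum.cong) (use nz in auto)
    also have "\<dots> = ent (p * Y * i) 0 0" using a by simp
    finally have "ent (p * Y * i) 0 0 = 0" using z(2) by simp
    then show ?thesis using all nz by metis
  qed
  ultimately show "\<exists>gs. length gs = a * a - 1 \<and> set gs \<subseteq> set fs \<and>
       (\<forall>Y. (\<forall>g\<in>set gs. g Y = 0) \<and> tr (p * Y * i) = 0 \<longrightarrow> p * Y * i = 0)"
    by (intro exI[of _ gs] conjI allI impI) simp_all
qed

text \<open>For \<open>T\<close> of order three and a cube root of unity \<open>z\<close> this is
  the spectral projection of \<open>T\<close> for the eigenvalue z^2 = 1/z, not for z.\<close>

definition spec3 :: "nat \<Rightarrow> fmat \<Rightarrow> complex \<Rightarrow> fmat" where
  "spec3 d T z = sc (1/3) (E d + sc z T + sc (z\<^sup>2) (T * T))"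

text \<open>The last claim covers a missing eigenvalue: if the projection vanishes, \<open>T\<close>
  satisfies a quadratic equation, and \<open>quadratic_dim\<close> bounds the dimension by
  2.\<close>

lemma spec3_props:
  assumes T: "sz d d T" "T * T * T = E d" and z: "z ^ 3 = 1"
  shows "spec3 d T z * spec3 d T z = spec3 d T z" "T * spec3 d T z = sc (z\<^sup>2) (spec3 d T z)"
    "spec3 d T z = 0 \<Longrightarrow> T * T = sc (- z) (E d) + sc (- z\<^sup>2) T"
proof -
  define u where "u = E d + sc z T + sc (z\<^sup>2) (T * T)"
  have su: "sz d d u" using T by (simp add: u_def)
  have z3: "z * (z * z) = 1" using z by (simp add: power3_eq_cube mult.assoc)
  have "z ^ 4 = z * (z * (z * z))" "z ^ 6 = z * (z * z) * (z * (z * z))"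
    by (simp_all add: eval_nat_numeral)
  then have z46: "z ^ 4 = z" "z ^ 6 = 1" by (simp_all add: z3)
  have z4: "z\<^sup>2 * z\<^sup>2 = z" "z * z\<^sup>2 = 1" "z\<^sup>2 * z = 1" "z * z = z\<^sup>2"
    using z3 z46 by (simp_all add: power2_eq_square mult.assoc)
  have Tu: "T * u = sc (z\<^sup>2) u"
    using T by (simp add: u_def distrib_left sc_add z4 z46 mult.assoc add_ac)
  have "u * u = u + sc z (T * u) + sc (z\<^sup>2) (T * (T * u))"
    using su by (simp add: u_def distrib_right mult.assoc)
  also have "\<dots> = u + u + u" by (simp add: Tu z4 z46)
  also have "\<dots> = sc 3 u" by (rule fmat_eqI) simp
  finally have uu: "u * u = sc 3 u" .
  have su3: "spec3 d T z = sc (1/3) u" by (simp add: spec3_def u_def)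
  show "spec3 d T z * spec3 d T z = spec3 d T z" unfolding su3 by (simp add: uu)
  show "T * spec3 d T z = sc (z\<^sup>2) (spec3 d T z)" unfolding su3 by (simp add: Tu mult.commute)
  assume "spec3 d T z = 0"
  then have "u = 0" by (simp add: su3)
  then have "sc z u = 0" by simp
  then have "sc z (E d) + sc (z\<^sup>2) T + T * T = 0" by (simp add: u_def sc_add z4)
  then have "T * T + (sc z (E d) + sc (z\<^sup>2) T) = 0" by (simp add: add_ac)
  then have "T * T = - (sc z (E d) + sc (z\<^sup>2) T)" by (rule eq_neg_iff_add_eq_0[THEN iffD2])
  then show "T * T = sc (- z) (E d) + sc (- z\<^sup>2) T" by (simp add: sc_uminus_left)
qed

lemma spec3_sandwich:
  "sz d d T \<Longrightarrow> sz d d Y \<Longrightarrow> spec3 d T z * Y * spec3 d T z =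
    sc (1/9) (Y + sc z (T * Y + Y * T) + sc (z^2) (T * T * Y + T * Y * T + Y * T * T)
      + sc (z^3) (T * T * Y * T + T * Y * T * T) + sc (z^4) (T * T * Y * T * T))"
proof -
  assume sz: "sz d d T" "sz d d Y"
  have "spec3 d T z * Y * spec3 d T z = sc (1/9)
    ((E d + sc z T + sc (z\<^sup>2) (T * T)) * (Y * (E d + sc z T + sc (z\<^sup>2) (T * T))))"
    by (simp add: spec3_def mult.assoc)
  also have "\<dots> = sc (1/9) (Y + sc z (T * Y + Y * T) + sc (z^2) (T * T * Y + T * Y * T + Y * T * T)
      + sc (z^3) (T * T * Y * T + T * Y * T * T) + sc (z^4) (T * T * Y * T * T))"
  proof (rule arg_cong[of _ _ "sc (1/9)"], rule fmat_eqI)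
    fix i j
    show "ent ((E d + sc z T + sc (z\<^sup>2) (T * T)) * (Y * (E d + sc z T + sc (z\<^sup>2) (T * T)))) i j =
      ent (Y + sc z (T * Y + Y * T) + sc (z^2) (T * T * Y + T * Y * T + Y * T * T)
      + sc (z^3) (T * T * Y * T + T * Y * T * T) + sc (z^4) (T * T * Y * T * T)) i j"
      using sz by (simp add: distrib_left distrib_right mult.assoc)
        (simp add: algebra_simps power2_eq_square power3_eq_cube power4_eq_xxxx)
  qed
  finally show ?thesis .
qed

text \<open>The sums of \<open>z * z ^ k\<close> over the three cube roots of unity
  \<open>z\<close>: they are 3 for k = 2 and 0 for k = 1, 3, 4. The last identity is the sum of the
  squares.\<close>

lemma cube_root_identities:
  fixes \<omega> :: complex
  assumes w: "1 + \<omega> + \<omega>\<^sup>2 = 0"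
  shows "\<omega> ^ 3 = 1" "(\<omega>\<^sup>2) ^ 3 = 1" "1 + \<omega> * \<omega> + \<omega>\<^sup>2 * \<omega>\<^sup>2 = 0" "1 + \<omega> * \<omega>\<^sup>2 + \<omega>\<^sup>2 * (\<omega>\<^sup>2)\<^sup>2 = 3"
    "1 + \<omega> * \<omega> ^ 3 + \<omega>\<^sup>2 * (\<omega>\<^sup>2) ^ 3 = 0" "1 + \<omega> * \<omega> ^ 4 + \<omega>\<^sup>2 * (\<omega>\<^sup>2) ^ 4 = 0"
    "1 + \<omega>\<^sup>2 + (\<omega>\<^sup>2)\<^sup>2 = 0"
proof -
  have w0: "1 + \<omega> + \<omega> * \<omega> = 0" using w by (simp add: power2_eq_square)
  have "\<omega> * \<omega> = (1 + \<omega> + \<omega> * \<omega>) - 1 - \<omega>" by simp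
  then have w2: "\<omega> * \<omega> = - 1 - \<omega>" unfolding w0 by simp
  have "\<omega> * \<omega> * \<omega> = - \<omega> - \<omega> * \<omega>" unfolding w2 by (simp add: left_diff_distrib w2)
  then have w3: "\<omega> * \<omega> * \<omega> = 1" by (simp add: w2)
  show p3: "\<omega> ^ 3 = 1" using w3 by (simp add: power3_eq_cube)
  have p: "\<omega> ^ (3 * m + k) = \<omega> ^ k" for m k by (simp add: power_add power_mult p3)
  have p4: "\<omega> ^ 4 = \<omega>" "\<omega> ^ 5 = \<omega>\<^sup>2" "\<omega> ^ 6 = 1" "\<omega> ^ 8 = \<omega>\<^sup>2" "\<omega> ^ 10 = \<omega>"
    using p[of 1 1] p[of 1 2] p[of 2 0] p[of 2 2] p[of 3 1] by simp_all
  have w22: "\<omega>\<^sup>2 * \<omega>\<^sup>2 = \<omega>" "\<omega> * \<omega>\<^sup>2 = 1" "\<omega>\<^sup>2 * \<omega> = 1" "\<omega> * \<omega> = \<omega>\<^sup>2"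
    using w3 p4(1) by (simp_all add: power2_eq_square mult.assoc)
  have w': "1 + \<omega>\<^sup>2 + \<omega> = 0" using w by (simp add: add_ac)
  show "(\<omega>\<^sup>2) ^ 3 = 1" using p4 by simp
  show "1 + \<omega> * \<omega> + \<omega>\<^sup>2 * \<omega>\<^sup>2 = 0" unfolding w22 by (rule w')
  have q: "(\<omega>\<^sup>2)\<^sup>2 = \<omega>" "(\<omega>\<^sup>2) ^ 3 = 1" "(\<omega>\<^sup>2) ^ 4 = \<omega>\<^sup>2" using p4 by simp_all
  show "1 + \<omega> * \<omega>\<^sup>2 + \<omega>\<^sup>2 * (\<omega>\<^sup>2)\<^sup>2 = 3" unfolding q w22 by simp
  show "1 + \<omega> * \<omega> ^ 3 + \<omega>\<^sup>2 * (\<omega>\<^sup>2) ^ 3 = 0" unfolding q p3 using w by simp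
  show "1 + \<omega> * \<omega> ^ 4 + \<omega>\<^sup>2 * (\<omega>\<^sup>2) ^ 4 = 0" unfolding q p4 w22 by (rule w')
  show "1 + \<omega>\<^sup>2 + (\<omega>\<^sup>2)\<^sup>2 = 0" unfolding q by (rule w')
qed

text \<open>In the expansion of a sandwich the coefficient of total degree k in \<open>T\<close> is
  \<open>z ^ k\<close>. Weighting by \<open>z\<close> and summing over the cube roots keeps degree
  two only, the expression that appears in the differential of the cube. So it vanishes once all
  diagonal blocks of \<open>Y\<close> do.\<close>

lemma spec3_sum:
  assumes w: "1 + \<omega> + \<omega>\<^sup>2 = 0" and T: "sz d d T"
  shows "spec3 d T 1 + spec3 d T \<omega> + spec3 d T (\<omega>\<^sup>2) = E d"
    "sz d d Y \<Longrightarrow> spec3 d T 1 * Y * spec3 d T 1 + sc \<omega> (spec3 d T \<omega> * Y * spec3 d T \<omega>)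
      + sc (\<omega>\<^sup>2) (spec3 d T (\<omega>\<^sup>2) * Y * spec3 d T (\<omega>\<^sup>2)) = sc (1/3) (T * T * Y + T * Y * T + Y * T * T)"
proof -
  note coefs = cube_root_identities(3-7)[OF w]
  show "spec3 d T 1 + spec3 d T \<omega> + spec3 d T (\<omega>\<^sup>2) = E d"
  proof (rule fmat_eqI)
    fix i j
    define e t s where "e = ent (E d) i j" and "t = ent T i j" and "s = ent (T * T) i j"
    have "(e + t + s) + (e + \<omega> * t + \<omega>\<^sup>2 * s) + (e + \<omega>\<^sup>2 * t + (\<omega>\<^sup>2)\<^sup>2 * s) = 3 * e"
    proof -
      have "(e + t + s) + (e + \<omega> * t + \<omega>\<^sup>2 * s) + (e + \<omega>\<^sup>2 * t + (\<omega>\<^sup>2)\<^sup>2 * s)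
        = 3 * e + (1 + \<omega> + \<omega>\<^sup>2) * t + (1 + \<omega>\<^sup>2 + (\<omega>\<^sup>2)\<^sup>2) * s"
        by (simp add: algebra_simps)
      then show ?thesis unfolding w coefs by simp
    qed
    then have "(1/3) * (e + t + s) + (1/3) * (e + \<omega> * t + \<omega>\<^sup>2 * s) + (1/3) * (e + \<omega>\<^sup>2 * t + (\<omega>\<^sup>2)\<^sup>2 * s) = e"
      unfolding distrib_left[of "1/3", symmetric] by simp
    then show "ent (spec3 d T 1 + spec3 d T \<omega> + spec3 d T (\<omega>\<^sup>2)) i j = ent (E d) i j"
      unfolding spec3_def ent_add ent_sc e_def t_def s_def by simp
  qed
  assume Y: "sz d d Y"
  define P1 P2 P3 P4 where "P1 = T * Y + Y * T" and "P2 = T * T * Y + T * Y * T + Y * T * T"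
    and "P3 = T * T * Y * T + T * Y * T * T" and "P4 = T * T * Y * T * T"
  have sw: "spec3 d T z * Y * spec3 d T z = sc (1/9) (Y + sc z P1 + sc (z^2) P2 + sc (z^3) P3 + sc (z^4) P4)" for z
    unfolding P1_def P2_def P3_def P4_def by (rule spec3_sandwich[OF T Y])
  show "spec3 d T 1 * Y * spec3 d T 1 + sc \<omega> (spec3 d T \<omega> * Y * spec3 d T \<omega>)
      + sc (\<omega>\<^sup>2) (spec3 d T (\<omega>\<^sup>2) * Y * spec3 d T (\<omega>\<^sup>2)) = sc (1/3) P2"
  proof (rule fmat_eqI)
    fix i j
    define y a b c e where "y = ent Y i j" and "a = ent P1 i j" and "b = ent P2 i j" and "c = ent P3 i j"
      and "e = ent P4 i j"
    have "(y + a + b + c + e) + \<omega> * (y + \<omega> * a + \<omega>^2 * b + \<omega>^3 * c + \<omega>^4 * e)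
      + \<omega>^2 * (y + \<omega>^2 * a + (\<omega>^2)^2 * b + (\<omega>^2)^3 * c + (\<omega>^2)^4 * e) = 3 * b"
    proof -
      have "(y + a + b + c + e) + \<omega> * (y + \<omega> * a + \<omega>^2 * b + \<omega>^3 * c + \<omega>^4 * e)
          + \<omega>^2 * (y + \<omega>^2 * a + (\<omega>^2)^2 * b + (\<omega>^2)^3 * c + (\<omega>^2)^4 * e)
        = (1 + \<omega> + \<omega>\<^sup>2) * y + (1 + \<omega> * \<omega> + \<omega>\<^sup>2 * \<omega>\<^sup>2) * a + (1 + \<omega> * \<omega>\<^sup>2 + \<omega>\<^sup>2 * (\<omega>\<^sup>2)\<^sup>2) * b
          + (1 + \<omega> * \<omega> ^ 3 + \<omega>\<^sup>2 * (\<omega>\<^sup>2) ^ 3) * c + (1 + \<omega> * \<omega> ^ 4 + \<omega>\<^sup>2 * (\<omega>\<^sup>2) ^ 4) * e"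
        by (simp add: algebra_simps)
      then show ?thesis unfolding w coefs by simp
    qed
    moreover have "(1/9) * P + u * ((1/9) * Q) + v * ((1/9) * R) = (1/9) * (P + u * Q + v * R)"
      for P Q R u v :: complex by (simp add: field_simps)
    ultimately have "(1/9) * (y + a + b + c + e) + \<omega> * ((1/9) * (y + \<omega> * a + \<omega>^2 * b + \<omega>^3 * c + \<omega>^4 * e))
      + \<omega>^2 * ((1/9) * (y + \<omega>^2 * a + (\<omega>^2)^2 * b + (\<omega>^2)^3 * c + (\<omega>^2)^4 * e)) = (1/3) * b"
      by (simp only:) simp
    then show "ent (spec3 d T 1 * Y * spec3 d T 1 + sc \<omega> (spec3 d T \<omega> * Y * spec3 d T \<omega>)
      + sc (\<omega>\<^sup>2) (spec3 d T (\<omega>\<^sup>2) * Y * spec3 d T (\<omega>\<^sup>2))) i j = ent (sc (1/3) P2) i j"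
      unfolding sw ent_add ent_sc y_def a_def b_def c_def e_def by simp
  qed
qed

lemma factor_eigen: "e = i * p \<Longrightarrow> p * i = E a \<Longrightarrow> cl a i \<Longrightarrow> A * e = sc x e \<Longrightarrow> A * i = sc x i"
proof -
  assume h: "e = i * p" "p * i = E a" "cl a i" "A * e = sc x e"
  have ei: "e * i = i" using h by (simp add: mult.assoc)
  have "A * i = A * e * i" by (simp only: ei mult.assoc)
  then show ?thesis using h(4) ei by simp
qed

text \<open>
  The solutions \<open>Y\<close> are dual to \<open>Ext\<^sup>1(S, S)\<close> over the quotient of the group algebra in which the
  central element acts as on \<open>S\<close>. They vanish on the diagonal blocks of both eigenspace
  decompositions, and one of these conditions is redundant since the traces agree.
\<close>

lemma dual_ext_dim:
  assumes S: "simple_pair d A B" and d: "d \<ge> 3"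
  shows "\<exists>Y1 Y2 r s r' s'. (\<forall>Y\<in>{Y1, Y2}. sz d d Y \<and> A * Y + Y * A = 0 \<and> B * B * Y + B * Y * B + Y * B * B = 0) \<and>
    ent Y1 r s \<noteq> 0 \<and> ent Y2 r s = 0 \<and> ent Y2 r' s' \<noteq> 0"
proof -
  note rpS = rep_pairD[OF simple_pairD(1)[OF S]]
  obtain c where c: "c \<noteq> 0" "A * A = sc c (E d)" using simple_pairD(3)[OF S] by blast
  obtain \<alpha> where \<alpha>: "\<alpha> ^ 2 = c" using complex_root_exists[of 2 c] by auto
  obtain \<beta> where \<beta>: "\<beta> ^ 3 = c" using complex_root_exists[of 3 c] by auto
  obtain \<omega> :: complex where w: "1 + \<omega> + \<omega>\<^sup>2 = 0" using primitive_cube_root by blast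
  have \<alpha>0: "\<alpha> \<noteq> 0" and \<beta>0: "\<beta> \<noteq> 0" using \<alpha> \<beta> c(1) by auto
  \<comment> \<open>Normalization to \<open>A1\<close> of order dividing two and \<open>T\<close> of
    order dividing three, for which the spectral projections have explicit formulas.\<close>
  define A1 T where "A1 = sc (1/\<alpha>) A" and "T = sc (1/\<beta>) B"
  have s1: "sz d d A1" "sz d d T" using rpS by (simp_all add: A1_def T_def)
  have A1A1: "A1 * A1 = E d" using c(2) \<alpha> c(1) by (simp add: A1_def power2_eq_square)
  have TTT: "T * T * T = E d"
    using c \<beta> rpS(3) by (simp add: T_def power3_eq_cube mult.assoc)
  have AA1: "A = sc \<alpha> A1" and BT: "B = sc \<beta> T" using \<alpha>0 \<beta>0 by (simp_all add: A1_def T_def)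
  note w3 = cube_root_identities(1,2)[OF w]
  define ep em where "ep = sc (1/2) (E d + A1)" and "em = sc (1/2) (E d - A1)"
  have sep: "sz d d ep" "sz d d em" using s1 by (simp_all add: ep_def em_def)
  have idem: "ep * ep = ep" "em * em = em"
    using s1 A1A1 by (rule_tac [!] fmat_eqI) (simp_all add: ep_def em_def distrib_left distrib_right
      left_diff_distrib right_diff_distrib)
  have epem: "ep + em = E d" by (rule fmat_eqI) (simp add: ep_def em_def field_simps)
  have eig: "A * ep = sc \<alpha> ep" "A * em = sc (- \<alpha>) em"
  proof -
    have "A1 * (E d + A1) = E d + A1" "A1 * (E d - A1) = - (E d - A1)"
      using s1 A1A1 by (simp_all add: distrib_left right_diff_distrib add.commute)
    moreover have "A * ep = sc (\<alpha> / 2) (A1 * (E d + A1))" "A * em = sc (\<alpha> / 2) (A1 * (E d - A1))"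
      by (simp_all add: AA1 ep_def em_def)
    ultimately have "A * ep = sc (\<alpha> / 2) (E d + A1)" "A * em = sc (\<alpha> / 2) (- (E d - A1))" by metis+
    moreover have "sc (\<alpha> / 2) (- (E d - A1)) = sc (- \<alpha>) em"
      by (rule fmat_eqI) (simp add: em_def right_diff_distrib)
    ultimately show "A * ep = sc \<alpha> ep" "A * em = sc (- \<alpha>) em" by (simp_all add: ep_def)
  qed
  define f where "f = spec3 d T"
  have sf: "sz d d (f z)" for z using s1 by (simp add: f_def spec3_def)
  note f = spec3_props[OF s1(2) TTT, folded f_def]
  have fB: "B * f z = sc (\<beta> * z\<^sup>2) (f z)" if "z ^ 3 = 1" for z unfolding BT using f(2)[OF that] by simp
  have fsum: "f 1 + f \<omega> + f (\<omega>\<^sup>2) = E d" unfolding f_def by (rule spec3_sum(1)[OF w s1(2)])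
  have one: "(1::complex) ^ 3 = 1" by simp
  obtain a1 i1 p1 where e1: "sz d a1 i1" "sz a1 d p1" "ep = i1 * p1" "p1 * i1 = E a1"
    using rank_factorization[OF sep(1) idem(1)] by blast
  obtain a2 i2 p2 where e2: "sz d a2 i2" "sz a2 d p2" "em = i2 * p2" "p2 * i2 = E a2"
    using rank_factorization[OF sep(2) idem(2)] by blast
  obtain b0 j0 q0 where f0: "sz d b0 j0" "sz b0 d q0" "f 1 = j0 * q0" "q0 * j0 = E b0"
    using rank_factorization[OF sf f(1)[OF one]] by blast
  obtain b1 j1 q1 where f1: "sz d b1 j1" "sz b1 d q1" "f \<omega> = j1 * q1" "q1 * j1 = E b1"
    using rank_factorization[OF sf f(1)[OF w3(1)]] by blast
  obtain b2 j2 q2 where f2: "sz d b2 j2" "sz b2 d q2" "f (\<omega>\<^sup>2) = j2 * q2" "q2 * j2 = E b2"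
    using rank_factorization[OF sf f(1)[OF w3(2)]] by blast
  \<comment> \<open>The trace of a projection is its rank, so the ranks of a decomposition of the
    identity add up to \<open>d\<close>.\<close>
  have "(of_nat (a1 + a2) :: complex) = of_nat d"
    using arg_cong[OF epem, of tr] e1(3,4) e2(3,4) tr_mult_commute[of i1 p1] tr_mult_commute[of i2 p2]
    by (simp add: tr_add)
  then have suma: "a1 + a2 = d" by (simp only: of_nat_eq_iff)
  have "(of_nat (b0 + b1 + b2) :: complex) = of_nat d"
    using arg_cong[OF fsum, of tr] f0(3,4) f1(3,4) f2(3,4) tr_mult_commute[of j0 q0] tr_mult_commute[of j1 q1]
      tr_mult_commute[of j2 q2]
    by (simp add: tr_add)
  then have sumb: "b0 + b1 + b2 = d" by (simp only: of_nat_eq_iff)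
  have bpos: "b > 0" if z: "z ^ 3 = 1" and j: "sz d b j" "f z = j * q" for z b j q
  proof (rule ccontr)
    assume "\<not> b > 0"
    then have "j = 0" using j(1) by (intro fmat_eqI) (simp add: cl_def)
    then have "f z = 0" using j(2) by simp
    then have TT: "T * T = sc (- z) (E d) + sc (- z\<^sup>2) T" by (rule f(3)[OF z])
    have "B * B = sc (\<beta>\<^sup>2) (T * T)" by (simp add: BT power2_eq_square)
    also have "\<dots> = sc (- \<beta> * z\<^sup>2) B + sc (- \<beta>\<^sup>2 * z) (E d)"
      unfolding TT by (simp add: BT sc_add power2_eq_square mult_ac add.commute)
    finally have "d \<le> 2" by (rule quadratic_dim[OF S])
    then show False using d by simp
  qed
  note eg = factor_eigen
  have d2: "d \<ge> 2" using d by simp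
  note g1 = eg[OF e1(3,4) conjunct2[OF e1(1)] eig(1)] and g2 = eg[OF e2(3,4) conjunct2[OF e2(1)] eig(2)]
    and h0 = eg[OF f0(3,4) conjunct2[OF f0(1)] fB[OF one]] and h1 = eg[OF f1(3,4) conjunct2[OF f1(1)] fB[OF w3(1)]]
    and h2 = eg[OF f2(3,4) conjunct2[OF f2(1)] fB[OF w3(2)]]
  note ed1 = eigenspaces_dim[OF S d2 e1(1,2,4) g1] and ed2 = eigenspaces_dim[OF S d2 e2(1,2,4) g2]
  have bp: "b0 > 0" "b1 > 0" "b2 > 0"
    using bpos[OF one f0(1,3)] bpos[OF w3(1) f1(1,3)] bpos[OF w3(2) f2(1,3)] by auto
  have bound: "a1 * a1 + a2 * a2 + b0 * b0 + b1 * b1 + b2 * b2 < d * d"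
    by (rule multiplicity_bound[OF suma sumb bp])
      (rule ed1[OF f0(1,2,4) h0] ed1[OF f1(1,2,4) h1] ed1[OF f2(1,2,4) h2]
        ed2[OF f0(1,2,4) h0] ed2[OF f1(1,2,4) h1] ed2[OF f2(1,2,4) h2])+
  have a1: "a1 > 0" using ed2[OF f0(1,2,4) h0] suma bp by linarith
  note F1 = block_functionals[OF e1(1,2)] and F2 = block_functionals[OF e2(1,2)] and K0 = block_functionals[OF f0(1,2)]
    and K1 = block_functionals[OF f1(1,2)] and K2 = block_functionals[OF f2(1,2)]
  let ?fs = "\<lambda>a p i. concat (map (\<lambda>k. map (\<lambda>l Y. ent (p * Y * i) k l) [0..<a]) [0..<a])"
  obtain gs where gs: "length gs = a1 * a1 - 1" "set gs \<subseteq> set (?fs a1 p1 i1)"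
    "\<And>Y. \<forall>g\<in>set gs. g Y = 0 \<Longrightarrow> tr (p1 * Y * i1) = 0 \<Longrightarrow> p1 * Y * i1 = 0"
    using F1(4)[OF a1] by metis
  define F where "F = gs @ ?fs a2 p2 i2 @ ?fs b0 q0 j0 @ ?fs b1 q1 j1 @ ?fs b2 q2 j2"
  have linF: "linf g" if "g \<in> set F" for g
  proof -
    have "g \<in> set (?fs a1 p1 i1) \<or> g \<in> set (?fs a2 p2 i2) \<or> g \<in> set (?fs b0 q0 j0) \<or>
      g \<in> set (?fs b1 q1 j1) \<or> g \<in> set (?fs b2 q2 j2)"
      using that gs(2) unfolding F_def set_append by blast
    then show ?thesis by (elim disjE) (rule F1(2) F2(2) K0(2) K1(2) K2(2); assumption)+
  qed
  have "length F = a1 * a1 - 1 + (a2 * a2 + (b0 * b0 + (b1 * b1 + b2 * b2)))"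
    unfolding F_def length_append gs(1) F2(1) K0(1) K1(1) K2(1) by (rule refl)
  moreover have "a1 * a1 > 0" using a1 by simp
  ultimately have lenF: "length F + 1 < d * d" using bound by linarith
  have sol: "A * Y + Y * A = 0 \<and> B * B * Y + B * Y * B + Y * B * B = 0"
    if Y: "sz d d Y" and z: "\<forall>g\<in>set F. g Y = 0" for Y
  proof -
    have zs: "\<forall>g\<in>set gs. g Y = 0" "p2 * Y * i2 = 0" "q0 * Y * j0 = 0" "q1 * Y * j1 = 0" "q2 * Y * j2 = 0"
      using z F2(3)[of Y] K0(3)[of Y] K1(3)[of Y] K2(3)[of Y] unfolding F_def set_append ball_Un by blast+
    have trq: "tr (Y * (i * p)) = tr (p * Y * i)" for i p
      using tr_mult_commute[of "Y * i" p] by (simp add: mult.assoc)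
    have "tr (Y * ep) + tr (Y * em) = tr (Y * f 1) + tr (Y * f \<omega>) + tr (Y * f (\<omega>\<^sup>2))"
      unfolding tr_add[symmetric] distrib_left[symmetric] epem fsum by (rule refl)
    then have "tr (p1 * Y * i1) = 0" unfolding e1(3) e2(3) f0(3) f1(3) f2(3) trq zs(2-5) by simp
    then have z1: "p1 * Y * i1 = 0" by (rule gs(3)[OF zs(1)])
    have sand: "i * p * Y * (i * p) = 0" if "p * Y * i = 0" for i p
    proof -
      have "i * p * Y * (i * p) = i * (p * Y * i) * p" by (simp add: mult.assoc)
      then show ?thesis using that by simp
    qed
    have "ep * Y * ep - em * Y * em = sc (1/2) (A1 * Y + Y * A1)"
      using s1 Y by (rule_tac fmat_eqI) (simp add: ep_def em_def distrib_left distrib_right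
        left_diff_distrib right_diff_distrib mult.assoc)
    moreover have "ep * Y * ep = 0" "em * Y * em = 0" unfolding e1(3) e2(3) by (rule sand, rule z1, rule sand, rule zs(2))
    ultimately have "A1 * Y + Y * A1 = 0" by simp
    then have AY: "A * Y + Y * A = 0" unfolding AA1 by (simp add: sc_add[symmetric])
    have "f 1 * Y * f 1 = 0" "f \<omega> * Y * f \<omega> = 0" "f (\<omega>\<^sup>2) * Y * f (\<omega>\<^sup>2) = 0"
      unfolding f0(3) f1(3) f2(3) by (rule sand, rule zs(3), rule sand, rule zs(4), rule sand, rule zs(5))
    then have "sc (1/3) (T * T * Y + T * Y * T + Y * T * T) = 0"
      using spec3_sum(2)[OF w s1(2) Y, folded f_def] by simp
    then have "T * T * Y + T * Y * T + Y * T * T = 0" by simp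
    then have "B * B * Y + B * Y * B + Y * B * B = 0" unfolding BT by (simp add: sc_add[symmetric])
    with AY show ?thesis by simp
  qed
  obtain Y1 where Y1: "sz d d Y1" "Y1 \<noteq> 0" "\<forall>g\<in>set F. g Y1 = 0"
    using underdetermined[of F d d] linF lenF by auto
  obtain r s where rs: "ent Y1 r s \<noteq> 0" using Y1(2) by (metis ent_0 fmat_eqI)
  \<comment> \<open>The additional condition at the entry (r, s), where \<open>Y1\<close> does not
    vanish, makes the second solution independent of the first. It uses up the 1 in
    \<open>lenF\<close>.\<close>
  have lin2: "linf g" if "g \<in> set ((\<lambda>Y. ent Y r s) # F)" for g
    using that linF by (auto simp: linf_def)
  obtain Y2 where Y2: "sz d d Y2" "Y2 \<noteq> 0" "\<forall>g\<in>set ((\<lambda>Y. ent Y r s) # F). g Y2 = 0"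
    using underdetermined[of "(\<lambda>Y. ent Y r s) # F" d d, OF lin2] lenF by auto
  obtain r' s' where rs': "ent Y2 r' s' \<noteq> 0" using Y2(2) by (metis ent_0 fmat_eqI)
  have z2: "\<forall>g\<in>set F. g Y2 = 0" "ent Y2 r s = 0" using Y2(3) by simp_all
  show ?thesis
    by (intro exI[of _ Y1] exI[of _ Y2] exI[of _ r] exI[of _ s] exI[of _ r'] exI[of _ s'] conjI rs rs' z2(2))
      (use Y1(1) Y2(1) sol[OF Y1(1,3)] sol[OF Y2(1) z2(1)] in auto)
qed

text \<open>
  Conjugating \<open>B \<oplus> B\<close> by \<open>h = (1 + t H1) (1 + t H2)\<close> with \<open>H1\<close>, \<open>H2\<close> off-diagonal and of square zero keeps
  the family polynomial. The tangent direction \<open>[H1 + H2, B \<oplus> B]\<close> commutes up to coboundaries only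
  with scalars. This is tested by the trace functionals \<open>tr (Z [X, D t])\<close>, where \<open>[Z, B] = [W, A] = Y\<close>
  is dual to the extensions: they vanish on the endomorphisms \<open>X\<close> at every \<open>t \<noteq> 0\<close>, and at \<open>t = 0\<close> they cut
  the endomorphism ring down to the scalars.
\<close>

lemma double_deform:
  assumes S: "simple_pair d A B" and d: "d \<ge> 3"
  shows "deform (d + d) (A + inj2 d d * A * proj2 d d) (B + inj2 d d * B * proj2 d d)"
proof -
  note F = fun_alg_pfun
  note rpS = rep_pairD[OF simple_pairD(1)[OF S]]
  obtain c where c: "c \<noteq> 0" "A * A = sc c (E d)" using simple_pairD(3)[OF S] by blast
  then have B3: "B * B * B = sc c (E d)" using rpS(3) by simp
  obtain Y1 Y2 r s r' s' where Y: "\<And>Y. Y \<in> {Y1, Y2} \<Longrightarrow> sz d d Y"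
      "\<And>Y. Y \<in> {Y1, Y2} \<Longrightarrow> A * Y + Y * A = 0" "\<And>Y. Y \<in> {Y1, Y2} \<Longrightarrow> B * B * Y + B * Y * B + Y * B * B = 0"
    and nz: "ent Y1 r s \<noteq> 0" "ent Y2 r s = 0" "ent Y2 r' s' \<noteq> 0"
    using dual_ext_dim[OF S d] by metis
  \<comment> \<open>The equations for \<open>Y\<close> make it a commutator with \<open>A\<close>
    and with \<open>B\<close>; the formulas for \<open>W\<close> and \<open>Z\<close> invert these
    commutators, with the factors 2 c and 3 c coming from \<open>A * A = c\<close> and
    \<open>B * B * B = c\<close>.\<close>
  define W where "W Y = sc (1 / (2 * c)) (Y * A)" for Y
  define Z where "Z Y = sc (1 / (3 * c)) (Y * B * B + Y * B * B + B * Y * B)" for Y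
  have sWZ: "sz d d (W Y)" "sz d d (Z Y)" if "Y \<in> {Y1, Y2}" for Y
    using Y(1)[OF that] rpS by (simp_all add: W_def Z_def)
  have WA: "W Y * A - A * W Y = Y" if y: "Y \<in> {Y1, Y2}" for Y
  proof -
    have AY: "A * Y = - (Y * A)" using Y(2)[OF y] by (simp add: eq_neg_iff_add_eq_0)
    have "Y * A * A = sc c Y" using c(2) Y(1)[OF y] by (simp add: mult.assoc)
    then have "Y * A * A - A * (Y * A) = sc (2 * c) Y"
      by (simp add: mult.assoc[symmetric] AY) (rule fmat_eqI, simp)
    then show ?thesis using c(1) by (simp add: W_def sc_diff[symmetric] mult.assoc)
  qed
  have ZB: "Z Y * B - B * Z Y = Y" if y: "Y \<in> {Y1, Y2}" for Y
  proof -
    have YBBB: "Y * B * B * B = sc c Y" using B3 Y(1)[OF y] by (simp add: mult.assoc)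
    define P Q where "P = B * B * Y * B" and "Q = B * Y * B * B"
    have "(B * B * Y + B * Y * B + Y * B * B) * B = 0" using Y(3)[OF y] by simp
    then have rel: "P + Q + sc c Y = 0" by (simp add: distrib_right YBBB P_def Q_def)
    have "(Y * B * B + Y * B * B + B * Y * B) * B - B * (Y * B * B + Y * B * B + B * Y * B)
        = Y * B * B * B + Y * B * B * B + Q - (Q + Q + P)"
      by (simp add: distrib_left distrib_right P_def Q_def mult.assoc)
    also have "\<dots> = sc (3 * c) Y - (P + Q + sc c Y)"
      unfolding YBBB by (rule fmat_eqI) (simp add: algebra_simps)
    finally have "(Y * B * B + Y * B * B + B * Y * B) * B - B * (Y * B * B + Y * B * B + B * Y * B) = sc (3 * c) Y"
      by (simp add: rel)
    then show ?thesis using c(1) by (simp add: Z_def sc_diff[symmetric])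
  qed
  define N where "N = d + d"
  define J Q where "J = inj2 d d" and "Q = proj2 d d"
  define AA BB where "AA = tri d d A A 0" and "BB = tri d d B B 0"
  \<comment> \<open>Pairing with \<open>G1\<close> and \<open>G2\<close> under the trace reads off
    the entries (r, s) and (r', s'). On \<open>Y1\<close>, \<open>Y2\<close> these pairings form a
    triangular system with nonzero diagonal. The factors \<open>E d\<close> enforce the size without
    knowing where the entries lie.\<close>
  define G1 G2 where "G1 = E d * El s r * E d" and "G2 = E d * El s' r' * E d"
  have sG: "sz d d G1" "sz d d G2" by (simp_all add: G1_def G2_def)
  have trG: "tr (Y * G1) = ent Y r s" "tr (Y * G2) = ent Y r' s'" if y: "Y \<in> {Y1, Y2}" for Y
  proof -
    have "tr (Y * (E d * El a b * E d)) = ent Y b a" for a b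
    proof -
      have "tr (Y * (E d * El a b * E d)) = tr (E d * (Y * El a b))"
        using tr_mult_commute[of "Y * El a b" "E d"] Y(1)[OF y] by (simp add: mult.assoc[symmetric])
      also have "\<dots> = tr (El a b * Y)" using Y(1)[OF y] tr_mult_commute[of Y "El a b"] by simp
      finally show ?thesis by (simp add: tr_El_times)
    qed
    then show "tr (Y * G1) = ent Y r s" "tr (Y * G2) = ent Y r' s'" by (simp_all add: G1_def G2_def)
  qed
  \<comment> \<open>\<open>G1\<close> goes to the upper right corner and \<open>G2\<close> to the
    lower left one; only scalar 2 x 2 matrices commute with both corner units.\<close>
  define H1 H2 where "H1 = G1 * Q" and "H2 = J * G2"
  have sJQ: "rw N J" "cl d J" "rw d Q" "cl N Q" by (simp_all add: J_def Q_def N_def)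
  have sN: "sz N N H1" "sz N N H2" "sz N N AA" "sz N N BB"
    using sG rpS sJQ rw_mono[of d G1 N] cl_mono[of d G2 N] by (simp_all add: H1_def H2_def AA_def BB_def N_def)
  have H0: "H1 * H1 = 0" "H2 * H2 = 0"
  proof -
    have "Q * (G1 * Q) = 0" using sG by (simp add: Q_def)
    then show "H1 * H1 = 0" by (simp add: H1_def mult.assoc)
    have "G2 * J = 0" using sG by (simp add: J_def)
    then have "G2 * (J * G2) = 0" by (simp add: mult.assoc[symmetric])
    then show "H2 * H2 = 0" by (simp add: H2_def mult.assoc)
  qed
  define h where "h t = (E N + sc t H1) * (E N + sc t H2)" for t
  define h' where "h' t = (E N - sc t H2) * (E N - sc t H1)" for t
  have sh: "sz N N (h t)" "sz N N (h' t)" for t using sN by (simp_all add: h_def h'_def)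
  have inv1: "(E N + sc t H) * (E N - sc t H) = E N" "(E N - sc t H) * (E N + sc t H) = E N"
    if "sz N N H" "H * H = 0" for t H
    using that by (simp_all add: distrib_left distrib_right left_diff_distrib right_diff_distrib)
  have hh': "h t * h' t = E N" "h' t * h t = E N" for t
  proof -
    have "h t * h' t = (E N + sc t H1) * ((E N + sc t H2) * (E N - sc t H2)) * (E N - sc t H1)"
      by (simp add: h_def h'_def mult.assoc)
    then show "h t * h' t = E N" using inv1[OF sN(1) H0(1)] inv1[OF sN(2) H0(2)] sN by simp
    have "h' t * h t = (E N - sc t H2) * ((E N - sc t H1) * (E N + sc t H1)) * (E N + sc t H2)"
      by (simp add: h_def h'_def mult.assoc)
    then show "h' t * h t = E N" using inv1[OF sN(1) H0(1)] inv1[OF sN(2) H0(2)] sN by simp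
  qed
  define Bt where "Bt t = h t * BB * h' t" for t
  \<comment> \<open>The difference quotient of \<open>Bt\<close> at 0, written without division so
    that it is polynomial in \<open>t\<close> and defined at 0.\<close>
  define D where "D t = ((H1 + H2) * BB - BB * (H1 + H2) + sc t (H1 * H2 * BB - BB * (H1 * H2))) * h' t" for t
  have sD: "sz N N (Bt t)" "sz N N (D t)" for t using sN sh by (simp_all add: Bt_def D_def)
  have BtD: "Bt t = BB + sc t (D t)" for t
  proof -
    have "h t = E N + sc t (H1 + H2) + sc (t * t) (H1 * H2)"
      using sN by (simp add: h_def distrib_left distrib_right sc_add add_ac)
    then have "h t * BB - BB * h t = sc t ((H1 + H2) * BB - BB * (H1 + H2) + sc t (H1 * H2 * BB - BB * (H1 * H2)))"
      using sN by (simp add: distrib_left distrib_right sc_add sc_diff)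
    then have "(h t * BB - BB * h t) * h' t = sc t (D t)" by (simp add: D_def)
    moreover have "BB * h t * h' t = BB" using hh'(1)[of t] sN by (simp add: mult.assoc)
    ultimately have "Bt t - BB = sc t (D t)" by (simp add: Bt_def left_diff_distrib)
    then show ?thesis by (simp add: algebra_simps)
  qed
  have rp0: "rep_pair N AA BB"
    unfolding AA_def BB_def N_def by (rule tri_rp[OF simple_pairD(1)[OF S] simple_pairD(1)[OF S]]) simp_all
  have AA2: "AA * AA = sc c (E N)"
  proof -
    have "AA * AA = tri d d (A * A) (A * A) 0" using rpS by (simp add: AA_def tri_mult)
    also have "\<dots> = sc c (tri d d (E d) (E d) 0)" unfolding c(2) by (simp add: tri_def sc_add)
    finally show ?thesis by (simp add: tri_E N_def)
  qed
  have rpt: "rep_pair N AA (Bt t)" for t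
  proof -
    obtain A' B' where inv: "inv_pair N AA A'" "inv_pair N BB B'" using rp0 by (auto simp: rep_pair_def)
    have cancel: "h' t * (h t * x) = E N * x" for x using hh'(2)[of t] by (simp add: mult.assoc[symmetric])
    have BB': "BB * (B' * x) = E N * x" "B' * (BB * x) = E N * x" for x
      using inv(2) by (simp_all add: inv_pair_def mult.assoc[symmetric])
    have "Bt t * (h t * B' * h' t) = h t * (BB * (E N * (B' * h' t)))"
      by (simp add: Bt_def mult.assoc cancel)
    also have "\<dots> = h t * (BB * B') * h' t" using inv by (simp add: inv_pair_def mult.assoc BB')
    finally have 1: "Bt t * (h t * B' * h' t) = E N" using inv sh hh' by (simp add: inv_pair_def)
    have "h t * B' * h' t * Bt t = h t * (B' * (E N * (BB * h' t)))"
      by (simp add: Bt_def mult.assoc cancel)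
    also have "\<dots> = h t * (B' * BB) * h' t" using inv by (simp add: inv_pair_def mult.assoc BB')
    finally have 2: "h t * B' * h' t * Bt t = E N" using inv sh hh' by (simp add: inv_pair_def)
    have "inv_pair N (Bt t) (h t * B' * h' t)" using 1 2 sD sh inv by (simp add: inv_pair_def)
    moreover have "Bt t * Bt t * Bt t = h t * (BB * (E N * (BB * (E N * (BB * h' t)))))"
      by (simp add: Bt_def mult.assoc cancel)
    then have "Bt t * Bt t * Bt t = h t * (BB * BB * BB) * h' t" using sN by (simp add: mult.assoc)
    then have "Bt t * Bt t * Bt t = AA * AA"
      unfolding rep_pairD(3)[OF rp0, symmetric] AA2 using sh hh' by simp
    ultimately show ?thesis using inv(1) unfolding rep_pair_def by metis
  qed
  \<comment> \<open>Since \<open>AA\<close> and \<open>BB\<close> are two copies of \<open>A\<close>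
    and \<open>B\<close>, the commutator relations persist when \<open>Y\<close>, \<open>Z\<close>
    and \<open>W\<close> are moved to the upper right corner by \<open>Q\<close>. This gives trace
    tests for another block.\<close>
  have ZBB: "Z Y * BB - BB * Z Y = Y" "Z Y * Q * BB - BB * (Z Y * Q) = Y * Q"
    "W Y * AA - AA * W Y = Y" "W Y * Q * AA - AA * (W Y * Q) = Y * Q" if y: "Y \<in> {Y1, Y2}" for Y
  proof -
    note s = sWZ[OF y] rpS(1,2)
    have "Z Y * BB = Z Y * B" "BB * Z Y = B * Z Y" "W Y * AA = W Y * A" "AA * W Y = A * W Y"
      using s by (simp_all add: BB_def AA_def tri_def distrib_left distrib_right mult.assoc)
    then show "Z Y * BB - BB * Z Y = Y" "W Y * AA - AA * W Y = Y" using ZB[OF y] WA[OF y] by simp_all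
    have "Z Y * Q * BB = Z Y * B * Q" "BB * (Z Y * Q) = B * Z Y * Q" "W Y * Q * AA = W Y * A * Q" "AA * (W Y * Q) = A * W Y * Q"
      using s by (simp_all add: BB_def AA_def tri_def Q_def distrib_left distrib_right mult.assoc)
    then show "Z Y * Q * BB - BB * (Z Y * Q) = Y * Q" "W Y * Q * AA - AA * (W Y * Q) = Y * Q"
      using ZB[OF y] WA[OF y] by (simp_all add: left_diff_distrib[symmetric])
  qed
  have cyc: "tr (x * y * z) = tr (z * x * y)" for x y z
    using tr_mult_commute[of "x * y" z] by (simp add: mult.assoc)
  \<comment> \<open>As \<open>X\<close> commutes with \<open>BB + sc t (D t)\<close>, its commutator
    with \<open>BB\<close> is -t times its commutator with \<open>D t\<close>. Cyclicity of the
    trace turns the pairing with \<open>ZZ\<close> into a multiple of \<open>tr (YY * X)\<close>,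
    which vanishes because \<open>YY\<close> is the commutator of \<open>WW\<close> with
    \<open>AA\<close> and \<open>X\<close> commutes with \<open>AA\<close>. Division by
    \<open>t\<close> leaves a condition that is still meaningful at 0.\<close>
  have end_zero: "tr (ZZ * (X * D t - D t * X)) = 0"
    if X: "X * AA = AA * X" "X * Bt t = Bt t * X" and t: "t \<noteq> 0"
      and ZZ: "ZZ * BB - BB * ZZ = YY" "WW * AA - AA * WW = YY" for X ZZ WW YY t
  proof -
    have "X * BB - BB * X = - sc t (X * D t - D t * X)"
      using X(2) unfolding BtD by (simp add: distrib_left distrib_right sc_diff algebra_simps)
    then have "t * tr (ZZ * (X * D t - D t * X)) = - tr (ZZ * (X * BB - BB * X))"
      by (simp add: tr_uminus tr_sc)
    also have "tr (ZZ * (X * BB - BB * X)) = tr (ZZ * X * BB) - tr (ZZ * BB * X)"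
      by (simp add: right_diff_distrib tr_diff mult.assoc)
    also have "\<dots> = tr (BB * ZZ * X) - tr (ZZ * BB * X)" by (simp only: cyc[of ZZ X BB])
    also have "\<dots> = - tr (YY * X)" by (simp add: ZZ(1)[symmetric] left_diff_distrib tr_diff)
    also have "tr (YY * X) = tr (WW * AA * X) - tr (AA * WW * X)"
      by (simp add: ZZ(2)[symmetric] left_diff_distrib tr_diff)
    also have "\<dots> = 0" using cyc[of WW X AA] X(1) by (simp add: mult.assoc)
    finally show ?thesis using t by simp
  qed
  \<comment> \<open>At 0 the matrix \<open>D 0\<close> is the commutator of \<open>H1 + H2\<close>
    with \<open>BB\<close>. By the Jacobi identity and cyclicity the test becomes the pairing of
    \<open>YY\<close> with the commutator of \<open>X\<close> and \<open>H1 + H2\<close>.\<close>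
  have zero_tr: "tr (YY * (X * (H1 + H2) - (H1 + H2) * X)) = 0"
    if X: "X * BB = BB * X" and z: "tr (ZZ * (X * D 0 - D 0 * X)) = 0" and ZZ: "ZZ * BB - BB * ZZ = YY" for X ZZ YY
  proof -
    define H where "H = H1 + H2"
    have D0: "D 0 = H * BB - BB * H" using sN by (simp add: D_def h'_def H_def)
    have "ZZ * (X * D 0 - D 0 * X) = ZZ * (X * H) * BB - ZZ * (X * BB) * H - ZZ * H * (BB * X) + ZZ * BB * (H * X)"
      by (simp add: D0 left_diff_distrib right_diff_distrib mult.assoc)
    also have "\<dots> = ZZ * (X * H) * BB - ZZ * BB * (X * H) - ZZ * (H * X) * BB + ZZ * BB * (H * X)"
    proof -
      have XB: "X * (BB * x) = BB * (X * x)" for x using X by (metis mult.assoc)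
      show ?thesis by (simp add: mult.assoc XB X[symmetric])
    qed
    finally have "tr (ZZ * (X * H) * BB) - tr (ZZ * BB * (X * H)) - tr (ZZ * (H * X) * BB) + tr (ZZ * BB * (H * X)) = 0"
      using z by (simp add: tr_diff tr_add)
    then have "tr (BB * ZZ * (X * H)) - tr (ZZ * BB * (X * H)) - tr (BB * ZZ * (H * X)) + tr (ZZ * BB * (H * X)) = 0"
      by (simp only: cyc[of ZZ "X * H" BB] cyc[of ZZ "H * X" BB])
    moreover have "(q - p) - (v - u) = 0" if "p - q - u + v = 0" for p q u v :: complex
    proof -
      have "(q - p) - (v - u) = - (p - q - u + v)" by simp
      then show ?thesis using that by simp
    qed
    ultimately have "(tr (ZZ * BB * (X * H)) - tr (BB * ZZ * (X * H))) - (tr (ZZ * BB * (H * X)) - tr (BB * ZZ * (H * X))) = 0"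
      by blast
    then have "tr (YY * (X * H)) - tr (YY * (H * X)) = 0"
      unfolding ZZ[symmetric] left_diff_distrib tr_diff .
    then show ?thesis by (simp add: H_def[symmetric] right_diff_distrib tr_diff)
  qed
  have mem: "Y1 \<in> {Y1, Y2}" "Y2 \<in> {Y1, Y2}" by simp_all
  \<comment> \<open>By Schur's lemma an endomorphism of two copies of \<open>S\<close> is a 2 x 2
    matrix of scalars. The trace tests make it scalar and its corner entry then makes it
    zero.\<close>
  have inj0: "X = 0"
    if X: "sz N N X" "X * AA = AA * X" "X * BB = BB * X" "ent X 0 0 = 0"
      and tz: "tr (Z Y2 * (X * D 0 - D 0 * X)) = 0" "tr (Z Y2 * Q * (X * D 0 - D 0 * X)) = 0"
        "tr (Z Y1 * (X * D 0 - D 0 * X)) = 0" for X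
  proof -
    define U where "U = (\<lambda>k::nat. if k = 0 then E d else J)"
    define V where "V = (\<lambda>k::nat. if k = 0 then E d else Q)"
    have blk: "\<exists>c. V k * X * U l = sc c (E d)" for k l
    proof (rule schur[OF S])
      have UA: "tri d d M M 0 * U l = U l * M" "V k * tri d d M M 0 = M * V k" if "sz d d M" for M k l
        using that by (simp_all add: U_def V_def J_def Q_def tri_def distrib_left distrib_right mult.assoc)
      show "sz d d (V k * X * U l)" by (simp add: U_def V_def J_def Q_def)
      have "V k * X * U l * M = M * (V k * X * U l)"
        if "sz d d M" "X * tri d d M M 0 = tri d d M M 0 * X" for M
      proof -
        have "V k * X * U l * M = V k * (X * tri d d M M 0) * U l" by (simp add: mult.assoc UA(1)[OF that(1)])
        also have "\<dots> = M * (V k * X * U l)"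
          unfolding that(2) by (simp add: mult.assoc[symmetric] UA(2)[OF that(1)])
        finally show ?thesis .
      qed
      then show "V k * X * U l * A = A * (V k * X * U l)" "V k * X * U l * B = B * (V k * X * U l)"
        using rpS X(2,3) by (simp_all add: AA_def BB_def)
    qed
    obtain x00 where x00: "E d * X * E d = sc x00 (E d)" using blk[of 0 0] by (auto simp: U_def V_def)
    obtain x01 where x01: "E d * X * J = sc x01 (E d)" using blk[of 0 1] by (auto simp: U_def V_def)
    obtain x10 where x10: "Q * X * E d = sc x10 (E d)" using blk[of 1 0] by (auto simp: U_def V_def)
    obtain x11 where x11: "Q * X * J = sc x11 (E d)" using blk[of 1 1] by (auto simp: U_def V_def)
    have "X = (E d + J * Q) * X * (E d + J * Q)"
      using X(1) by (simp add: J_def Q_def E_add_inj2_proj2 N_def)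
    also have "\<dots> = E d * X * E d + E d * X * J * Q + J * (Q * X * E d) + J * (Q * X * J) * Q"
      by (simp add: distrib_left distrib_right mult.assoc add_ac)
    also have "\<dots> = sc x00 (E d) + sc x01 Q + sc x10 J + sc x11 (J * Q)"
      unfolding x00 x01 x10 x11 using sJQ by simp
    finally have Xe: "X = sc x00 (E d) + sc x01 Q + sc x10 J + sc x11 (J * Q)" .
    have jq: "Q * J = E d" "Q * (J * x) = E d * x" "E d * J = 0" "Q * E d = 0" for x
      by (simp_all add: J_def Q_def mult.assoc[symmetric])
    have gz: "Q * G1 = 0" "Q * (G1 * x) = 0" "G2 * J = 0" "G2 * (J * x) = 0" "G1 * J = 0" "Q * G2 = 0"
       "G1 * (J * x) = 0" "Q * (G2 * x) = 0" "Q * Q = 0" "Q * (Q * x) = 0" "J * J = 0" "J * (J * x) = 0"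
       "E d * (J * x) = 0" "Q * (E d * x) = 0" for x
      using sG by (simp_all add: J_def Q_def)
    have XH: "X * (H1 + H2) = sc x00 (G1 * Q) + sc x01 G2 + sc x10 (J * G1 * Q) + sc x11 (J * G2)"
      unfolding Xe H1_def H2_def using sG sJQ
      by (simp add: distrib_left distrib_right mult.assoc jq gz add_ac)
    have HX: "(H1 + H2) * X = sc x00 (J * G2) + sc x01 (J * G2 * Q) + sc x10 G1 + sc x11 (G1 * Q)"
      unfolding Xe H1_def H2_def using sG sJQ
      by (simp add: distrib_left distrib_right mult.assoc jq gz add_ac)
    have yz: "tr (Y * (G * Q)) = 0" "Y * (J * x) = 0" if "sz d d Y" for Y G x
    proof -
      have "tr (Y * (G * Q)) = tr (Q * (Y * G))" using tr_mult_commute[of "Y * G" Q] by (simp add: mult.assoc)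
      also have "Q * (Y * G) = 0" using that by (simp add: Q_def)
      finally show "tr (Y * (G * Q)) = 0" by simp
      show "Y * (J * x) = 0" using that by (simp add: J_def)
    qed
    have t00: "x01 * tr (Y * G2) - x10 * tr (Y * G1) = 0" if y: "Y \<in> {Y1, Y2}"
      and z: "tr (Z Y * (X * D 0 - D 0 * X)) = 0" for Y
      using zero_tr[OF X(3) z ZBB(1)[OF y]] unfolding XH HX
      by (simp add: right_diff_distrib distrib_left tr_diff tr_add tr_sc mult.assoc yz[OF Y(1)[OF y]])
    have t01: "(x11 - x00) * tr (Y * G2) = 0" if y: "Y \<in> {Y1, Y2}"
      and z: "tr (Z Y * Q * (X * D 0 - D 0 * X)) = 0" for Y
      using zero_tr[OF X(3) z ZBB(2)[OF y]] unfolding XH HX using sG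
      by (simp add: right_diff_distrib distrib_left tr_diff tr_add tr_sc mult.assoc yz[OF Y(1)[OF y]] jq gz
          left_diff_distrib)
    \<comment> \<open>The order matters: \<open>Y2\<close> pairs to zero with \<open>G1\<close> and
      so isolates \<open>x01\<close>; after that \<open>Y1\<close> isolates \<open>x10\<close>. The
      test shifted by \<open>Q\<close> compares the diagonal.\<close>
    have "x01 = 0" using t00[OF mem(2) tz(1)] nz by (simp add: trG)
    moreover have "x10 = 0" using t00[OF mem(1) tz(3)] nz \<open>x01 = 0\<close> by (simp add: trG)
    moreover have "x11 = x00" using t01[OF mem(2) tz(2)] nz by (simp add: trG)
    ultimately have "X = sc x00 (E d + J * Q)" unfolding Xe by (simp add: sc_add)
    then have Xs: "X = sc x00 (E N)" by (simp add: J_def Q_def E_add_inj2_proj2 N_def)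
    have "ent (sc x00 (E N)) 0 0 = 0" using X(4) Xs by metis
    then have "x00 = 0" using d by (simp add: N_def split: if_splits)
    then show ?thesis using Xs by simp
  qed
  have id: "(\<lambda>t. t) \<in> pfun" using pfun_poly[of "[:0, 1:]"] by simp
  have pB: "pmat pfun Bt" and pD: "pmat pfun D"
    unfolding Bt_def D_def h_def h'_def
    by (intro pmat_add[OF F] pmat_diff[OF F] pmat_mult[OF F] pmat_const[OF F] pmat_sc[OF F] id)+
  define L1 where "L1 t X = X * AA - AA * X" for t :: complex and X
  define L2 where "L2 t X = X * Bt t - Bt t * X" for t X
  define TR where "TR ZZ t X = tr (ZZ * (X * D t - D t * X))" for ZZ t X
  \<comment> \<open>For nonzero \<open>t\<close> the three trace tests follow from the commutation
    relations, so adding them does not shrink the endomorphism ring. At 0 they do shrink it, which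
    makes the system injective there and hence for cofinitely many \<open>t\<close>.\<close>
  define fs where "fs = entries N N L1 @ entries N N L2 @
    [TR (Z Y2), TR (Z Y2 * Q), TR (Z Y1), \<lambda>t X. ent X 0 0]"
  have fs_cases: "(\<exists>a b. f = (\<lambda>t X. ent (L1 t X) a b)) \<or> (\<exists>a b. f = (\<lambda>t X. ent (L2 t X) a b)) \<or>
      (\<exists>ZZ. f = TR ZZ) \<or> f = (\<lambda>t X. ent X 0 0)" if "f \<in> set fs" for f
    using that unfolding fs_def set_append set_entries by auto
  have lin: "linf (\<lambda>X. ent (L1 t X) a b)" "linf (\<lambda>X. ent (L2 t X) a b)" "linf (TR ZZ t)" "linf (\<lambda>X. ent X 0 0)"
    for t a b ZZ
    by (simp_all add: linf_def L1_def L2_def TR_def algebra_simps tr_add tr_diff tr_sc)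
  have pm: "pmat pfun (\<lambda>t. L1 t X)" "pmat pfun (\<lambda>t. L2 t X)" "(\<lambda>t. TR ZZ t X) \<in> pfun" for X ZZ
    unfolding L1_def L2_def TR_def
    by (intro pmat_tr[OF F] pmat_diff[OF F] pmat_mult[OF F] pmat_const[OF F] pB pD)+
  have Bt0: "Bt 0 = BB" using BtD[of 0] by simp
  have "\<exists>g\<in>pfun. g 0 \<noteq> 0 \<and> (\<forall>t. g t \<noteq> 0 \<longrightarrow> injective_at N N (map (\<lambda>f. f t) fs))"
  proof (rule injective_open[OF F])
    show "linf (f t)" if "f \<in> set fs" for f t
      using fs_cases[OF that] by (elim disjE exE) (simp_all add: lin)
    show "(\<lambda>t. f t X) \<in> pfun" if "f \<in> set fs" for f X
      using fs_cases[OF that] by (elim disjE exE) (simp_all add: pmat_ent[OF pm(1)] pmat_ent[OF pm(2)] pm(3) fun_algD(1)[OF F])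
    show "injective_at N N (map (\<lambda>f. f 0) fs)"
      unfolding injective_at_def
    proof (intro allI impI)
      fix X assume X: "sz N N X" and "\<forall>f\<in>set (map (\<lambda>f. f 0) fs). f X = 0"
      then have eq: "\<forall>f\<in>set fs. f 0 X = 0" by simp
      have e1: "\<forall>f\<in>set (entries N N L1). f 0 X = 0" and e2: "\<forall>f\<in>set (entries N N L2). f 0 X = 0"
        and e3: "TR (Z Y2) 0 X = 0" "TR (Z Y2 * Q) 0 X = 0" "TR (Z Y1) 0 X = 0" "ent X 0 0 = 0"
        using eq unfolding fs_def set_append ball_Un by simp_all
      have "L1 0 X = 0" by (rule entries_zero[OF e1]) (use X sN in \<open>simp add: L1_def\<close>)
      then have c1: "X * AA = AA * X" by (simp add: L1_def)
      have "L2 0 X = 0" by (rule entries_zero[OF e2]) (use X sD in \<open>simp add: L2_def\<close>)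
      then have c2: "X * BB = BB * X" by (simp add: L2_def Bt0)
      show "X = 0" by (rule inj0[OF X c1 c2 e3(4) e3(1-3)[unfolded TR_def]])
    qed
  qed
  then obtain g where g: "g \<in> pfun" "g 0 \<noteq> 0" and ginj: "\<forall>t. g t \<noteq> 0 \<longrightarrow> injective_at N N (map (\<lambda>f. f t) fs)"
    by (elim bexE conjE) (rule that)
  have se: "scalar_end N AA (Bt t)" if t: "t \<noteq> 0" "g t \<noteq> 0" for t
    unfolding scalar_end_def
  proof (intro allI impI)
    fix X assume h: "sz N N X \<and> X * AA = AA * X \<and> X * Bt t = Bt t * X"
    define X' where "X' = X - sc (ent X 0 0) (E N)"
    have sX': "sz N N X'" using h by (simp add: X'_def)
    have N0: "N > 0" using d by (simp add: N_def)
    have c1: "X' * AA = AA * X'" and c2: "X' * Bt t = Bt t * X'"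
      using h sN sD by (simp_all add: X'_def left_diff_distrib right_diff_distrib)
    have e0: "ent X' 0 0 = 0" using N0 by (simp add: X'_def)
    note z = end_zero[OF c1 c2 t(1)]
    have "TR (Z Y2) t X' = 0" "TR (Z Y2 * Q) t X' = 0" "TR (Z Y1) t X' = 0"
      unfolding TR_def
      by (rule z[OF ZBB(1)[OF mem(2)] ZBB(3)[OF mem(2)]], rule z[OF ZBB(2)[OF mem(2)] ZBB(4)[OF mem(2)]],
          rule z[OF ZBB(1)[OF mem(1)] ZBB(3)[OF mem(1)]])
    moreover have "\<forall>f\<in>set (entries N N L1). f t X' = 0" "\<forall>f\<in>set (entries N N L2). f t X' = 0"
      using c1 c2 by (auto simp: set_entries L1_def L2_def)
    ultimately have "\<forall>f\<in>set (map (\<lambda>f. f t) fs). f X' = 0"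
      using e0 unfolding fs_def by (simp add: ball_Un)
    then have "X' = 0" using ginj[rule_format, OF t(2)] sX' unfolding injective_at_def by blast
    then show "\<exists>c. X = sc c (E N)" by (auto simp: X'_def)
  qed
  have "eventually (\<lambda>t::complex. t \<noteq> 0) cofinite" using pfun_nonzero_cofinite[OF id, of 1] by simp
  then have "eventually (\<lambda>t. t \<noteq> 0 \<and> g t \<noteq> 0) cofinite"
    using pfun_nonzero_cofinite[OF g] by (simp add: eventually_conj_iff)
  then have ev: "eventually (\<lambda>t. scalar_end N AA (Bt t)) cofinite"
    by (rule eventually_mono) (rule se; simp)
  show ?thesis
    unfolding deform_def N_def[symmetric]
    by (intro exI[of _ "\<lambda>_. AA"] exI[of _ Bt] exI[of _ c] conjI allI pmat_const[OF F] pB c(1) rpt AA2 ev)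
      (simp_all add: Bt0 AA_def BB_def tri_def)
qed

section \<open>From the list of simple summands to the two deformations\<close>

lemma replicate_twice_positions:
  assumes i: "1 \<le> i" "i \<le> k" and e: "e i \<ge> 2"
  shows "\<exists>a b. a < b \<and> b < length (concat (map (\<lambda>i. replicate (e i) (S i)) [1..<Suc k])) \<and>
    concat (map (\<lambda>i. replicate (e i) (S i)) [1..<Suc k]) ! a = S i \<and>
    concat (map (\<lambda>i. replicate (e i) (S i)) [1..<Suc k]) ! b = S i"
proof -
  let ?f = "\<lambda>i. replicate (e i) (S i)"
  have "[1..<Suc k] = [1..<i] @ [i..<Suc k]"
    using i upt_add_eq_append[of 1 i "Suc k - i"] by simp
  also have "[i..<Suc k] = i # [Suc i..<Suc k]" using i by (simp add: upt_conv_Cons)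
  finally have split: "concat (map ?f [1..<Suc k])
    = concat (map ?f [1..<i]) @ ?f i @ concat (map ?f [Suc i..<Suc k])" by simp
  define l where "l = length (concat (map ?f [1..<i]))"
  have "concat (map ?f [1..<Suc k]) ! (l + j) = S i" if "j < e i" for j
    unfolding split nth_append l_def using that by simp
  note nth = this
  have "l + 1 < length (concat (map ?f [1..<Suc k]))" unfolding split l_def using e by simp
  moreover have "concat (map ?f [1..<Suc k]) ! l = S i" "concat (map ?f [1..<Suc k]) ! (l + 1) = S i"
    using nth[of 0] nth[of 1] e by simp_all
  ultimately show ?thesis by (intro exI[of _ l] exI[of _ "l + 1"] conjI less_add_one)
qed

theorem theorem9:
  fixes n k :: nat
    and V :: b3_rep
    and S :: "nat \<Rightarrow> b3_rep"
    and e :: "nat \<Rightarrow> nat"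
  assumes "V \<in> rep_variety n"
    and "\<And>i. i \<in> {1..k} \<Longrightarrow> simple_rep (S i)"
    and "\<And>i j. \<lbrakk>i \<in> {1..k}; j \<in> {1..k}; i \<noteq> j\<rbrakk> \<Longrightarrow> \<not> rep_iso (S i) (S j)"
    and "\<And>i. i \<in> {1..k} \<Longrightarrow> e i \<ge> 1"
    and "rep_iso V (isotypic_sum k S e)"
    and "singular_point n V"
    and "(\<exists>i j. 1 \<le> i \<and> i < j \<and> j \<le> k \<and> Ext1 (S i) (S j) \<noteq> {Ext1_zero (S i) (S j)}) \<or>
         (\<exists>i. 1 \<le> i \<and> i \<le> k \<and> rep_dim (S i) \<ge> 3 \<and> e i \<ge> 2)"
  shows "\<exists>Z1 Z2. irreducible_component (rep_zariski n) Z1 \<and>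
           irreducible_component (rep_zariski n) Z2 \<and> Z1 \<noteq> Z2 \<and> V \<in> Z1 \<inter> Z2"
proof -
  define Ss where "Ss = concat (map (\<lambda>i. replicate (e i) (S i)) [1..<Suc k])"
  have simple: "simple_rep W" if W: "W \<in> set Ss" for W
  proof -
    obtain i where "i \<in> set [1..<Suc k]" "W \<in> set (replicate (e i) (S i))"
      using W unfolding Ss_def set_concat set_map by blast
    then have "i \<in> {1..k}" "W = S i" by auto
    then show ?thesis using assms(2)[of i] by simp
  qed
  have "rep_iso V (direct_sum_reps Ss)" using assms(5) by (simp add: isotypic_sum_def Ss_def)
  from rep_iso_direct_sum[OF assms(1) this simple_rep_in_variety[OF simple]]
  obtain i p where D: "dsum n {..<length Ss} (\<lambda>l. rep_dim (Ss ! l)) i p"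
    and Vf: "of_mat (fst V) = glue {..<length Ss} i p (\<lambda>l. of_mat (fst (Ss ! l)))"
    and Vs: "of_mat (snd V) = glue {..<length Ss} i p (\<lambda>l. of_mat (snd (Ss ! l)))" by auto
  have V: "V = (to_mat n n (glue {..<length Ss} i p (\<lambda>l. of_mat (fst (Ss ! l)))),
      to_mat n n (glue {..<length Ss} i p (\<lambda>l. of_mat (snd (Ss ! l)))))"
    unfolding Vf[symmetric] Vs[symmetric] using rep_variety_carrier[OF assms(1)] by simp
  have simp_Ss: "simple_pair (rep_dim (Ss ! l)) (of_mat (fst (Ss ! l))) (of_mat (snd (Ss ! l)))"
    if "l \<in> {..<length Ss}" for l
    by (rule simple_rep_simple_pair[OF simple]) (use that in simp)
  have main: ?thesis if "a < length Ss" "b < length Ss" "a \<noteq> b"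
    "deform (rep_dim (Ss ! a) + rep_dim (Ss ! b))
      (of_mat (fst (Ss ! a)) + inj2 (rep_dim (Ss ! a)) (rep_dim (Ss ! b)) * of_mat (fst (Ss ! b))
        * proj2 (rep_dim (Ss ! a)) (rep_dim (Ss ! b)))
      (of_mat (snd (Ss ! a)) + inj2 (rep_dim (Ss ! a)) (rep_dim (Ss ! b)) * of_mat (snd (Ss ! b))
        * proj2 (rep_dim (Ss ! a)) (rep_dim (Ss ! b)))" for a b
    by (rule two_components[OF D simp_Ss _ _ that(3,4) V]) (simp_all add: that(1,2))
  from assms(7) show ?thesis
  proof
    assume "\<exists>i j. 1 \<le> i \<and> i < j \<and> j \<le> k \<and> Ext1 (S i) (S j) \<noteq> {Ext1_zero (S i) (S j)}"
    then obtain i' j' where ij: "1 \<le> i'" "i' < j'" "j' \<le> k" "Ext1 (S i') (S j') \<noteq> {Ext1_zero (S i') (S j')}"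
      by (elim exE conjE)
    have mem: "i' \<in> {1..k}" "j' \<in> {1..k}" using ij by auto
    have inSs: "S l \<in> set Ss" if "l \<in> {1..k}" for l
    proof -
      have "S l \<in> set (replicate (e l) (S l))" using assms(4)[OF that] by simp
      moreover have "l \<in> set [1..<Suc k]" using that by auto
      ultimately have "S l \<in> (\<Union>i\<in>set [1..<Suc k]. set (replicate (e i) (S i)))" by (intro UN_I)
      then show ?thesis unfolding Ss_def set_concat set_map image_image .
    qed
    \<comment> \<open>An extension of \<open>S i'\<close> by \<open>S j'\<close> has
      \<open>S j'\<close> as its sub, so the position of \<open>S j'\<close> provides the first
      block of the deformation.\<close>
    obtain a where a: "a < length Ss" "Ss ! a = S j'" using inSs[OF mem(2)] by (metis in_set_conv_nth)
    obtain b where b: "b < length Ss" "Ss ! b = S i'" using inSs[OF mem(1)] by (metis in_set_conv_nth)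
    note sv = simple_rep_in_variety[OF assms(2)[OF mem(1)]] simple_rep_in_variety[OF assms(2)[OF mem(2)]]
    have ni: "\<not> rep_iso (S i') (S j')" "\<not> rep_iso (S j') (S i')"
      using assms(3)[OF mem] assms(3)[OF mem(2,1)] ij(2) by simp_all
    have "a \<noteq> b"
    proof
      assume "a = b"
      then have eq: "S i' = S j'" using a b by simp
      have szs: "sz (rep_dim (S i')) (rep_dim (S i')) (of_mat (fst (S i')))"
        "sz (rep_dim (S i')) (rep_dim (S i')) (of_mat (snd (S i')))"
        using rep_pairD(1,2)[OF rep_variety_rp[OF sv(1)]] by simp_all
      have "pair_iso (rep_dim (S i')) (of_mat (fst (S i'))) (of_mat (snd (S i')))
        (rep_dim (S i')) (of_mat (fst (S i'))) (of_mat (snd (S i')))"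
        unfolding pair_iso_def using szs
        by (intro conjI refl exI[of _ "E (rep_dim (S i'))"]) (simp_all del: rw_of_mat cl_of_mat)
      then have "rep_iso (S i') (S i')" by (rule rep_iso_pair_iso[OF sv(1) sv(1)])
      then show False using ni eq by simp
    qed
    from a(1) b(1) this show ?thesis
      by (rule main) (unfold a(2) b(2), rule Ext1_deform[OF assms(2)[OF mem(1)] assms(2)[OF mem(2)] ni ij(4)])
  next
    assume "\<exists>i. 1 \<le> i \<and> i \<le> k \<and> rep_dim (S i) \<ge> 3 \<and> e i \<ge> 2"
    then obtain i' where i': "1 \<le> i'" "i' \<le> k" "rep_dim (S i') \<ge> 3" "e i' \<ge> 2" by blast
    obtain a b where ab: "a < b" "b < length Ss" "Ss ! a = S i'" "Ss ! b = S i'"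
      using replicate_twice_positions[of i' k e S, OF i'(1,2,4)] unfolding Ss_def by blast
    have "simple_rep (S i')" using assms(2) i' by simp
    note def = double_deform[OF simple_rep_simple_pair[OF this] i'(3)]
    have "a < length Ss" "a \<noteq> b" using ab by simp_all
    from this(1) ab(2) this(2) show ?thesis by (rule main) (unfold ab(3,4), rule def)
  qed
qed

end
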